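(* For every $\delta_3>0$, all functions $\delta_2\colon\mathbb N\to(0,1]$ and $r\colon\mathbb N^2\to\mathbb N$, and all constants $\ell_0,t_0,s\in\mathbb N$, there exist $n_0,T\in\mathbb N$ such that for every $n\ge n_0$ and every family $(H_1,\dots,H_s)$ of $n$-vertex $3$-uniform hypergraphs on a common vertex set $V=V(H_1)=\dots=V(H_s)$, there are integers $t$ and $\ell$ with $t_0\le t\le T$ and $\ell_0\le\ell\le T$, a vertex partition $\mathcal V$ given by $V=V_1\,\dot\cup\cdots\dot\cup\,V_t$, and an $\ell$-equitable partition $\mathcal B$ with respect to $\mathcal V$, such that the following properties hold: (R.1) $|V_1|\le|V_2|\le\cdots\le|V_t|\le|V_1|+1$; (R.2) for all $1\le i<j\le t$ and $\alpha\in[\ell]$, the bipartite graph $B^{ij}_\alpha$ is $(\delta_2(\ell),1/\ell)$-regular; (R.3) $H_i$ is $\delta_2(\ell)$-weakly regular with respect to $\mathcal V$ for every $i\in[s]$; (R.4) $H_i$ is $(\delta_3,r(t,\ell))$-regular with respect to $\mathcal B$ for every $i\in[s]$.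
   Context: **Equitable pair partitions.** Given a partition $\mathcal V$: $V=V_1\dot\cup\cdots\dot\cup V_t$, let $K^{(2)}(\mathcal V)$ be the complete $t$-partite graph with classes $V_1,\dots,V_t$ and $K^{(2)}(V_i,V_j)$ the complete bipartite graph between $V_i$ and $V_j$. A partition $\mathcal B$ of (the edge set of) $K^{(2)}(\mathcal V)$ is $\ell$-equitable with respect to $\mathcal V$ if every $B\in\mathcal B$ is contained in some $K^{(2)}(V_i,V_j)$ with $i\ne j$, and for all distinct $i,j$ precisely $\ell$ members of $\mathcal B$ partition $K^{(2)}(V_i,V_j)$; these members are denoted $B^{ij}_1,\dots,B^{ij}_\ell$ (bipartite graphs with classes $V_i,V_j$). For $i<j<k$ and $\alpha,\beta,\gamma\in[\ell]$, the triad $B^{ijk}_{\alpha\beta\gamma}$ is the tripartite graph on $V_i\dot\cup V_j\dot\cup V_k$ with edge set $E(B^{ij}_\alpha)\cup E(B^{ik}_\beta)\cup E(B^{jk}_\gamma)$. **Graph regularity.** A bipartite graph $G$ with classes $A,B$ is $(\delta,d)$-regular if $\big|e_G(A',B')-d|A'||B'|\big|\le\delta|A||B|$ for all $A'\subseteq A$, $B'\subseteq B$. **Weak regularity.** For disjoint $X,Y,Z\subseteq V$, let $H[X,Y,Z]$ be the tripartite hypergraph of hyperedges of $H$ with exactly one vertex in each of $X,Y,Z$, and let $d=e(H[X,Y,Z])/(|X||Y||Z|)$. $H[X,Y,Z]$ is $\delta$-weakly regular if $\big|e_H(X',Y',Z')-d|X'||Y'||Z'|\big|\le\delta|X||Y||Z|$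 for all $X'\subseteq X$, $Y'\subseteq Y$, $Z'\subseteq Z$. $H$ is $\delta$-weakly regular with respect to $\mathcal V$ if $H[X,Y,Z]$ is $\delta$-weakly regular for all but at most $\delta\binom t3$ of the triples $\{X,Y,Z\}$ of distinct members of $\mathcal V$. **Strong regularity.** For a graph $G$, $\mathcal K_3(G)$ denotes the set of $3$-subsets of $V(G)$ spanning a triangle in $G$, and $d(H|G)=|E(H)\cap\mathcal K_3(G)|/|\mathcal K_3(G)|$ is the relative density. A tripartite hypergraph $H'$ is $(\delta,d,r)$-regular with respect to a tripartite graph $P$ on the same vertex classes if $$\bigg|\Big|\bigcup_{i=1}^r\big(E(H')\cap\mathcal K_3(Q_i)\big)\Big|-d\Big|\bigcup_{i=1}^r\mathcal K_3(Q_i)\Big|\bigg|\le\delta|\mathcal K_3(P)|$$ for every family of (not necessarily disjoint) subgraphs $Q_1,\dots,Q_r\subseteq P$ with $\big|\bigcup_{i=1}^r\mathcal K_3(Q_i)\big|\ge\delta|\mathcal K_3(P)|>0$. A hypergraph $H$ on $V$ is $(\delta,r)$-regular with respect to $\mathcal B$ if the union of the sets $\mathcal K_3(B^{ijk}_{\alpha\beta\gamma})$, taken over all triads of $\mathcal B$ (with $i<j<k$) for which $H[V_i,V_j,V_k]$ is not $\big(\delta,d(H|B^{ijk}_{\alpha\beta\gamma}),r\big)$-regular with respect to $B^{ijk}_{\alpha\beta\gamma}$, has size at most $\delta|V|^3$. (Triads containing no triangles contribute nothing.) *)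

theory Defs
  imports Complex_Main "HOL-Library.Disjoint_Sets" "HOL-Library.Ramsey"
begin

text \<open>
  Graphs and 3-uniform hypergraphs on a vertex set \<open>V\<close> are given by their edge sets, i.e. by subsets
  of \<^term>\<open>nsets V 2\<close> and \<^term>\<open>nsets V 3\<close>. Isolated vertices play no role in any of the notions
  below. Vertex classes and the members of a family of hypergraphs are indexed from \<open>1\<close>.
\<close>

type_synonym 'a edges = "'a set set"

definition vertex_partition :: "'a set \<Rightarrow> nat \<Rightarrow> (nat \<Rightarrow> 'a set) \<Rightarrow> bool" where
  "vertex_partition V t W \<longleftrightarrow>
     (\<Union>i\<in>{1..t}. W i) = V \<and> disjoint_family_on W {1..t} \<and> (\<forall>i\<in>{1..t}. W i \<noteq> {})"

definition complete_bipartite :: "'a set \<Rightarrow> 'a set \<Rightarrow> 'a edges" where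
  "complete_bipartite A B = {{a, b} |a b. a \<in> A \<and> b \<in> B}"

definition complete_multipartite :: "nat \<Rightarrow> (nat \<Rightarrow> 'a set) \<Rightarrow> 'a edges" where
  "complete_multipartite t W =
     (\<Union>i\<in>{1..t}. \<Union>j\<in>{1..t} - {i}. complete_bipartite (W i) (W j))"


subsection \<open>Equitable pair partitions\<close>

text \<open>
  \<open>pair_members W \<B> i j\<close> is the set \<open>{B\<^sup>i\<^sup>j\<^sub>1, \<dots>, B\<^sup>i\<^sup>j\<^sub>\<ell>}\<close>. The numbering of its elements is never
  used, so that quantification over \<open>\<alpha> \<in> [\<ell>]\<close> is quantification over this set.
\<close>

definition pair_members :: "(nat \<Rightarrow> 'a set) \<Rightarrow> 'a edges set \<Rightarrow> nat \<Rightarrow> nat \<Rightarrow> 'a edges set" where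
  "pair_members W \<B> i j = {B \<in> \<B>. B \<subseteq> complete_bipartite (W i) (W j)}"

definition equitable :: "nat \<Rightarrow> nat \<Rightarrow> (nat \<Rightarrow> 'a set) \<Rightarrow> 'a edges set \<Rightarrow> bool" where
  "equitable l t W \<B> \<longleftrightarrow>
     partition_on (complete_multipartite t W) \<B> \<and>
     (\<forall>B\<in>\<B>. \<exists>i\<in>{1..t}. \<exists>j\<in>{1..t}. i \<noteq> j \<and> B \<subseteq> complete_bipartite (W i) (W j)) \<and>
     (\<forall>i\<in>{1..t}. \<forall>j\<in>{1..t}. i \<noteq> j \<longrightarrow>
        card (pair_members W \<B> i j) = l \<and>
        partition_on (complete_bipartite (W i) (W j)) (pair_members W \<B> i j))"


subsection \<open>Graph regularity\<close>

text \<open>\<open>A\<close> and \<open>B\<close> are meant to be the (disjoint) classes of the bipartite graph \<open>G\<close>.\<close>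

definition graph_regular :: "real \<Rightarrow> real \<Rightarrow> 'a set \<Rightarrow> 'a set \<Rightarrow> 'a edges \<Rightarrow> bool" where
  "graph_regular \<delta> d A B G \<longleftrightarrow>
     (\<forall>A' B'. A' \<subseteq> A \<and> B' \<subseteq> B \<longrightarrow>
        \<bar>real (card (G \<inter> complete_bipartite A' B')) - d * real (card A') * real (card B')\<bar>
          \<le> \<delta> * real (card A) * real (card B))"


subsection \<open>Weak regularity\<close>

text \<open>
  For pairwise disjoint \<open>X\<close>, \<open>Y\<close>, \<open>Z\<close> and subsets \<open>X'\<close>, \<open>Y'\<close>, \<open>Z'\<close> of them, \<open>e\<^sub>H(X', Y', Z')\<close> is
  \<open>card (hyp_restrict H X' Y' Z')\<close>.
\<close>

definition hyp_restrict :: "'a edges \<Rightarrow> 'a set \<Rightarrow> 'a set \<Rightarrow> 'a set \<Rightarrow> 'a edges" where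
  "hyp_restrict H X Y Z = {e \<in> H. card (e \<inter> X) = 1 \<and> card (e \<inter> Y) = 1 \<and> card (e \<inter> Z) = 1}"

definition hyp_density :: "'a edges \<Rightarrow> 'a set \<Rightarrow> 'a set \<Rightarrow> 'a set \<Rightarrow> real" where
  "hyp_density H X Y Z =
     real (card (hyp_restrict H X Y Z)) / (real (card X) * real (card Y) * real (card Z))"

definition weakly_regular_triple ::
    "real \<Rightarrow> 'a edges \<Rightarrow> 'a set \<Rightarrow> 'a set \<Rightarrow> 'a set \<Rightarrow> bool" where
  "weakly_regular_triple \<delta> H X Y Z \<longleftrightarrow>
     (\<forall>X' Y' Z'. X' \<subseteq> X \<and> Y' \<subseteq> Y \<and> Z' \<subseteq> Z \<longrightarrow>
        \<bar>real (card (hyp_restrict H X' Y' Z'))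
           - hyp_density H X Y Z * real (card X') * real (card Y') * real (card Z')\<bar>
          \<le> \<delta> * real (card X) * real (card Y) * real (card Z))"

definition weakly_regular :: "real \<Rightarrow> nat \<Rightarrow> (nat \<Rightarrow> 'a set) \<Rightarrow> 'a edges \<Rightarrow> bool" where
  "weakly_regular \<delta> t W H \<longleftrightarrow>
     real (card {(i, j, k). 1 \<le> i \<and> i < j \<and> j < k \<and> k \<le> t \<and>
                   \<not> weakly_regular_triple \<delta> H (W i) (W j) (W k)})
       \<le> \<delta> * real (t choose 3)"


subsection \<open>Strong regularity\<close>

definition triangles :: "'a edges \<Rightarrow> 'a edges" where
  "triangles G = {T. card T = 3 \<and> nsets T 2 \<subseteq> G}"

definition relative_density :: "'a edges \<Rightarrow> 'a edges \<Rightarrow> real" where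
  "relative_density H G = real (card (H \<inter> triangles G)) / real (card (triangles G))"

definition regular_wrt_graph ::
    "real \<Rightarrow> real \<Rightarrow> nat \<Rightarrow> 'a edges \<Rightarrow> 'a edges \<Rightarrow> bool" where
  "regular_wrt_graph \<delta> d r P H \<longleftrightarrow>
     (\<forall>Q :: nat \<Rightarrow> 'a edges.
        (\<forall>i\<in>{1..r}. Q i \<subseteq> P) \<and>
        real (card (\<Union>i\<in>{1..r}. triangles (Q i))) \<ge> \<delta> * real (card (triangles P)) \<and>
        \<delta> * real (card (triangles P)) > 0 \<longrightarrow>
        \<bar>real (card (\<Union>i\<in>{1..r}. H \<inter> triangles (Q i)))
           - d * real (card (\<Union>i\<in>{1..r}. triangles (Q i)))\<bar>
          \<le> \<delta> * real (card (triangles P)))"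

text \<open>
  The triads on \<open>W i\<close>, \<open>W j\<close>, \<open>W k\<close> are the graphs \<open>B1 \<union> B2 \<union> B3\<close> with \<open>B1\<close>, \<open>B2\<close>, \<open>B3\<close> among the
  members of the partition for the pairs \<open>ij\<close>, \<open>ik\<close>, \<open>jk\<close>, respectively.
\<close>

definition irregular_triads ::
    "real \<Rightarrow> nat \<Rightarrow> nat \<Rightarrow> (nat \<Rightarrow> 'a set) \<Rightarrow> 'a edges set \<Rightarrow> 'a edges \<Rightarrow> 'a edges set" where
  "irregular_triads \<delta> r t W \<B> H =
     {P. \<exists>i j k B1 B2 B3. 1 \<le> i \<and> i < j \<and> j < k \<and> k \<le> t \<and>
           B1 \<in> pair_members W \<B> i j \<and> B2 \<in> pair_members W \<B> i k \<and> B3 \<in> pair_members W \<B> j k \<and>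
           P = B1 \<union> B2 \<union> B3 \<and>
           \<not> regular_wrt_graph \<delta> (relative_density H P) r P (hyp_restrict H (W i) (W j) (W k))}"

definition regular_wrt_partition ::
    "real \<Rightarrow> nat \<Rightarrow> 'a set \<Rightarrow> nat \<Rightarrow> (nat \<Rightarrow> 'a set) \<Rightarrow> 'a edges set \<Rightarrow> 'a edges \<Rightarrow> bool" where
  "regular_wrt_partition \<delta> r V t W \<B> H \<longleftrightarrow>
     real (card (\<Union>P\<in>irregular_triads \<delta> r t W \<B> H. triangles P)) \<le> \<delta> * real (card V) ^ 3"

end

theory Submission
  imports Defs
begin

text \<open>
  Let the residual of a hypergraph be the squared \<open>L\<^sup>2\<close> distance of its indicator function to the
  functions that are constant on each set of triples with the same triad. If the hypergraph is
  irregular, the families \<open>Q\<^sub>1, \<dots>, Q\<^sub>r\<close> that witness this lower the residual by at least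
  \<open>\<delta>\<^sub>3\<^sup>3 n\<^sup>3\<close> when they are added to the partition. Passing to a new equitable structure in which
  each of these boundedly many graphs is, up to \<open>\<epsilon>n\<^sup>2\<close> pairs, a union of members, keeps at least
  half of this gain. Hence boundedly many steps suffice.

  To obtain the new structure one chooses \<open>\<ell>\<close> first, in terms of the number of graphs and of \<open>\<epsilon>\<close>
  only, so that \<open>\<delta>\<^sub>2(\<ell>)\<close> becomes a constant. The same residual argument on triples of vertices,
  with boxes as witnesses, yields an equipartition that is regular for the hypergraphs and for the
  colour classes generated by the graphs. A random assignment of \<open>\<ell>\<close> labels then cuts each colour
  class of a regular pair into slices of density \<open>1/\<ell>\<close>, except for at most one slice per colour
  that mixes colours.
\<close>

subsection \<open>Mean square distance to a partition\<close>

text \<open>Members of density \<open>1 / l\<close> with prescribed regularity cannot in general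
  refine given graphs exactly, so exceptional pairs are unavoidable. The residual tolerates them:
  any function of the new labels bounds it from above, and a triple on which this function goes
  wrong costs at most a constant. For the same reason the new structure may be built from scratch.
  It refines neither the old classes nor the old members; it suffices to put the old members, next
  to the witnesses, into the family of graphs to be approximated. Off the exceptional triples the
  new triad of a triple then determines its old triad and the witnesses that contain it.
  Consequently \<open>\<epsilon>\<close> and the number of rounds depend on \<open>\<delta>3\<close>
  and \<open>s\<close> only. What grows from round to round is the number of graphs, which depends
  on the previous \<open>t\<close>, \<open>l\<close> and \<open>r t l\<close>. With \<open>l\<close>
  fixed before the vertex classes, the required accuracy of graph and weak regularity is known when
  the classes are chosen, and a single regularization of ternary relations provides both, with
  \<open>t\<close> free to be huge in terms of \<open>l\<close>.\<close>

definition fibre :: "'b set \<Rightarrow> ('b \<Rightarrow> 'l) \<Rightarrow> 'l \<Rightarrow> 'b set" where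
  "fibre \<Omega> \<pi> b = {\<omega>\<in>\<Omega>. \<pi> \<omega> = b}"

definition fibre_density :: "'b set \<Rightarrow> ('b \<Rightarrow> 'l) \<Rightarrow> 'b set \<Rightarrow> 'l \<Rightarrow> real" where
  "fibre_density \<Omega> \<pi> H b = real (card (H \<inter> fibre \<Omega> \<pi> b)) / real (card (fibre \<Omega> \<pi> b))"

text \<open>For finite \<open>\<Omega>\<close> this is \<open>card (H \<inter> \<Omega>)\<close>
  minus the usual index, the sum over \<open>\<Omega>\<close> of the squared density of the fibre of
  each point. In this form an upper bound needs only one competitor, and two labellings can be
  compared although neither refines the other.\<close>

definition residual :: "'b set \<Rightarrow> ('b \<Rightarrow> 'l) \<Rightarrow> 'b set \<Rightarrow> real" where
  "residual \<Omega> \<pi> H = (\<Sum>\<omega>\<in>\<Omega>. (of_bool (\<omega> \<in> H) - fibre_density \<Omega> \<pi> H (\<pi> \<omega>))\<^sup>2)"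

lemma finite_fibre [simp]: "finite \<Omega> \<Longrightarrow> finite (fibre \<Omega> \<pi> b)"
  by (simp add: fibre_def)

lemma sum_of_bool_card: "finite A \<Longrightarrow> (\<Sum>\<omega>\<in>A. of_bool (\<omega> \<in> H)) = real (card (H \<inter> A))"
  by (simp add: Int_commute of_bool_def sum.If_cases flip: sum.inter_filter)

lemma sum_over_fibres:
  assumes "finite \<Omega>"
  shows "(\<Sum>\<omega>\<in>\<Omega>. g \<omega>) = (\<Sum>b\<in>\<pi> ` \<Omega>. \<Sum>\<omega>\<in>fibre \<Omega> \<pi> b. g \<omega>)"
  unfolding fibre_def using sum.image_gen[OF assms] .

lemma fibre_density_bounds: "0 \<le> fibre_density \<Omega> \<pi> H b" 
  "finite \<Omega> \<Longrightarrow> fibre_density \<Omega> \<pi> H b \<le> 1"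
  unfolding fibre_density_def
  by (auto intro!: divide_le_eq_1_pos[THEN iffD2] card_mono simp: divide_le_eq)

lemma sum_fibre_deviation:
  assumes "finite \<Omega>"
  shows "(\<Sum>\<omega>\<in>fibre \<Omega> \<pi> b. of_bool (\<omega> \<in> H) - fibre_density \<Omega> \<pi> H b) = 0"
proof (cases "fibre \<Omega> \<pi> b = {}")
  case False
  then have "card (fibre \<Omega> \<pi> b) > 0" using assms by (simp add: card_gt_0_iff)
  then show ?thesis
    using assms by (simp add: sum_subtractf sum_of_bool_card fibre_density_def Int_commute del: sum_of_bool_eq)
qed simp

lemma residual_nonneg: "0 \<le> residual \<Omega> \<pi> H"
  unfolding residual_def by (simp add: sum_nonneg)

text \<open>On a fibre the mean is the best constant: in the expansion around the density the cross
  term vanishes by \<open>sum_fibre_deviation\<close>.\<close>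

lemma residual_le_measurable:
  assumes "finite \<Omega>"
  shows "residual \<Omega> \<pi> H \<le> (\<Sum>\<omega>\<in>\<Omega>. (of_bool (\<omega> \<in> H) - \<phi> (\<pi> \<omega>))\<^sup>2)"
proof -
  have "(\<Sum>\<omega>\<in>fibre \<Omega> \<pi> b. (of_bool (\<omega> \<in> H) - fibre_density \<Omega> \<pi> H (\<pi> \<omega>))\<^sup>2)
      \<le> (\<Sum>\<omega>\<in>fibre \<Omega> \<pi> b. (of_bool (\<omega> \<in> H) - \<phi> (\<pi> \<omega>))\<^sup>2)" for b
  proof -
    let ?d = "fibre_density \<Omega> \<pi> H b" and ?F = "fibre \<Omega> \<pi> b"
    have "(\<Sum>\<omega>\<in>?F. (of_bool (\<omega> \<in> H) - \<phi> (\<pi> \<omega>))\<^sup>2)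
        = (\<Sum>\<omega>\<in>?F. (of_bool (\<omega> \<in> H) - ?d)\<^sup>2 + 2 * (?d - \<phi> b) * (of_bool (\<omega> \<in> H) - ?d) + (?d - \<phi> b)\<^sup>2)"
      by (rule sum.cong) (auto simp: fibre_def power2_eq_square algebra_simps)
    also have "\<dots> = (\<Sum>\<omega>\<in>?F. (of_bool (\<omega> \<in> H) - ?d)\<^sup>2) + card ?F * (?d - \<phi> b)\<^sup>2"
      using sum_fibre_deviation[OF assms, where b = b and \<pi> = \<pi> and H = H]
      by (simp only: sum.distrib flip: sum_distrib_left) simp
    also have "(\<Sum>\<omega>\<in>?F. (of_bool (\<omega> \<in> H) - ?d)\<^sup>2)
        = (\<Sum>\<omega>\<in>?F. (of_bool (\<omega> \<in> H) - fibre_density \<Omega> \<pi> H (\<pi> \<omega>))\<^sup>2)"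
      by (rule sum.cong) (auto simp: fibre_def)
    finally show ?thesis by simp
  qed
  then show ?thesis
    unfolding residual_def sum_over_fibres[OF assms, of _ \<pi>] by (rule sum_mono)
qed

lemma residual_le_card: "finite \<Omega> \<Longrightarrow> residual \<Omega> \<pi> H \<le> card \<Omega>"
  by (rule order_trans[OF residual_le_measurable[where \<phi> = "\<lambda>_. 0"]])
     (auto intro!: order_trans[OF sum_bounded_above[where K = 1]])

text \<open>
  The competitor that lowers the residual is the fibre density, shifted by \<open>\<plusminus>\<delta>\<close> on \<open>U\<close>. It takes
  values in \<open>[-1, 2]\<close>, so every point of \<open>X\<close> costs at most \<open>4\<close>.
\<close>

lemma residual_increment:
  fixes \<pi> :: "'b \<Rightarrow> 'l" and \<pi>' :: "'b \<Rightarrow> 'k" and \<delta> :: real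
  assumes fin: "finite \<Omega>" and \<delta>: "0 \<le> \<delta>" "\<delta> \<le> 1" and X: "X \<subseteq> \<Omega>"
    and bad: "\<And>b. b \<in> B \<Longrightarrow> \<delta> * card (fibre \<Omega> \<pi> b)
          \<le> \<bar>real (card (H \<inter> U \<inter> fibre \<Omega> \<pi> b))
               - fibre_density \<Omega> \<pi> H b * card (U \<inter> fibre \<Omega> \<pi> b)\<bar>"
    and factor: "\<And>\<omega> \<omega>'. \<omega> \<in> \<Omega> - X \<Longrightarrow> \<omega>' \<in> \<Omega> - X \<Longrightarrow> \<pi>' \<omega> = \<pi>' \<omega>'
          \<Longrightarrow> \<pi> \<omega> = \<pi> \<omega>' \<and> (\<omega> \<in> U \<longleftrightarrow> \<omega>' \<in> U)"
  shows "residual \<Omega> \<pi>' H \<le> residual \<Omega> \<pi> H - \<delta>\<^sup>2 * card {\<omega>\<in>\<Omega>. \<pi> \<omega> \<in> B} + 4 * card X"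
proof -
  define d where "d = fibre_density \<Omega> \<pi> H"
  define h where "h = (\<lambda>\<omega>. of_bool (\<omega> \<in> H) :: real)"
  \<comment> \<open>The sign follows the deviation of \<open>U\<close> on the fibre. The cross term
    then gains at least \<open>2 * \<delta>\<^sup>2\<close> per point of a bad fibre, and the
    quadratic term gives back at most \<open>\<delta>\<^sup>2\<close>.\<close>
  define c where "c b = (if b \<notin> B then 0
      else if d b * card (U \<inter> fibre \<Omega> \<pi> b) \<le> card (H \<inter> U \<inter> fibre \<Omega> \<pi> b) then \<delta> else - \<delta>)" for b
  define g where "g \<omega> = d (\<pi> \<omega>) + c (\<pi> \<omega>) * of_bool (\<omega> \<in> U)" for \<omega>
  have d01: "0 \<le> d b" "d b \<le> 1" for b
    using fibre_density_bounds fin by (auto simp: d_def)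
  have g_bound: "\<bar>h \<omega> - g \<omega>\<bar> \<le> 2" for \<omega>
    using d01[of "\<pi> \<omega>"] \<delta> by (auto simp: h_def g_def c_def)
  have on_fibre: "(\<Sum>\<omega>\<in>fibre \<Omega> \<pi> b. (h \<omega> - g \<omega>)\<^sup>2)
      \<le> (\<Sum>\<omega>\<in>fibre \<Omega> \<pi> b. (h \<omega> - d (\<pi> \<omega>))\<^sup>2) - \<delta>\<^sup>2 * (\<Sum>\<omega>\<in>fibre \<Omega> \<pi> b. of_bool (\<pi> \<omega> \<in> B))"
    (is "?L \<le> ?R") for b
  proof -
    let ?F = "fibre \<Omega> \<pi> b"
    have fF: "finite ?F" using fin by simp
    have "?L = (\<Sum>\<omega>\<in>?F. (h \<omega> - d (\<pi> \<omega>))\<^sup>2 - 2 * c b * (h \<omega> - d b) * of_bool (\<omega> \<in> U) + (c b)\<^sup>2 * of_bool (\<omega> \<in> U))"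
      by (rule sum.cong) (auto simp: fibre_def g_def power2_eq_square algebra_simps)
    also have "\<dots> = (\<Sum>\<omega>\<in>?F. (h \<omega> - d (\<pi> \<omega>))\<^sup>2) - 2 * c b * (\<Sum>\<omega>\<in>?F. (h \<omega> - d b) * of_bool (\<omega> \<in> U)) + (c b)\<^sup>2 * card (U \<inter> ?F)"
      by (simp add: sum.distrib sum_subtractf sum_of_bool_card[OF fF, symmetric] sum_distrib_left mult.assoc del: sum_of_bool_eq)
    also have "(\<Sum>\<omega>\<in>?F. (h \<omega> - d b) * of_bool (\<omega> \<in> U)) = (\<Sum>\<omega>\<in>?F. of_bool (\<omega> \<in> H \<inter> U) - d b * of_bool (\<omega> \<in> U))"
      by (rule sum.cong) (auto simp: h_def)
    also have "\<dots> = card (H \<inter> U \<inter> ?F) - d b * card (U \<inter> ?F)"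
      by (simp only: sum_subtractf sum_of_bool_card[OF fF] flip: sum_distrib_left)
    finally have L: "?L = (\<Sum>\<omega>\<in>?F. (h \<omega> - d (\<pi> \<omega>))\<^sup>2)
        - 2 * c b * (card (H \<inter> U \<inter> ?F) - d b * card (U \<inter> ?F)) + (c b)\<^sup>2 * card (U \<inter> ?F)" .
    show ?thesis
    proof (cases "b \<in> B")
      case False
      then have "(\<Sum>\<omega>\<in>?F. of_bool (\<pi> \<omega> \<in> B) :: real) = 0"
        by (intro sum.neutral) (auto simp: fibre_def)
      with L False show ?thesis by (simp add: c_def)
    next
      case True
      have "(\<Sum>\<omega>\<in>?F. of_bool (\<pi> \<omega> \<in> B) :: real) = (\<Sum>\<omega>\<in>?F. 1)"
        using True by (intro sum.cong) (auto simp: fibre_def)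
      then have cB: "(\<Sum>\<omega>\<in>?F. of_bool (\<pi> \<omega> \<in> B) :: real) = card ?F" by simp
      have "c b * (card (H \<inter> U \<inter> ?F) - d b * card (U \<inter> ?F))
          = \<delta> * \<bar>card (H \<inter> U \<inter> ?F) - d b * card (U \<inter> ?F)\<bar>"
        using True by (auto simp: c_def algebra_simps)
      also have "\<dots> \<ge> \<delta> * (\<delta> * card ?F)"
        using bad[OF True] \<delta> unfolding d_def by (intro mult_left_mono) auto
      finally have 1: "c b * (card (H \<inter> U \<inter> ?F) - d b * card (U \<inter> ?F)) \<ge> \<delta>\<^sup>2 * card ?F"
        by (simp add: power2_eq_square)
      have "(c b)\<^sup>2 * card (U \<inter> ?F) \<le> \<delta>\<^sup>2 * card ?F"
        using True fF by (auto simp: c_def intro!: mult_left_mono card_mono)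
      with 1 L cB show ?thesis by simp
    qed
  qed
  have "(\<Sum>\<omega>\<in>\<Omega>. (h \<omega> - g \<omega>)\<^sup>2)
     \<le> (\<Sum>b\<in>\<pi> ` \<Omega>. (\<Sum>\<omega>\<in>fibre \<Omega> \<pi> b. (h \<omega> - d (\<pi> \<omega>))\<^sup>2) - \<delta>\<^sup>2 * (\<Sum>\<omega>\<in>fibre \<Omega> \<pi> b. of_bool (\<pi> \<omega> \<in> B)))"
    unfolding sum_over_fibres[OF fin, of _ \<pi>] by (rule sum_mono) (rule on_fibre)
  also have "\<dots> = (\<Sum>\<omega>\<in>\<Omega>. (h \<omega> - d (\<pi> \<omega>))\<^sup>2) - \<delta>\<^sup>2 * (\<Sum>\<omega>\<in>\<Omega>. of_bool (\<pi> \<omega> \<in> B))"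
    by (simp only: sum_over_fibres[OF fin, of _ \<pi>] sum_subtractf sum_distrib_left)
  also have "(\<Sum>\<omega>\<in>\<Omega>. of_bool (\<pi> \<omega> \<in> B) :: real) = card {\<omega>\<in>\<Omega>. \<pi> \<omega> \<in> B}"
    using sum_of_bool_card[OF fin, of "{\<omega>. \<pi> \<omega> \<in> B}"] by (simp add: Collect_conj_eq Int_commute)
  also have "(\<Sum>\<omega>\<in>\<Omega>. (h \<omega> - d (\<pi> \<omega>))\<^sup>2) = residual \<Omega> \<pi> H"
    by (simp add: residual_def h_def d_def)
  finally have hg: "(\<Sum>\<omega>\<in>\<Omega>. (h \<omega> - g \<omega>)\<^sup>2) \<le> residual \<Omega> \<pi> H - \<delta>\<^sup>2 * card {\<omega>\<in>\<Omega>. \<pi> \<omega> \<in> B}" .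
  \<comment> \<open>By \<open>factor\<close>, \<open>g\<close> is constant on each value of
    \<open>\<pi>'\<close> outside \<open>X\<close>, so a chosen representative defines
    \<open>\<phi>\<close>. The default 0 for labels that occur only on \<open>X\<close> also stays
    within distance 2 of an indicator.\<close>
  define \<phi> where "\<phi> l = (if \<exists>\<omega>\<in>\<Omega> - X. \<pi>' \<omega> = l then g (SOME \<omega>. \<omega> \<in> \<Omega> - X \<and> \<pi>' \<omega> = l) else 0)" for l
  have off: "\<phi> (\<pi>' \<omega>) = g \<omega>" if "\<omega> \<in> \<Omega> - X" for \<omega>
  proof -
    define \<omega>' where "\<omega>' = (SOME \<omega>'. \<omega>' \<in> \<Omega> - X \<and> \<pi>' \<omega>' = \<pi>' \<omega>)"
    have "\<omega>' \<in> \<Omega> - X \<and> \<pi>' \<omega>' = \<pi>' \<omega>" unfolding \<omega>'_def by (rule someI[of _ \<omega>]) (use that in auto)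
    with factor[of \<omega>' \<omega>] that have "g \<omega>' = g \<omega>" by (auto simp: g_def)
    then show ?thesis using that unfolding \<phi>_def \<omega>'_def by auto
  qed
  have \<phi>b: "(h \<omega> - \<phi> l)\<^sup>2 \<le> 4" for \<omega> l
  proof -
    have "\<bar>h \<omega> - \<phi> l\<bar> \<le> 2"
    proof (cases "\<exists>\<omega>\<in>\<Omega> - X. \<pi>' \<omega> = l")
      case True
      define \<omega>' where "\<omega>' = (SOME \<omega>'. \<omega>' \<in> \<Omega> - X \<and> \<pi>' \<omega>' = l)"
      have "\<phi> l = g \<omega>'" using True by (auto simp: \<phi>_def \<omega>'_def)
      then show ?thesis
        using d01[of "\<pi> \<omega>'"] \<delta> by (auto simp: h_def g_def c_def)
    qed (auto simp: \<phi>_def h_def)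
    then have "\<bar>h \<omega> - \<phi> l\<bar>\<^sup>2 \<le> 2\<^sup>2" by (intro power_mono) auto
    then show ?thesis by simp
  qed
  have fX: "finite X" using X fin finite_subset by blast
  have "residual \<Omega> \<pi>' H \<le> (\<Sum>\<omega>\<in>\<Omega>. (h \<omega> - \<phi> (\<pi>' \<omega>))\<^sup>2)"
    unfolding h_def by (rule residual_le_measurable[OF fin])
  also have "\<dots> \<le> (\<Sum>\<omega>\<in>\<Omega>. (h \<omega> - g \<omega>)\<^sup>2 + 4 * of_bool (\<omega> \<in> X))"
    by (rule sum_mono) (use off \<phi>b in \<open>auto intro: order_trans[OF _ le_add_same_cancel2[THEN iffD2]]\<close>)
  also have "\<dots> = (\<Sum>\<omega>\<in>\<Omega>. (h \<omega> - g \<omega>)\<^sup>2) + 4 * card (X \<inter> \<Omega>)"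
    by (simp only: sum.distrib sum_of_bool_card[OF fin] flip: sum_distrib_left)
  also have "X \<inter> \<Omega> = X" using X by blast
  finally show ?thesis using hg by simp
qed

subsection \<open>Equipartitions\<close>

text \<open>The last \<open>n mod t\<close> classes receive the additional vertex, so that sizes
  increase with the index, as the theorem demands.\<close>

definition equi_size :: "nat \<Rightarrow> nat \<Rightarrow> nat \<Rightarrow> nat" where
  "equi_size n t i = n div t + of_bool (t - n mod t < i)"

definition equipartition :: "'a set \<Rightarrow> nat \<Rightarrow> ('a \<Rightarrow> nat) \<Rightarrow> bool" where
  "equipartition V t w \<longleftrightarrow>
     (\<forall>x\<in>V. w x \<in> {1..t}) \<and> (\<forall>i\<in>{1..t}. card {x\<in>V. w x = i} = equi_size (card V) t i)"

lemma sum_equi_size: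
  assumes "1 \<le> t"
  shows "(\<Sum>i\<in>{1..t}. equi_size n t i) = n"
proof -
  have "{1..t} \<inter> {i. t - n mod t < i} = {t - n mod t + 1..t}" by auto
  moreover have "n mod t < t" using assms by simp
  ultimately have "(\<Sum>i\<in>{1..t}. of_bool (t - n mod t < i)) = n mod t"
    by (simp add: of_bool_def sum.If_cases)
  then show ?thesis by (simp add: equi_size_def sum.distrib)
qed

text \<open>
  Classes are cut greedily, each inside a single fibre of \<open>a\<close>, as long as some fibre is large
  enough. The vertices left over then, less than one class per fibre, form the exceptional set \<open>Y\<close>.
\<close>

lemma approximating_partition:
  fixes t :: nat
  assumes "finite V" "card (a ` V) \<le> K" "\<And>i. i \<in> {1..t} \<Longrightarrow> s i \<le> S" "(\<Sum>i\<in>{1..t}. s i) = card V"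
  shows "\<exists>w Y. (\<forall>x\<in>V. w x \<in> {1..t}) \<and> (\<forall>i\<in>{1..t}. card {x\<in>V. w x = i} = s i) \<and>
    Y \<subseteq> V \<and> card Y \<le> K * S \<and> (\<forall>x\<in>V - Y. \<forall>x'\<in>V - Y. w x = w x' \<longrightarrow> a x = a x')"
  using assms
proof (induction t arbitrary: V)
  case 0
  then have "V = {}" by simp
  then show ?case by auto
next
  case (Suc t)
  let ?m = "s (Suc t)"
  have m: "?m \<le> card V" "(\<Sum>i\<in>{1..t}. s i) = card V - ?m"
    using Suc.prems(4) by auto
  \<comment> \<open>The last class \<open>S0\<close> is cut off and the induction hypothesis is
    applied to the rest. Two points of \<open>S0\<close> are not compared here: whether they lie in
    one fibre of \<open>a\<close> depends on how \<open>S0\<close> was chosen.\<close>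
  have extend: "\<exists>w Y. (\<forall>x\<in>V. w x \<in> {1..Suc t}) \<and> (\<forall>i\<in>{1..Suc t}. card {x\<in>V. w x = i} = s i) \<and>
      Y \<subseteq> V - S0 \<and> card Y \<le> K * S \<and>
      (\<forall>x\<in>V - S0 - Y. \<forall>x'\<in>V - Y. w x = w x' \<longrightarrow> x' \<notin> S0 \<and> a x = a x')"
    if S0: "S0 \<subseteq> V" "card S0 = ?m" for S0
  proof -
    have "card (a ` (V - S0)) \<le> K"
      using Suc.prems(1,2) by (meson Diff_subset card_mono finite_imageI image_mono le_trans)
    moreover have "card (V - S0) = card V - ?m"
      using S0 Suc.prems(1) by (simp add: card_Diff_subset finite_subset)
    ultimately have "\<exists>w Y. (\<forall>x\<in>V - S0. w x \<in> {1..t}) \<and> (\<forall>i\<in>{1..t}. card {x\<in>V - S0. w x = i} = s i) \<and>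
      Y \<subseteq> V - S0 \<and> card Y \<le> K * S \<and> (\<forall>x\<in>V - S0 - Y. \<forall>x'\<in>V - S0 - Y. w x = w x' \<longrightarrow> a x = a x')"
      using Suc.prems(1,3) m(2) by (intro Suc.IH) simp_all
    then obtain w Y where w: "\<forall>x\<in>V - S0. w x \<in> {1..t}"
      "\<forall>i\<in>{1..t}. card {x\<in>V - S0. w x = i} = s i" "Y \<subseteq> V - S0" "card Y \<le> K * S"
      "\<forall>x\<in>V - S0 - Y. \<forall>x'\<in>V - S0 - Y. w x = w x' \<longrightarrow> a x = a x'"
      by (elim exE conjE)
    define w' where "w' x = (if x \<in> S0 then Suc t else w x)" for x
    have "w x \<noteq> Suc t" if "x \<in> V - S0" for x
      using bspec[OF w(1) that] by simp
    then have "{x\<in>V. w' x = Suc t} = S0" using S0 by (auto simp: w'_def)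
    moreover have "{x\<in>V. w' x = i} = {x\<in>V - S0. w x = i}" if "i \<in> {1..t}" for i
      using that by (auto simp: w'_def)
    ultimately have "\<forall>i\<in>{1..Suc t}. card {x\<in>V. w' x = i} = s i"
      using w(2) S0 by (simp add: atLeastAtMostSuc_conv)
    moreover have "w' x \<in> {1..Suc t}" if "x \<in> V" for x
      using w(1) that by (cases "x \<in> S0") (simp_all add: w'_def le_SucI)
    moreover have "x' \<notin> S0 \<and> a x = a x'"
      if "x \<in> V - S0 - Y" "x' \<in> V - Y" "w' x = w' x'" for x x'
    proof -
      have "w x \<noteq> Suc t" using w(1) that(1) by (metis DiffD1 Suc_n_not_le_n atLeastAtMost_iff)
      then have "x' \<notin> S0" using that by (auto simp: w'_def split: if_splits)
      moreover have "w x = w x'" using that calculation by (simp add: w'_def)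
      ultimately show ?thesis using w(5) that by blast
    qed
    ultimately show ?thesis using w(3,4) by blast
  qed
  show ?case
  proof (cases "\<exists>c. ?m \<le> card {x\<in>V. a x = c}")
    case True
    then obtain c S0 where S0: "S0 \<subseteq> {x\<in>V. a x = c}" "card S0 = ?m"
      by (meson obtain_subset_with_card_n)
    then have "S0 \<subseteq> V" by blast
    from extend[OF this S0(2)] obtain w Y where
      w: "\<forall>x\<in>V. w x \<in> {1..Suc t}" "\<forall>i\<in>{1..Suc t}. card {x\<in>V. w x = i} = s i"
        "Y \<subseteq> V - S0" "card Y \<le> K * S"
        "\<forall>x\<in>V - S0 - Y. \<forall>x'\<in>V - Y. w x = w x' \<longrightarrow> x' \<notin> S0 \<and> a x = a x'"
      by blast
    have "a x = a x'" if xx: "x \<in> V - Y" "x' \<in> V - Y" "w x = w x'" for x x'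
    proof (cases "x \<in> S0 \<and> x' \<in> S0")
      case True
      then show ?thesis using S0(1) by blast
    next
      case False
      then consider "x \<in> V - S0 - Y" | "x' \<in> V - S0 - Y" using xx by blast
      then show ?thesis
        by cases (use w(5) xx in metis)+
    qed
    moreover have "Y \<subseteq> V" using w(3) by blast
    ultimately show ?thesis using w(1,2,4) by blast
  next
    case False
    \<comment> \<open>Every fibre is smaller than the next class, so all of \<open>V\<close> is few
      vertices and can be taken as \<open>Y\<close>. Only the class sizes still have to be
      right.\<close>
    have "card V = (\<Sum>c\<in>a ` V. card {x\<in>V. a x = c})"
      using sum.image_gen[OF Suc.prems(1), of "\<lambda>_. 1::nat" a] by simp
    also have "\<dots> \<le> (\<Sum>c\<in>a ` V. S)"
    proof (rule sum_mono)
      fix c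
      have "card {x\<in>V. a x = c} \<le> ?m" "?m \<le> S" using False Suc.prems(3) nat_le_linear by auto
      then show "card {x\<in>V. a x = c} \<le> S" by simp
    qed
    also have "\<dots> \<le> K * S" using Suc.prems(2) by simp
    finally have "card V \<le> K * S" .
    moreover obtain S0 where "S0 \<subseteq> V" "card S0 = ?m" using m obtain_subset_with_card_n by metis
    then obtain w where "\<forall>x\<in>V. w x \<in> {1..Suc t}" "\<forall>i\<in>{1..Suc t}. card {x\<in>V. w x = i} = s i"
      using extend by metis
    ultimately show ?thesis by blast
  qed
qed

lemma approximating_equipartition:
  assumes "finite V" "card (a ` V) \<le> K" "1 \<le> t"
  obtains w Y where "equipartition V t w" "Y \<subseteq> V" "card Y \<le> K * (card V div t + 1)"
    "\<And>x x'. x \<in> V - Y \<Longrightarrow> x' \<in> V - Y \<Longrightarrow> w x = w x' \<Longrightarrow> a x = a x'"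
proof -
  have "equi_size (card V) t i \<le> card V div t + 1" for i by (simp add: equi_size_def)
  from approximating_partition[OF assms(1,2) this sum_equi_size[OF assms(3)]]
  show ?thesis using that unfolding equipartition_def by blast
qed

subsection \<open>Regularity of ternary relations\<close>

definition box_irregular :: "real \<Rightarrow> ('a \<times> 'b \<times> 'c) set \<Rightarrow> 'a set \<Rightarrow> 'b set \<Rightarrow> 'c set \<Rightarrow> bool" where
  "box_irregular \<delta> F X Y Z \<longleftrightarrow>
     (\<exists>X' Y' Z'. X' \<subseteq> X \<and> Y' \<subseteq> Y \<and> Z' \<subseteq> Z \<and>
        \<delta> * real (card (X \<times> Y \<times> Z)) < \<bar>real (card (F \<inter> X' \<times> Y' \<times> Z'))
          - real (card (F \<inter> X \<times> Y \<times> Z)) / real (card (X \<times> Y \<times> Z)) * real (card (X' \<times> Y' \<times> Z'))\<bar>)"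

definition triple_label :: "('a \<Rightarrow> 'l) \<Rightarrow> 'a \<times> 'a \<times> 'a \<Rightarrow> 'l \<times> 'l \<times> 'l" where
  "triple_label w = (\<lambda>(x, y, z). (w x, w y, w z))"

lemma fibre_triple_label:
  "fibre (V \<times> V \<times> V) (triple_label w) (i, j, k) = fibre V w i \<times> fibre V w j \<times> fibre V w k"
  by (auto simp: fibre_def triple_label_def)

lemma card_fibre_equipartition:
  "equipartition V t w \<Longrightarrow> i \<in> {1..t} \<Longrightarrow> card (fibre V w i) = equi_size (card V) t i"
  by (simp add: equipartition_def fibre_def)

lemma card_fibre_ge:
  assumes "equipartition V t w" "i \<in> {1..t}" "t \<le> card V"
  shows "card V / (2 * t) \<le> card (fibre V w i)"
proof -
  have t: "0 < t" using assms(2) by auto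
  then have "1 \<le> card V div t" using assms(3) div_greater_zero_iff[of "card V" t] by simp
  then have "(card V div t + 1) * t \<le> 2 * (card V div t) * t" by simp
  moreover have "card V \<le> (card V div t + 1) * t"
    using dividend_less_div_times[of t "card V"] t by (simp add: algebra_simps)
  ultimately have "card V \<le> (2 * (card V div t)) * t" by linarith
  then have "real (card V) \<le> real ((2 * (card V div t)) * t)" by (simp only: of_nat_le_iff)
  then have "real (card V) / (2 * t) \<le> card V div t" using t by (simp add: field_simps)
  also have "\<dots> \<le> card (fibre V w i)"
    using card_fibre_equipartition[OF assms(1,2)] by (simp add: equi_size_def)
  finally show ?thesis by simp
qed

definition irregular_boxes ::
    "real \<Rightarrow> 'a set \<Rightarrow> nat \<Rightarrow> ('a \<Rightarrow> nat) \<Rightarrow> ('a \<times> 'a \<times> 'a) set \<Rightarrow> (nat \<times> nat \<times> nat) set" where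
  "irregular_boxes \<delta> V t w F =
     {(i, j, k) \<in> {1..t} \<times> {1..t} \<times> {1..t}. box_irregular \<delta> F (fibre V w i) (fibre V w j) (fibre V w k)}"

text \<open>Every irregular box has a witness box, given by three vertex sets. The old classes and
  all these sets have at most \<open>2 ^ (t + 3 * M * t ^ 3)\<close> Venn atoms, and an
  equipartition into \<open>t'\<close> classes respects the atoms up to a small set
  \<open>Y\<close>. Off the triples meeting \<open>Y\<close> the new label determines the old box
  and membership in the union \<open>U F\<close> of the witnesses of \<open>F\<close>, so
  \<open>residual_increment\<close> applies to each relation.\<close>

lemma ternary_increment:
  fixes V :: "'a set" and \<F> :: "('a \<times> 'a \<times> 'a) set set" and \<delta> :: real
  assumes \<delta>: "0 < \<delta>" "\<delta> \<le> 1" and fin: "finite V" "finite \<F>" "card \<F> \<le> M"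
    and t: "1 \<le> t" "t \<le> card V" "equipartition V t w"
    and irr: "\<delta> * t ^ 3 < card (\<Union>F\<in>\<F>. irregular_boxes \<delta> V t w F)"
    and t': "1 \<le> t'" "t' \<le> card V" "384 * real M * 2 ^ (t + 3 * M * t ^ 3) / \<delta> ^ 3 \<le> t'"
  shows "\<exists>w'. equipartition V t' w' \<and>
    (\<Sum>F\<in>\<F>. residual (V \<times> V \<times> V) (triple_label w') F)
      \<le> (\<Sum>F\<in>\<F>. residual (V \<times> V \<times> V) (triple_label w) F) - \<delta> ^ 3 / 16 * card V ^ 3"
proof -
  define n where "n = card V"
  define \<Omega> where "\<Omega> = V \<times> V \<times> V"
  define K where "K = (2::nat) ^ (t + 3 * M * t ^ 3)"
  define bad where "bad F = irregular_boxes \<delta> V t w F" for F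
  have f\<Omega>: "finite \<Omega>" using fin by (simp add: \<Omega>_def)
  have badsub: "bad F \<subseteq> {1..t} \<times> {1..t} \<times> {1..t}" for F by (auto simp: bad_def irregular_boxes_def)
  have fbad: "finite (bad F)" for F using badsub by (rule finite_subset) simp
  have cbad: "card (bad F) \<le> t ^ 3" for F
    using card_mono[OF _ badsub[of F]] by (simp add: card_cartesian_product power3_eq_cube mult.assoc)
  have npos: "0 < n" using t by (simp add: n_def)
  define wits where "wits F b X' Y' Z' \<longleftrightarrow>
     X' \<subseteq> fibre V w (fst b) \<and> Y' \<subseteq> fibre V w (fst (snd b)) \<and> Z' \<subseteq> fibre V w (snd (snd b)) \<and>
     \<delta> * real (card (fibre \<Omega> (triple_label w) b)) < \<bar>real (card (F \<inter> X' \<times> Y' \<times> Z'))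
          - fibre_density \<Omega> (triple_label w) F b * real (card (X' \<times> Y' \<times> Z'))\<bar>" for F b X' Y' Z'
  have "\<exists>X' Y' Z'. wits F b X' Y' Z'" if "b \<in> bad F" for F b
  proof -
    obtain i j k where b: "b = (i, j, k)" by (cases b)
    with that have "box_irregular \<delta> F (fibre V w i) (fibre V w j) (fibre V w k)"
      by (auto simp: bad_def irregular_boxes_def)
    then show ?thesis
      unfolding box_irregular_def wits_def b fibre_density_def \<Omega>_def fibre_triple_label fst_conv snd_conv .
  qed
  then have ex: "\<exists>P. wits F b (fst P) (fst (snd P)) (snd (snd P))" if "b \<in> bad F" for F b
    using that by (metis fst_conv snd_conv)
  define P where "P F b = (SOME P. wits F b (fst P) (fst (snd P)) (snd (snd P)))" for F b
  define A1 where "A1 F b = fst (P F b)" for F b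
  define A2 where "A2 F b = fst (snd (P F b))" for F b
  define A3 where "A3 F b = snd (snd (P F b))" for F b
  have wits: "wits F b (A1 F b) (A2 F b) (A3 F b)" if "b \<in> bad F" for F b
    unfolding A1_def A2_def A3_def P_def by (rule someI_ex[OF ex[OF that]])
  note A = wits[unfolded wits_def, THEN conjunct1] wits[unfolded wits_def, THEN conjunct2, THEN conjunct1]
    wits[unfolded wits_def, THEN conjunct2, THEN conjunct2, THEN conjunct1]
  note wit = wits[unfolded wits_def, THEN conjunct2, THEN conjunct2, THEN conjunct2]
  define \<A> where "\<A> = fibre V w ` {1..t} \<union> (\<Union>F\<in>\<F>. \<Union>b\<in>bad F. {A1 F b, A2 F b, A3 F b})"
  have f\<A>: "finite \<A>" using fin fbad by (auto simp: \<A>_def)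
  have "card \<A> \<le> card (fibre V w ` {1..t}) + card (\<Union>F\<in>\<F>. \<Union>b\<in>bad F. {A1 F b, A2 F b, A3 F b})"
    unfolding \<A>_def by (rule card_Un_le)
  also have "\<dots> \<le> t + M * (t ^ 3 * 3)"
  proof (rule add_mono)
    show "card (fibre V w ` {1..t}) \<le> t" using card_image_le[of "{1..t}" "fibre V w"] by simp
    have "card (\<Union>b\<in>bad F. {A1 F b, A2 F b, A3 F b}) \<le> t ^ 3 * 3" for F
    proof -
      have "card (\<Union>b\<in>bad F. {A1 F b, A2 F b, A3 F b}) \<le> (\<Sum>b\<in>bad F. card {A1 F b, A2 F b, A3 F b})"
        by (rule card_UN_le[OF fbad])
      also have "\<dots> \<le> card (bad F) * 3"
        using sum_bounded_above[of "bad F" "\<lambda>b. card {A1 F b, A2 F b, A3 F b}" 3]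
        by (simp add: card_insert_if)
      also have "\<dots> \<le> t ^ 3 * 3" using cbad by simp
      finally show ?thesis .
    qed
    then have "(\<Sum>F\<in>\<F>. card (\<Union>b\<in>bad F. {A1 F b, A2 F b, A3 F b})) \<le> card \<F> * (t ^ 3 * 3)"
      using sum_bounded_above[of \<F> "\<lambda>F. card (\<Union>b\<in>bad F. {A1 F b, A2 F b, A3 F b})"] by simp
    also have "\<dots> \<le> M * (t ^ 3 * 3)" using fin by simp
    finally show "card (\<Union>F\<in>\<F>. \<Union>b\<in>bad F. {A1 F b, A2 F b, A3 F b}) \<le> M * (t ^ 3 * 3)"
      using card_UN_le[OF fin(2), of "\<lambda>F. \<Union>b\<in>bad F. {A1 F b, A2 F b, A3 F b}"] by linarith
  qed
  finally have c\<A>: "card \<A> \<le> t + 3 * M * t ^ 3" by (simp add: mult_ac)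
  \<comment> \<open>The Venn atom of \<open>x\<close>, given as the collection of sets that contain
    it.\<close>
  define a where "a x = {S\<in>\<A>. x \<in> S}" for x
  have "card (a ` V) \<le> card (Pow \<A>)" using f\<A> by (intro card_mono) (auto simp: a_def)
  also have "\<dots> \<le> K" using c\<A> f\<A> by (simp add: card_Pow K_def)
  finally have cK: "card (a ` V) \<le> K" .
  obtain w' Y where w': "equipartition V t' w'" and Y: "Y \<subseteq> V" "card Y \<le> K * (n div t' + 1)"
    and wY: "\<And>x x'. x \<in> V - Y \<Longrightarrow> x' \<in> V - Y \<Longrightarrow> w' x = w' x' \<Longrightarrow> a x = a x'"
    using approximating_equipartition[OF fin(1) cK t'(1)] unfolding n_def by blast
  have a_w: "w x = w x'" if "a x = a x'" "x \<in> V" for x x'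
  proof -
    have "w x \<in> {1..t}" using t(3) that(2) by (simp add: equipartition_def)
    then have "fibre V w (w x) \<in> a x" using that(2) by (auto simp: a_def \<A>_def fibre_def)
    then show ?thesis unfolding that(1) by (simp add: a_def fibre_def)
  qed
  have a_A: "x \<in> S \<longleftrightarrow> x' \<in> S" if "a x = a x'" "S \<in> \<A>" for x x' S
    using that by (auto simp: a_def)
  define X where "X = Y \<times> V \<times> V \<union> V \<times> Y \<times> V \<union> V \<times> V \<times> Y"
  have cX: "card X \<le> 3 * card Y * n ^ 2"
  proof -
    have "card X \<le> card (Y \<times> V \<times> V) + card (V \<times> Y \<times> V) + card (V \<times> V \<times> Y)"
      unfolding X_def by (meson add_le_mono1 card_Un_le le_trans)
    then show ?thesis by (simp add: card_cartesian_product n_def power2_eq_square mult_ac)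
  qed
  define U where "U F = (\<Union>b\<in>bad F. A1 F b \<times> A2 F b \<times> A3 F b)" for F
  have Ufib: "U F \<inter> fibre \<Omega> (triple_label w) b = A1 F b \<times> A2 F b \<times> A3 F b" if "b \<in> bad F" for F b
  proof -
    have sub: "A1 F b \<times> A2 F b \<times> A3 F b \<subseteq> fibre \<Omega> (triple_label w) b" if "b \<in> bad F" for b
    proof -
      obtain i j k where b: "b = (i, j, k)" by (cases b)
      show ?thesis
        using A[OF that] unfolding \<Omega>_def b fibre_triple_label fst_conv snd_conv by (intro Sigma_mono)
    qed
    have disj: "b' = b"
      if "b' \<in> bad F" "\<omega> \<in> A1 F b' \<times> A2 F b' \<times> A3 F b'" "\<omega> \<in> fibre \<Omega> (triple_label w) b" for b' \<omega>
      using subsetD[OF sub[OF that(1)] that(2)] that(3) by (simp add: fibre_def)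
    show ?thesis
    proof
      show "U F \<inter> fibre \<Omega> (triple_label w) b \<subseteq> A1 F b \<times> A2 F b \<times> A3 F b"
      proof
        fix \<omega> assume \<omega>: "\<omega> \<in> U F \<inter> fibre \<Omega> (triple_label w) b"
        then obtain b' where b': "b' \<in> bad F" "\<omega> \<in> A1 F b' \<times> A2 F b' \<times> A3 F b'"
          unfolding U_def by blast
        with disj[of b' \<omega>] \<omega> have "b' = b" by simp
        with b' show "\<omega> \<in> A1 F b \<times> A2 F b \<times> A3 F b" by simp
      qed
      show "A1 F b \<times> A2 F b \<times> A3 F b \<subseteq> U F \<inter> fibre \<Omega> (triple_label w) b"
        using sub[OF that] that unfolding U_def by blast
    qed
  qed
  have each: "residual \<Omega> (triple_label w') F \<le> residual \<Omega> (triple_label w) F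
      - \<delta>\<^sup>2 * card {\<omega>\<in>\<Omega>. triple_label w \<omega> \<in> bad F} + 4 * card X" if F: "F \<in> \<F>" for F
  proof (rule residual_increment[where U = "U F"])
    show "\<delta> * card (fibre \<Omega> (triple_label w) b)
       \<le> \<bar>real (card (F \<inter> U F \<inter> fibre \<Omega> (triple_label w) b))
          - fibre_density \<Omega> (triple_label w) F b * card (U F \<inter> fibre \<Omega> (triple_label w) b)\<bar>"
      if "b \<in> bad F" for b
      using wit[OF that] unfolding Int_assoc Ufib[OF that] by simp
    show "triple_label w \<omega> = triple_label w \<omega>' \<and> (\<omega> \<in> U F \<longleftrightarrow> \<omega>' \<in> U F)"
      if \<omega>: "\<omega> \<in> \<Omega> - X" "\<omega>' \<in> \<Omega> - X" "triple_label w' \<omega> = triple_label w' \<omega>'" for \<omega> \<omega>'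
    proof -
      obtain x y z x' y' z' where xyz: "\<omega> = (x, y, z)" "\<omega>' = (x', y', z')"
        by (metis prod_cases3)
      have mem: "x \<in> V - Y" "y \<in> V - Y" "z \<in> V - Y" "x' \<in> V - Y" "y' \<in> V - Y" "z' \<in> V - Y"
        using \<omega>(1,2) unfolding xyz \<Omega>_def X_def by blast+
      have eq: "a x = a x'" "a y = a y'" "a z = a z'"
        using \<omega>(3) unfolding xyz triple_label_def by (auto intro!: wY mem del: equalityI subsetI)
      then have "triple_label w \<omega> = triple_label w \<omega>'"
        unfolding triple_label_def xyz using a_w[OF eq(1)] a_w[OF eq(2)] a_w[OF eq(3)] mem by simp
      moreover have "\<omega> \<in> A1 F b \<times> A2 F b \<times> A3 F b \<longleftrightarrow> \<omega>' \<in> A1 F b \<times> A2 F b \<times> A3 F b" if "b \<in> bad F" for b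
      proof -
        have "A1 F b \<in> \<A>" "A2 F b \<in> \<A>" "A3 F b \<in> \<A>" using that F by (auto simp: \<A>_def)
        then show ?thesis using a_A[OF eq(1)] a_A[OF eq(2)] a_A[OF eq(3)] by (simp add: xyz)
      qed
      ultimately show ?thesis unfolding U_def by blast
    qed
    show "X \<subseteq> \<Omega>" using Y(1) by (auto simp: X_def \<Omega>_def)
  qed (use \<delta> f\<Omega> in auto)
  have big: "card (bad F) * (n / (2 * t)) ^ 3 \<le> card {\<omega>\<in>\<Omega>. triple_label w \<omega> \<in> bad F}" for F
  proof -
    have un: "{\<omega>\<in>\<Omega>. triple_label w \<omega> \<in> bad F} = (\<Union>b\<in>bad F. fibre \<Omega> (triple_label w) b)"
      by (auto simp: fibre_def)
    have "(n / (2 * t)) ^ 3 \<le> card (fibre \<Omega> (triple_label w) b)" if "b \<in> bad F" for b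
    proof -
      obtain i j k where b: "b = (i, j, k)" by (cases b)
      then have ijk: "i \<in> {1..t}" "j \<in> {1..t}" "k \<in> {1..t}" using that badsub[of F] by auto
      have "n / (2 * t) * (n / (2 * t) * (n / (2 * t)))
          \<le> real (card (fibre V w i)) * (real (card (fibre V w j)) * real (card (fibre V w k)))"
        using ijk card_fibre_ge[OF t(3) _ t(2)] unfolding n_def by (intro mult_mono) auto
      then show ?thesis
        unfolding b \<Omega>_def fibre_triple_label by (simp add: card_cartesian_product power3_eq_cube mult.assoc)
    qed
    then have "card (bad F) * (n / (2 * t)) ^ 3 \<le> (\<Sum>b\<in>bad F. real (card (fibre \<Omega> (triple_label w) b)))"
      by (intro sum_bounded_below) auto
    also have "\<dots> = card (\<Union>b\<in>bad F. fibre \<Omega> (triple_label w) b)"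
      using fbad f\<Omega> by (subst card_UN_disjoint) (auto simp: fibre_def)
    finally show ?thesis unfolding un .
  qed
  have "\<delta> * t ^ 3 \<le> (\<Sum>F\<in>\<F>. real (card (bad F)))"
  proof -
    have "card (\<Union>F\<in>\<F>. irregular_boxes \<delta> V t w F) \<le> (\<Sum>F\<in>\<F>. card (bad F))"
      unfolding bad_def by (rule card_UN_le[OF fin(2)])
    then show ?thesis using irr by (simp flip: of_nat_sum)
  qed
  \<comment> \<open>At least \<open>\<delta> * t ^ 3\<close> irregular boxes, counted with
    multiplicity over \<open>\<F>\<close>, each with at least \<open>(n / (2 * t)) ^ 3\<close>
    triples, yield the gain \<open>\<delta> ^ 3 / 8 * n ^ 3\<close>. Half of it is reserved for the
    loss on \<open>X\<close>.\<close>
  then have "\<delta>\<^sup>2 * ((n / (2 * t)) ^ 3 * (\<delta> * t ^ 3)) \<le> \<delta>\<^sup>2 * ((n / (2 * t)) ^ 3 * (\<Sum>F\<in>\<F>. real (card (bad F))))"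
    by (intro mult_left_mono) auto
  also have "\<dots> = \<delta>\<^sup>2 * (\<Sum>F\<in>\<F>. card (bad F) * (n / (2 * t)) ^ 3)"
    by (simp only: sum_distrib_right[symmetric] mult.commute)
  also have "\<dots> \<le> \<delta>\<^sup>2 * (\<Sum>F\<in>\<F>. real (card {\<omega>\<in>\<Omega>. triple_label w \<omega> \<in> bad F}))"
    by (intro mult_left_mono sum_mono big) auto
  also have "\<delta>\<^sup>2 * ((n / (2 * t)) ^ 3 * (\<delta> * t ^ 3)) = \<delta> ^ 3 / 8 * n ^ 3"
    using t by (simp add: power2_eq_square power3_eq_cube field_simps)
  finally have gain: "\<delta> ^ 3 / 8 * n ^ 3 \<le> (\<Sum>F\<in>\<F>. \<delta>\<^sup>2 * card {\<omega>\<in>\<Omega>. triple_label w \<omega> \<in> bad F})"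
    by (simp add: sum_distrib_left)
  have "real (card Y) \<le> real (K * (n div t' + 1))" using Y(2) by (simp only: of_nat_le_iff)
  also have "\<dots> \<le> K * (2 * (n / t'))"
  proof -
    have "real (n div t') \<le> n / t'" by (rule of_nat_div_le_of_nat)
    moreover have "1 \<le> n / t'" using t' by (simp add: n_def)
    ultimately have "real (n div t' + 1) \<le> 2 * (n / t')" by simp
    then show ?thesis unfolding of_nat_mult by (intro mult_left_mono) auto
  qed
  finally have cY: "card Y \<le> 2 * K * n / t'" by (simp add: mult_ac)
  have "real (card X) \<le> real (3 * card Y * n ^ 2)" using cX by (simp only: of_nat_le_iff)
  then have "M * (4 * card X) \<le> M * (4 * real (3 * card Y * n ^ 2))"
    unfolding of_nat_mult by (intro mult_left_mono) auto
  also have "\<dots> = M * 12 * real n ^ 2 * card Y" by simp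
  also have "\<dots> \<le> M * 12 * real n ^ 2 * (2 * K * n / t')"
    using cY by (intro mult_left_mono) auto
  also have "\<dots> = 24 * M * K / t' * n ^ 3" by (simp add: power2_eq_square power3_eq_cube)
  also have "\<dots> \<le> \<delta> ^ 3 / 16 * n ^ 3"
  proof (rule mult_right_mono)
    \<comment> \<open>Since \<open>card X\<close> is at most \<open>3 * card Y * n ^ 2\<close> and
      \<open>card Y\<close> at most \<open>2 * K * n / t'\<close>, the loss is
      \<open>24 * M * K / t' * n ^ 3\<close>; the constant 384 is 24 times 16.\<close>
    have "384 * M * K / \<delta> ^ 3 \<le> t'" using t'(3) by (simp add: K_def)
    then show "24 * M * K / t' \<le> \<delta> ^ 3 / 16" using t'(1) \<delta> by (simp add: field_simps)
  qed simp
  finally have loss: "M * (4 * card X) \<le> \<delta> ^ 3 / 16 * n ^ 3" .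
  have "(\<Sum>F\<in>\<F>. residual \<Omega> (triple_label w') F)
     \<le> (\<Sum>F\<in>\<F>. residual \<Omega> (triple_label w) F - \<delta>\<^sup>2 * card {\<omega>\<in>\<Omega>. triple_label w \<omega> \<in> bad F} + 4 * card X)"
    by (rule sum_mono[OF each])
  also have "\<dots> = (\<Sum>F\<in>\<F>. residual \<Omega> (triple_label w) F)
      - (\<Sum>F\<in>\<F>. \<delta>\<^sup>2 * card {\<omega>\<in>\<Omega>. triple_label w \<omega> \<in> bad F}) + card \<F> * (4 * card X)"
    by (simp add: sum.distrib sum_subtractf)
  also have "real (card \<F> * (4 * card X)) \<le> M * (4 * card X)"
    using fin(3) by (simp only: of_nat_le_iff) simp
  finally show ?thesis using gain loss w' unfolding \<Omega>_def n_def
    by (intro exI[of _ w']) (auto simp: field_simps)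
qed

text \<open>The sum of the residuals starts at no more than \<open>M * card V ^ 3\<close>, never
  becomes negative and drops by \<open>\<delta> ^ 3 / 16 * card V ^ 3\<close> in every unsuccessful
  round. The union over \<open>\<F>\<close> in the conclusion yields one small exceptional set that
  serves all relations at once.\<close>

lemma ternary_regularity:
  fixes \<delta> :: real and t0 M :: nat
  assumes \<delta>: "0 < \<delta>" "\<delta> \<le> 1"
  shows "\<exists>T n0. \<forall>(V :: 'a set) \<F>. finite V \<and> n0 \<le> card V \<and> finite \<F> \<and> card \<F> \<le> M \<longrightarrow>
    (\<exists>t w. 1 \<le> t \<and> t0 \<le> t \<and> t \<le> T \<and> equipartition V t w \<and>
       card (\<Union>F\<in>\<F>. irregular_boxes \<delta> V t w F) \<le> \<delta> * t ^ 3)"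
proof -
  define res where "res V \<F> w = (\<Sum>F\<in>\<F>. residual (V \<times> V \<times> V) (triple_label w) F)"
    for V :: "'a set" and \<F> and w :: "'a \<Rightarrow> nat"
  define good where "good V \<F> t w \<longleftrightarrow> card (\<Union>F\<in>\<F>. irregular_boxes \<delta> V t w F) \<le> \<delta> * t ^ 3"
    for V :: "'a set" and \<F> t w
  have step: "\<exists>T n0. \<forall>(V :: 'a set) \<F>. finite V \<and> n0 \<le> card V \<and> finite \<F> \<and> card \<F> \<le> M \<longrightarrow>
    (\<exists>t w. 1 \<le> t \<and> t0 \<le> t \<and> t \<le> T \<and> equipartition V t w \<and>
      (good V \<F> t w \<or> res V \<F> w \<le> (M - q * (\<delta> ^ 3 / 16)) * card V ^ 3))" for q :: nat
  proof (induction q)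
    case 0
    have "\<exists>t w. 1 \<le> t \<and> t0 \<le> t \<and> t \<le> t0 + 1 \<and> equipartition V t w \<and>
      (good V \<F> t w \<or> res V \<F> w \<le> (M - real 0 * (\<delta> ^ 3 / 16)) * card V ^ 3)"
      if V: "finite V" and \<F>: "finite \<F>" "card \<F> \<le> M" for V :: "'a set" and \<F>
    proof -
      \<comment> \<open>A constant map imposes no condition, so this is an arbitrary
        equipartition.\<close>
      obtain w where w: "equipartition V (t0 + 1) w"
        using approximating_equipartition[OF V, of "\<lambda>_. ()" "card ((\<lambda>_. ()) ` V)" "t0 + 1"]
        by auto
      have "res V \<F> w \<le> card \<F> * real (card (V \<times> V \<times> V))"
        unfolding res_def using V by (intro sum_bounded_above residual_le_card) auto
      also have "\<dots> \<le> M * real (card (V \<times> V \<times> V))" using \<F> by (intro mult_right_mono) auto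
      finally have "res V \<F> w \<le> M * card V ^ 3"
        by (simp add: card_cartesian_product power3_eq_cube mult.assoc)
      with w show ?thesis by (intro exI[of _ "t0 + 1"] exI[of _ w]) auto
    qed
    then show ?case by blast
  next
    case (Suc q)
    then obtain T n0 where IH: "\<And>V \<F>. finite (V :: 'a set) \<Longrightarrow> n0 \<le> card V \<Longrightarrow> finite \<F> \<Longrightarrow> card \<F> \<le> M \<Longrightarrow>
      \<exists>t w. 1 \<le> t \<and> t0 \<le> t \<and> t \<le> T \<and> equipartition V t w \<and>
      (good V \<F> t w \<or> res V \<F> w \<le> (M - q * (\<delta> ^ 3 / 16)) * card V ^ 3)" by metis
    \<comment> \<open>Computed from the bound \<open>T\<close> instead of the actual
      \<open>t\<close>, so that it is the same for all \<open>V\<close> and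
      \<open>\<F>\<close>.\<close>
    define t' where "t' = t0 + 1 + nat \<lceil>384 * M * 2 ^ (T + 3 * M * T ^ 3) / \<delta> ^ 3\<rceil>"
    have "\<exists>t w. 1 \<le> t \<and> t0 \<le> t \<and> t \<le> max T t' \<and> equipartition V t w \<and>
      (good V \<F> t w \<or> res V \<F> w \<le> (M - Suc q * (\<delta> ^ 3 / 16)) * card V ^ 3)"
      if V: "finite V" "max n0 (max T t') \<le> card V" "finite \<F>" "card \<F> \<le> M" for V :: "'a set" and \<F>
    proof -
      obtain t w where t: "1 \<le> t" "t0 \<le> t" "t \<le> T" "equipartition V t w"
        and gr: "good V \<F> t w \<or> res V \<F> w \<le> (M - q * (\<delta> ^ 3 / 16)) * card V ^ 3"
        using IH[of V \<F>] V by auto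
      show ?thesis
      proof (cases "good V \<F> t w")
        case True
        then show ?thesis using t by (intro exI[of _ t] exI[of _ w]) auto
      next
        case False
        have "t + 3 * M * t ^ 3 \<le> T + 3 * M * T ^ 3"
          using t(3) by (intro add_mono mult_left_mono power_mono) auto
        then have "384 * real M * 2 ^ (t + 3 * M * t ^ 3) / \<delta> ^ 3 \<le> 384 * real M * 2 ^ (T + 3 * M * T ^ 3) / \<delta> ^ 3"
          using \<delta> by (intro divide_right_mono mult_left_mono power_increasing) auto
        also have "\<dots> \<le> t'" unfolding t'_def of_nat_add of_nat_mult of_nat_power by simp linarith
        finally have t'l: "384 * real M * 2 ^ (t + 3 * M * t ^ 3) / \<delta> ^ 3 \<le> t'" by simp
        obtain w' where w': "equipartition V t' w'" "res V \<F> w' \<le> res V \<F> w - \<delta> ^ 3 / 16 * card V ^ 3"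
          using ternary_increment[OF \<delta> V(1,3,4) t(1) _ t(4) _ _ _ t'l] False V(2) t(3)
          unfolding good_def res_def by (auto simp: t'_def)
        have "res V \<F> w' \<le> (M - Suc q * (\<delta> ^ 3 / 16)) * card V ^ 3"
          using gr False w'(2) by (simp add: algebra_simps add_divide_distrib)
        then show ?thesis using w' by (intro exI[of _ t'] exI[of _ w']) (auto simp: t'_def)
      qed
    qed
    then show ?case by blast
  qed
  obtain q :: nat where q: "M < q * (\<delta> ^ 3 / 16)" using reals_Archimedean3[of "\<delta> ^ 3 / 16"] \<delta> by auto
  obtain T n0 where T: "\<And>V \<F>. finite (V :: 'a set) \<Longrightarrow> n0 \<le> card V \<Longrightarrow> finite \<F> \<Longrightarrow> card \<F> \<le> M \<Longrightarrow>
      \<exists>t w. 1 \<le> t \<and> t0 \<le> t \<and> t \<le> T \<and> equipartition V t w \<and>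
      (good V \<F> t w \<or> res V \<F> w \<le> (M - q * (\<delta> ^ 3 / 16)) * card V ^ 3)"
    using step[of q] by metis
  have "\<not> res V \<F> w \<le> (M - q * (\<delta> ^ 3 / 16)) * card V ^ 3" if "1 \<le> card V" for V :: "'a set" and \<F> w
  proof -
    have "(M - q * (\<delta> ^ 3 / 16)) * card V ^ 3 < 0" using that q by (intro mult_neg_pos) auto
    moreover have "0 \<le> res V \<F> w" unfolding res_def by (intro sum_nonneg residual_nonneg)
    ultimately show ?thesis by simp
  qed
  then have "\<exists>t w. 1 \<le> t \<and> t0 \<le> t \<and> t \<le> T \<and> equipartition V t w \<and>
       card (\<Union>F\<in>\<F>. irregular_boxes \<delta> V t w F) \<le> \<delta> * t ^ 3"
    if "finite V" "max n0 1 \<le> card V" "finite \<F>" "card \<F> \<le> M" for V :: "'a set" and \<F>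
    using T[of V \<F>] that unfolding good_def by fastforce
  then show ?thesis by blast
qed

subsection \<open>Labellings close to their expectation\<close>

text \<open>The probabilistic argument is derandomized by choosing the labels of \<open>E\<close> one by one.\<close>

lemma conditional_expectations:
  fixes \<phi> :: "'j \<Rightarrow> 'e \<Rightarrow> 'k \<Rightarrow> real" and p :: "'e \<Rightarrow> 'k \<Rightarrow> real" and C :: real
  assumes "finite E" "finite K" "0 \<le> C"
    and p: "\<And>e k. e \<in> E \<Longrightarrow> k \<in> K \<Longrightarrow> 0 \<le> p e k" "\<And>e. e \<in> E \<Longrightarrow> (\<Sum>k\<in>K. p e k) = 1"
    and \<phi>: "\<And>j e k. 0 \<le> \<phi> j e k" "\<And>j e. j \<in> J \<Longrightarrow> e \<in> E \<Longrightarrow> (\<Sum>k\<in>K. p e k * \<phi> j e k) \<le> C"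
  shows "\<exists>f. (\<forall>e\<in>E. f e \<in> K \<and> 0 < p e (f e)) \<and> (\<Sum>j\<in>J. \<Prod>e\<in>E. \<phi> j e (f e)) \<le> card J * C ^ card E"
  using assms(1) p \<phi>(2)
proof (induction E rule: finite_induct)
  case empty
  then show ?case by simp
next
  case (insert e E)
  then obtain f where f: "\<forall>e\<in>E. f e \<in> K \<and> 0 < p e (f e)"
    "(\<Sum>j\<in>J. \<Prod>e\<in>E. \<phi> j e (f e)) \<le> card J * C ^ card E"
    by auto
  define \<Phi> where "\<Phi> j = (\<Prod>e\<in>E. \<phi> j e (f e))" for j
  have \<Phi>: "0 \<le> \<Phi> j" for j unfolding \<Phi>_def by (intro prod_nonneg \<phi>(1) ballI)
  let ?M = "card J * C ^ card (insert e E)"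
  have "(\<Sum>k\<in>K. p e k * (\<Sum>j\<in>J. \<Phi> j * \<phi> j e k)) = (\<Sum>j\<in>J. \<Phi> j * (\<Sum>k\<in>K. p e k * \<phi> j e k))"
    by (simp add: sum_distrib_left mult_ac sum.swap[of _ K])
  also have "\<dots> \<le> (\<Sum>j\<in>J. \<Phi> j * C)"
    using insert.prems(3) \<Phi> by (intro sum_mono mult_left_mono) auto
  also have "\<dots> = (\<Sum>j\<in>J. \<Phi> j) * C" by (simp add: sum_distrib_right)
  also have "\<dots> \<le> card J * C ^ card E * C"
    using f(2) assms(3) unfolding \<Phi>_def by (intro mult_right_mono) auto
  also have "\<dots> = ?M" using insert.hyps by simp
  finally have avg: "(\<Sum>k\<in>K. p e k * (\<Sum>j\<in>J. \<Phi> j * \<phi> j e k)) \<le> ?M" .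
  \<comment> \<open>The weighted average is at most \<open>?M\<close>, so some label of positive
    weight does not exceed it. Positivity is insisted on because later a label of positive weight
    reveals the colour; strictness in the contradiction comes from one such label, while labels of
    weight 0 contribute nothing.\<close>
  have "\<exists>k\<in>K. 0 < p e k \<and> (\<Sum>j\<in>J. \<Phi> j * \<phi> j e k) \<le> ?M"
  proof (rule ccontr)
    assume contra: "\<not> ?thesis"
    have le: "p e k * ?M \<le> p e k * (\<Sum>j\<in>J. \<Phi> j * \<phi> j e k)" if "k \<in> K" for k
      using contra insert.prems(1)[of e k] that by (cases "p e k = 0") (auto intro!: mult_left_mono)
    obtain k where k: "k \<in> K" "0 < p e k"
      using insert.prems(1,2)[of e] by (metis insertI1 less_eq_real_def sum.neutral zero_neq_one)
    then have "p e k * ?M < p e k * (\<Sum>j\<in>J. \<Phi> j * \<phi> j e k)"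
      using contra by (auto intro!: mult_strict_left_mono)
    then have "(\<Sum>k\<in>K. p e k * ?M) < (\<Sum>k\<in>K. p e k * (\<Sum>j\<in>J. \<Phi> j * \<phi> j e k))"
      using le k(1) assms(2) by (intro sum_strict_mono_ex1) blast+
    with avg show False using insert.prems(2)[of e] by (simp flip: sum_distrib_right)
  qed
  then obtain k where k: "k \<in> K" "0 < p e k" "(\<Sum>j\<in>J. \<Phi> j * \<phi> j e k) \<le> ?M" by blast
  have "(\<Prod>e'\<in>insert e E. \<phi> j e' ((f(e := k)) e')) = \<Phi> j * \<phi> j e k" for j
  proof -
    have "(\<Prod>e'\<in>E. \<phi> j e' ((f(e := k)) e')) = \<Phi> j"
      unfolding \<Phi>_def using insert.hyps by (intro prod.cong) auto
    then show ?thesis using insert.hyps by simp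
  qed
  then show ?case using f(1) k by (intro exI[of _ "f(e := k)"]) auto
qed

lemma exp_le_quadratic:
  fixes x :: real
  assumes "\<bar>x\<bar> \<le> 1"
  shows "exp x \<le> 1 + x + x\<^sup>2"
proof (cases "0 \<le> x")
  case True
  with assms show ?thesis by (intro exp_bound) auto
next
  case False
  define y where "y = - x"
  have y: "0 < y" using False by (simp add: y_def)
  have "1 \<le> 1 + y ^ 3" using y by simp
  also have "\<dots> = (1 - y + y\<^sup>2) * (1 + y)" by algebra
  also have "\<dots> \<le> (1 - y + y\<^sup>2) * exp y"
  proof (rule mult_left_mono[OF exp_ge_add_one_self])
    have "y \<le> 1" using assms by (simp add: y_def)
    then show "0 \<le> 1 - y + y\<^sup>2" by (simp add: add_nonneg_nonneg)
  qed
  finally have "exp (- y) \<le> 1 - y + y\<^sup>2" by (simp add: exp_minus field_simps)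
  then show ?thesis by (simp add: y_def)
qed

text \<open>Bernstein's exponential moments with a union bound. \<open>J\<close> lists all
  deviations to be controlled, with both signs. The sum over \<open>J\<close> of their exponentials
  has expectation below \<open>exp (\<theta> * (\<eta> * card E))\<close>, so for some labelling
  every single summand is below it, which bounds each deviation by
  \<open>\<eta> * card E\<close>.\<close>

lemma concentrated_labelling:
  fixes p :: "'e \<Rightarrow> 'k \<Rightarrow> real" and \<eta> :: real
  assumes fin: "finite E" "finite K" "finite \<S>" and \<S>: "\<And>S. S \<in> \<S> \<Longrightarrow> S \<subseteq> E"
    and p: "\<And>e k. e \<in> E \<Longrightarrow> k \<in> K \<Longrightarrow> 0 \<le> p e k" "\<And>e. e \<in> E \<Longrightarrow> (\<Sum>k\<in>K. p e k) = 1"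
    and \<eta>: "0 < \<eta>" "\<eta> \<le> 2" and large: "2 * card \<S> * card K < exp (\<eta>\<^sup>2 * card E / 4)"
  obtains f where "\<And>e. e \<in> E \<Longrightarrow> f e \<in> K \<and> 0 < p e (f e)"
    "\<And>S k. S \<in> \<S> \<Longrightarrow> k \<in> K \<Longrightarrow> \<bar>real (card {e\<in>S. f e = k}) - (\<Sum>e\<in>S. p e k)\<bar> \<le> \<eta> * card E"
proof -
  \<comment> \<open>This minimizes \<open>\<theta>\<^sup>2 - \<theta> * \<eta>\<close>. The
    hypothesis \<open>\<eta> \<le> 2\<close> keeps the exponents in \<open>[-1, 1]\<close>, as
    \<open>exp_le_quadratic\<close> requires.\<close>
  define \<theta> where "\<theta> = \<eta> / 2"
  define J where "J = \<S> \<times> K \<times> {1, - 1 :: real}"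
  define x where "x j e k' = (case j of (S, k, \<sigma>) \<Rightarrow> \<theta> * \<sigma> * of_bool (e \<in> S) * (of_bool (k' = k) - p e k))"
    for j :: "'e set \<times> 'k \<times> real" and e k'
  define \<phi> where "\<phi> j e k = exp (x j e k)" for j e k
  have p1: "p e k \<le> 1" if "e \<in> E" "k \<in> K" for e k
    using member_le_sum[of k K "p e"] p that fin(2) by simp
  have mean: "(\<Sum>k\<in>K. p e k * \<phi> j e k) \<le> exp (\<theta>\<^sup>2)" if j: "j \<in> J" and e: "e \<in> E" for j e
  proof -
    obtain S k \<sigma> where jd: "j = (S, k, \<sigma>)" "S \<in> \<S>" "k \<in> K" and \<sigma>: "\<sigma> = 1 \<or> \<sigma> = - 1"
      using j by (auto simp: J_def)
    have xb: "\<bar>x j e k'\<bar> \<le> \<theta>" for k'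
    proof -
      have "\<bar>of_bool (k' = k) - p e k\<bar> \<le> 1" using p(1)[OF e jd(3)] p1[OF e jd(3)] by auto
      moreover have "\<bar>\<theta> * \<sigma> * of_bool (e \<in> S)\<bar> \<le> \<theta>" using \<sigma> \<eta> by (auto simp: \<theta>_def)
      ultimately have "\<bar>\<theta> * \<sigma> * of_bool (e \<in> S)\<bar> * \<bar>of_bool (k' = k) - p e k\<bar> \<le> \<theta> * 1"
        by (intro mult_mono) auto
      then show ?thesis by (simp add: x_def jd abs_mult)
    qed
    have "(\<Sum>k'\<in>K. p e k' * \<phi> j e k') \<le> (\<Sum>k'\<in>K. p e k' * (1 + x j e k' + \<theta>\<^sup>2))"
    proof (intro sum_mono mult_left_mono)
      fix k' assume "k' \<in> K"
      have "\<theta> \<le> 1" using \<eta> by (simp add: \<theta>_def)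
      then have "\<phi> j e k' \<le> 1 + x j e k' + (x j e k')\<^sup>2"
        unfolding \<phi>_def using xb[of k'] by (intro exp_le_quadratic) auto
      moreover have "(x j e k')\<^sup>2 \<le> \<theta>\<^sup>2" using xb[of k'] by (rule abs_le_square_iff[THEN iffD1, OF order_trans]) simp
      ultimately show "\<phi> j e k' \<le> 1 + x j e k' + \<theta>\<^sup>2" by simp
      show "0 \<le> p e k'" using p(1) e \<open>k' \<in> K\<close> by blast
    qed
    also have "\<dots> = (1 + \<theta>\<^sup>2) * (\<Sum>k'\<in>K. p e k') + \<theta> * \<sigma> * of_bool (e \<in> S) * ((\<Sum>k'\<in>K. p e k' * of_bool (k' = k)) - p e k * (\<Sum>k'\<in>K. p e k'))"
      unfolding sum_distrib_left sum_subtractf[symmetric] sum.distrib[symmetric]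
      by (rule sum.cong) (auto simp: x_def jd algebra_simps)
    also have "(\<Sum>k'\<in>K. p e k' * of_bool (k' = k)) = p e k"
      using jd(3) fin(2) by (simp add: of_bool_def if_distrib cong: if_cong)
    also have "(1 + \<theta>\<^sup>2) * (\<Sum>k'\<in>K. p e k') + \<theta> * \<sigma> * of_bool (e \<in> S) * (p e k - p e k * (\<Sum>k'\<in>K. p e k')) = 1 + \<theta>\<^sup>2"
      using p(2)[OF e] by simp
    also have "\<dots> \<le> exp (\<theta>\<^sup>2)" by (rule exp_ge_add_one_self)
    finally show ?thesis .
  qed
  obtain f where f: "\<forall>e\<in>E. f e \<in> K \<and> 0 < p e (f e)"
    "(\<Sum>j\<in>J. \<Prod>e\<in>E. \<phi> j e (f e)) \<le> card J * exp (\<theta>\<^sup>2) ^ card E"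
    using conditional_expectations[OF fin(1,2), of "exp (\<theta>\<^sup>2)" p \<phi> J] p mean
    by (auto simp: \<phi>_def)
  have "card J * exp (\<theta>\<^sup>2) ^ card E < exp (\<eta>\<^sup>2 * card E / 4) * exp (\<theta>\<^sup>2) ^ card E"
    using large by (intro mult_strict_right_mono) (auto simp: J_def card_cartesian_product mult_ac)
  also have "\<dots> = exp (\<theta> * (\<eta> * card E))"
    by (simp add: \<theta>_def power2_eq_square field_simps flip: exp_of_nat_mult exp_add)
  finally have total: "(\<Sum>j\<in>J. \<Prod>e\<in>E. \<phi> j e (f e)) < exp (\<theta> * (\<eta> * card E))" using f(2) by simp
  have one: "\<sigma> * (card {e\<in>S. f e = k} - (\<Sum>e\<in>S. p e k)) \<le> \<eta> * card E"
    if S: "S \<in> \<S>" "k \<in> K" and \<sigma>: "\<sigma> \<in> {1, - 1}" for S k and \<sigma> :: real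
  proof -
    have fS: "finite S" using \<S>[OF S(1)] fin(1) finite_subset by blast
    have "(\<Prod>e\<in>E. \<phi> (S, k, \<sigma>) e (f e)) = exp (\<Sum>e\<in>E. x (S, k, \<sigma>) e (f e))"
      unfolding \<phi>_def by (simp add: exp_sum fin(1))
    also have "(\<Sum>e\<in>E. x (S, k, \<sigma>) e (f e)) = (\<Sum>e\<in>S. \<theta> * \<sigma> * (of_bool (f e = k) - p e k))"
      using \<S>[OF S(1)] fin(1) by (intro sum.mono_neutral_cong_right) (auto simp: x_def)
    also have "\<dots> = \<theta> * \<sigma> * ((\<Sum>e\<in>S. of_bool (f e = k)) - (\<Sum>e\<in>S. p e k))"
      by (simp only: sum_subtractf flip: sum_distrib_left)
    also have "(\<Sum>e\<in>S. of_bool (f e = k)) = real (card {e\<in>S. f e = k})"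
      using fS by (simp add: Int_def)
    finally have eq: "(\<Prod>e\<in>E. \<phi> (S, k, \<sigma>) e (f e)) = exp (\<theta> * \<sigma> * (card {e\<in>S. f e = k} - (\<Sum>e\<in>S. p e k)))" .
    have "(\<Prod>e\<in>E. \<phi> (S, k, \<sigma>) e (f e)) \<le> (\<Sum>j\<in>J. \<Prod>e\<in>E. \<phi> j e (f e))"
      using S \<sigma> fin by (intro member_le_sum) (auto simp: J_def \<phi>_def intro!: prod_nonneg)
    then have "exp (\<theta> * \<sigma> * (card {e\<in>S. f e = k} - (\<Sum>e\<in>S. p e k))) < exp (\<theta> * (\<eta> * card E))"
      unfolding eq using total by (rule order_le_less_trans)
    then have "\<theta> * (\<sigma> * (card {e\<in>S. f e = k} - (\<Sum>e\<in>S. p e k))) < \<theta> * (\<eta> * card E)"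
      by (simp only: exp_less_cancel_iff mult.assoc)
    then show ?thesis using \<eta> by (simp add: \<theta>_def)
  qed
  show ?thesis
  proof (rule that[of f])
    show "\<bar>real (card {e\<in>S. f e = k}) - (\<Sum>e\<in>S. p e k)\<bar> \<le> \<eta> * card E" if "S \<in> \<S>" "k \<in> K" for S k
      using one[OF that, of 1] one[OF that, of "- 1"] by simp
  qed (use f in auto)
qed

subsection \<open>Slicing a coloured pair\<close>

lemma disjoint_sets_of_sizes:
  fixes l :: nat
  assumes "finite C" "(\<Sum>c\<in>C. m c) \<le> l"
  shows "\<exists>S. (\<forall>c\<in>C. S c \<subseteq> {..<l} \<and> card (S c) = m c) \<and> (\<forall>c\<in>C. \<forall>c'\<in>C. c \<noteq> c' \<longrightarrow> S c \<inter> S c' = {})"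
  using assms
proof (induction C rule: finite_induct)
  case empty
  then show ?case by simp
next
  case (insert c C)
  then obtain S where S: "\<forall>c\<in>C. S c \<subseteq> {..<l} \<and> card (S c) = m c"
    "\<forall>c\<in>C. \<forall>c'\<in>C. c \<noteq> c' \<longrightarrow> S c \<inter> S c' = {}"
    by auto
  have "card (\<Union>c\<in>C. S c) \<le> (\<Sum>c\<in>C. m c)"
    using card_UN_le[OF insert.hyps(1), of S] S(1) by simp
  then have "m c \<le> l - card (\<Union>c\<in>C. S c)"
    using insert.prems insert.hyps by simp
  also have "\<dots> \<le> card ({..<l} - (\<Union>c\<in>C. S c))"
    using diff_card_le_card_Diff[of "\<Union>c\<in>C. S c" "{..<l}"] S(1) insert.hyps(1)
    by (simp add: finite_subset[of _ "{..<l}"])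
  finally obtain N where N: "N \<subseteq> {..<l} - (\<Union>c\<in>C. S c)" "card N = m c"
    by (meson obtain_subset_with_card_n)
  define S' where "S' = S(c := N)"
  have "\<forall>x\<in>insert c C. S' x \<subseteq> {..<l} \<and> card (S' x) = m x"
    using S(1) N by (auto simp: S'_def)
  moreover have "\<forall>x\<in>insert c C. \<forall>y\<in>insert c C. x \<noteq> y \<longrightarrow> S' x \<inter> S' y = {}"
    using S(2) N(1) by (auto simp: S'_def)
  ultimately show ?case by blast
qed

text \<open>\<open>q\<close> is a joint distribution of a colour and a label, with marginal
  \<open>d\<close> on the colours and the uniform one on the labels. Rounding \<open>l * d c\<close>
  down loses less than one label per colour, so at most \<open>card C\<close> labels have to be
  shared between colours.\<close>

lemma equitable_coupling:
  fixes d :: "'c \<Rightarrow> real" and l :: nat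
  assumes C: "finite C" and d: "\<And>c. c \<in> C \<Longrightarrow> 0 \<le> d c" "(\<Sum>c\<in>C. d c) = 1" and l: "1 \<le> l"
  obtains q L where "L \<subseteq> {..<l}" "card L \<le> card C"
    "\<And>c k. c \<in> C \<Longrightarrow> k < l \<Longrightarrow> 0 \<le> q c k"
    "\<And>c. c \<in> C \<Longrightarrow> (\<Sum>k<l. q c k) = d c"
    "\<And>k. k < l \<Longrightarrow> (\<Sum>c\<in>C. q c k) = 1 / real l"
    "\<And>k c c'. k < l \<Longrightarrow> k \<notin> L \<Longrightarrow> c \<in> C \<Longrightarrow> c' \<in> C \<Longrightarrow> 0 < q c k \<Longrightarrow> 0 < q c' k \<Longrightarrow> c = c'"
proof -
  \<comment> \<open>Each \<open>c\<close> owns \<open>m c\<close> labels; its remaining mass is spread evenly over the free labels \<open>L\<close>.\<close>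
  define m where "m c = nat \<lfloor>l * d c\<rfloor>" for c
  have m: "m c \<le> l * d c" "l * d c < m c + 1" if "c \<in> C" for c
  proof -
    have "real (m c) = of_int \<lfloor>l * d c\<rfloor>" using d(1)[OF that] by (simp add: m_def)
    then show "m c \<le> l * d c" "l * d c < m c + 1" using floor_correct[of "l * d c"] by linarith+
  qed
  have "(\<Sum>c\<in>C. real (m c)) \<le> (\<Sum>c\<in>C. l * d c)" by (intro sum_mono m)
  also have "\<dots> = l" using d(2) by (simp flip: sum_distrib_left)
  finally have sm: "(\<Sum>c\<in>C. m c) \<le> l" by (simp flip: of_nat_sum)
  from disjoint_sets_of_sizes[OF C sm] obtain S where
    S': "\<forall>c\<in>C. S c \<subseteq> {..<l} \<and> card (S c) = m c" "\<forall>c\<in>C. \<forall>c'\<in>C. c \<noteq> c' \<longrightarrow> S c \<inter> S c' = {}"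
    by (elim exE conjE)
  have S: "\<And>c. c \<in> C \<Longrightarrow> S c \<subseteq> {..<l}" "\<And>c. c \<in> C \<Longrightarrow> card (S c) = m c"
      "\<And>c c'. c \<in> C \<Longrightarrow> c' \<in> C \<Longrightarrow> c \<noteq> c' \<Longrightarrow> S c \<inter> S c' = {}"
    using S' by simp_all
  define L where "L = {..<l} - (\<Union>c\<in>C. S c)"
  have fS: "finite (S c)" if "c \<in> C" for c using S(1)[OF that] finite_subset by blast
  have "card (\<Union>c\<in>C. S c) = (\<Sum>c\<in>C. m c)"
    using C fS S by (subst card_UN_disjoint) auto
  then have "card L = l - (\<Sum>c\<in>C. m c)"
    unfolding L_def using S(1) fS C by (subst card_Diff_subset) auto
  then have cL: "real (card L) = l - (\<Sum>c\<in>C. real (m c))"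
    using sm by (simp add: of_nat_diff)
  also have "\<dots> = (\<Sum>c\<in>C. l * d c - m c)"
    using d(2) by (simp add: sum_subtractf flip: sum_distrib_left)
  finally have cL': "real (card L) = (\<Sum>c\<in>C. l * d c - m c)" .
  also have "\<dots> \<le> card C * (1::real)"
    using m by (intro sum_bounded_above) (auto intro: less_imp_le simp: algebra_simps)
  finally have LC: "card L \<le> card C" by simp
  \<comment> \<open>Without free labels, \<open>q\<close> divides by \<open>card L = 0\<close> and
    the remainders are dropped. This is correct because they are nonnegative with sum
    \<open>card L\<close>, hence all zero.\<close>
  have zero: "l * d c - m c = 0" if "c \<in> C" "card L = 0" for c
    using cL' that m C sum_nonneg_eq_0_iff[of C "\<lambda>c. l * d c - m c"] by simp
  define q where "q c k = of_bool (k \<in> S c) / l + of_bool (k \<in> L) * ((d c - m c / l) / card L)" for c k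
  have count: "(\<Sum>k<l. of_bool (k \<in> N)) = real (card N)" if "N \<subseteq> {..<l}" for N
    using that by (simp add: Int_absorb1)
  show ?thesis
  proof (rule that[of L q])
    show "L \<subseteq> {..<l}" by (simp add: L_def)
    show "card L \<le> card C" by (rule LC)
    have dm: "0 \<le> d c - m c / l" if "c \<in> C" for c
      using m[OF that] l by (simp add: field_simps)
    show "0 \<le> q c k" if "c \<in> C" for c k
      unfolding q_def using dm[OF that] by (intro add_nonneg_nonneg mult_nonneg_nonneg divide_nonneg_nonneg) auto
    show "(\<Sum>k<l. q c k) = d c" if c: "c \<in> C" for c
    proof -
      have "(\<Sum>k<l. q c k) = (\<Sum>k<l. of_bool (k \<in> S c)) / l + (\<Sum>k<l. of_bool (k \<in> L)) * ((d c - m c / l) / card L)"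
        by (simp only: q_def sum.distrib sum_divide_distrib sum_distrib_right)
      also have "\<dots> = m c / l + card L * ((d c - m c / l) / card L)"
        using S(1,2)[OF c] by (simp only: count L_def Diff_subset)
      also have "\<dots> = d c"
        using zero[OF c] l by (cases "card L = 0") (auto simp: field_simps)
      finally show ?thesis .
    qed
    show "(\<Sum>c\<in>C. q c k) = 1 / real l" if k: "k < l" for k
    proof (cases "k \<in> L")
      case True
      then have "0 < card L" by (auto simp: card_gt_0_iff L_def)
      have "(\<Sum>c\<in>C. q c k) = (\<Sum>c\<in>C. (d c - m c / l) / card L)"
        using True by (intro sum.cong) (auto simp: q_def L_def)
      also have "\<dots> = ((\<Sum>c\<in>C. d c) - (\<Sum>c\<in>C. real (m c)) / l) / card L"
        by (simp only: sum_subtractf flip: sum_divide_distrib)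
      also have "\<dots> = 1 / l"
      proof -
        have "(\<Sum>c\<in>C. real (m c)) = real l - real (card L)" using cL by simp
        then show ?thesis using d(2) l \<open>0 < card L\<close> by (simp add: diff_divide_distrib)
      qed
      finally show ?thesis .
    next
      case False
      then obtain c0 where c0: "c0 \<in> C" "k \<in> S c0" using k by (auto simp: L_def)
      have "(\<Sum>c\<in>C. q c k) = (\<Sum>c\<in>C. if c = c0 then 1 / l else 0)"
        using False c0 S(3)[of c0] by (intro sum.cong) (auto simp: q_def)
      then show ?thesis using c0 C by simp
    qed
    show "c = c'" if "k \<notin> L" "c \<in> C" "c' \<in> C" "0 < q c k" "0 < q c' k" for k c c'
    proof -
      have "k \<in> S c" "k \<in> S c'" using that by (auto simp: q_def intro: ccontr)
      then show ?thesis using S(3)[OF that(2,3)] by blast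
    qed
  qed
qed

text \<open>A pair of colour \<open>c\<close> receives label \<open>k\<close> with the conditional
  probability \<open>q c k / d c\<close>. In a box the expected number of pairs with label
  \<open>k\<close> is then \<open>1 / l\<close> of the box, up to an error \<open>\<eta>\<close> for
  each colour; deviation from the expectation adds one more \<open>\<eta>\<close>. A label outside
  \<open>L\<close> has positive probability for one colour only, so its slice is monochromatic. The
  power of 2 in \<open>large\<close> counts the boxes.\<close>

lemma slicing:
  fixes col :: "'a \<times> 'b \<Rightarrow> 'c" and l :: nat and \<eta> :: real
  assumes AB: "finite A" "finite B" "A \<noteq> {}" "B \<noteq> {}"
    and C: "finite C" "col ` (A \<times> B) \<subseteq> C" and l: "1 \<le> l" and \<eta>: "0 < \<eta>" "\<eta> \<le> 2"
    and large: "2 * 2 ^ (card A + card B) * real l < exp (\<eta>\<^sup>2 * card (A \<times> B) / 4)"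
    and reg: "\<forall>c\<in>C. \<forall>A' B'. A' \<subseteq> A \<longrightarrow> B' \<subseteq> B \<longrightarrow>
      \<bar>real (card {e\<in>A' \<times> B'. col e = c}) - real (card {e\<in>A \<times> B. col e = c}) / real (card (A \<times> B)) * real (card (A' \<times> B'))\<bar>
        \<le> \<eta> * real (card (A \<times> B))"
  shows "\<exists>f L. (\<forall>e\<in>A \<times> B. f e < l) \<and> L \<subseteq> {..<l} \<and> card L \<le> card C \<and>
    (\<forall>k A' B'. k < l \<longrightarrow> A' \<subseteq> A \<longrightarrow> B' \<subseteq> B \<longrightarrow>
      \<bar>real (card {e\<in>A' \<times> B'. f e = k}) - real (card (A' \<times> B')) / real l\<bar> \<le> (card C + 1) * \<eta> * real (card (A \<times> B))) \<and>
    (\<forall>e\<in>A \<times> B. \<forall>e'\<in>A \<times> B. f e = f e' \<longrightarrow> f e \<notin> L \<longrightarrow> col e = col e')"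
proof -
  define E where "E = A \<times> B"
  define d where "d c = real (card {e\<in>E. col e = c}) / card E" for c
  have fE: "finite E" and E0: "0 < card E" using AB by (auto simp: E_def card_gt_0_iff)
  have d0: "0 \<le> d c" for c by (simp add: d_def)
  have dpos: "0 < d (col e)" if "e \<in> E" for e
  proof -
    have "e \<in> {e'\<in>E. col e' = col e}" using that by simp
    moreover have "finite {e'\<in>E. col e' = col e}" using fE by simp
    ultimately have "0 < card {e'\<in>E. col e' = col e}" by (auto simp only: card_gt_0_iff)
    then show ?thesis using E0 by (simp add: d_def)
  qed
  have count: "card R = (\<Sum>c\<in>C. card {e\<in>R. col e = c})" if "R \<subseteq> E" for R
  proof -
    have "card R = (\<Sum>c\<in>col ` R. card {e\<in>R. col e = c})"
      using sum.image_gen[of R "\<lambda>_. 1::nat" col] finite_subset[OF that fE] by simp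
    also have "\<dots> = (\<Sum>c\<in>C. card {e\<in>R. col e = c})"
    proof (rule sum.mono_neutral_left)
      have "{e\<in>R. col e = c} = {}" if "c \<notin> col ` R" for c using that by auto
      then show "\<forall>c\<in>C - col ` R. card {e\<in>R. col e = c} = 0" by (metis DiffD2 card.empty)
    qed (use C that in \<open>auto simp: E_def\<close>)
    finally show ?thesis .
  qed
  have "(\<Sum>c\<in>C. d c) = 1"
    using count[of E] E0 by (simp add: d_def flip: sum_divide_distrib of_nat_sum)
  note coupling = equitable_coupling[OF C(1) d0 this l]
  obtain q L where
    L: "L \<subseteq> {..<l}" "card L \<le> card C"
    and q: "\<And>c k. c \<in> C \<Longrightarrow> k < l \<Longrightarrow> 0 \<le> q c k"
      "\<And>c. c \<in> C \<Longrightarrow> (\<Sum>k<l. q c k) = d c"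
      "\<And>k. k < l \<Longrightarrow> (\<Sum>c\<in>C. q c k) = 1 / real l"
      "\<And>k c c'. k < l \<Longrightarrow> k \<notin> L \<Longrightarrow> c \<in> C \<Longrightarrow> c' \<in> C \<Longrightarrow> 0 < q c k \<Longrightarrow> 0 < q c' k \<Longrightarrow> c = c'"
    by (rule coupling) (rule that)
  have qd: "q c k \<le> d c" if "c \<in> C" "k < l" for c k
    using member_le_sum[of k "{..<l}" "q c"] q(1,2) that by auto
  define p where "p e k = q (col e) k / d (col e)" for e k
  define \<S> where "\<S> = (\<lambda>(A', B'). A' \<times> B') ` (Pow A \<times> Pow B)"
  have colC: "col e \<in> C" if "e \<in> E" for e using that C by (auto simp: E_def)
  have "card \<S> \<le> card (Pow A \<times> Pow B)" unfolding \<S>_def using AB by (intro card_image_le) auto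
  also have "\<dots> = 2 ^ (card A + card B)" using AB by (simp add: card_cartesian_product card_Pow power_add)
  finally have "real (2 * card \<S> * card {..<l}) \<le> real (2 * 2 ^ (card A + card B) * l)"
    by (simp only: of_nat_le_iff card_lessThan) simp
  also have "\<dots> < exp (\<eta>\<^sup>2 * card E / 4)" using large by (simp add: E_def)
  finally have big: "2 * card \<S> * card {..<l} < exp (\<eta>\<^sup>2 * card E / 4)" .
  have fS: "finite \<S>" using AB by (simp add: \<S>_def)
  have p0: "0 \<le> p e k" if "e \<in> E" "k \<in> {..<l}" for e k
    using q(1) d0 colC that by (auto simp: p_def)
  have p1: "(\<Sum>k\<in>{..<l}. p e k) = 1" if "e \<in> E" for e
    using q(2)[OF colC[OF that]] dpos[OF that] by (simp add: p_def flip: sum_divide_distrib)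
  have \<S>E: "R \<subseteq> E" if "R \<in> \<S>" for R using that by (auto simp: \<S>_def E_def)
  obtain f where f: "\<And>e. e \<in> E \<Longrightarrow> f e \<in> {..<l} \<and> 0 < p e (f e)"
    "\<And>R k. R \<in> \<S> \<Longrightarrow> k \<in> {..<l} \<Longrightarrow> \<bar>real (card {e\<in>R. f e = k}) - (\<Sum>e\<in>R. p e k)\<bar> \<le> \<eta> * card E"
    by (rule concentrated_labelling[where p = p, OF fE finite_lessThan fS \<S>E p0 p1 \<eta> big])
      (assumption | rule that)+
  show ?thesis
  proof (intro exI[of _ f] exI[of _ L] conjI allI ballI impI)
    show "f e < l" if "e \<in> A \<times> B" for e using f(1) that by (auto simp: E_def)
    show "\<bar>real (card {e\<in>A' \<times> B'. f e = k}) - real (card (A' \<times> B')) / real l\<bar> \<le> (card C + 1) * \<eta> * real (card (A \<times> B))"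
      if k: "k < l" and A': "A' \<subseteq> A" and B': "B' \<subseteq> B" for k A' B'
    proof -
      let ?R = "A' \<times> B'"
      have R: "?R \<in> \<S>" "?R \<subseteq> E" using A' B' by (auto simp: \<S>_def E_def)
      have fR: "finite ?R" using R(2) fE finite_subset by blast
      have "(\<Sum>e\<in>?R. p e k) = (\<Sum>c\<in>col ` ?R. \<Sum>e\<in>{e\<in>?R. col e = c}. p e k)"
        by (rule sum.image_gen[OF fR])
      also have "\<dots> = (\<Sum>c\<in>C. \<Sum>e\<in>{e\<in>?R. col e = c}. p e k)"
        using C R(2) colC by (intro sum.mono_neutral_left) (auto intro!: sum.neutral)
      also have "\<dots> = (\<Sum>c\<in>C. q c k / d c * card {e\<in>?R. col e = c})"
        by (intro sum.cong) (auto simp: p_def)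
      finally have "(\<Sum>e\<in>?R. p e k) - card ?R / l
          = (\<Sum>c\<in>C. q c k / d c * card {e\<in>?R. col e = c}) - (\<Sum>c\<in>C. q c k * card ?R)"
        using q(3)[OF k] by (simp flip: sum_distrib_right)
      also have "\<dots> = (\<Sum>c\<in>C. q c k / d c * (card {e\<in>?R. col e = c} - d c * card ?R))"
        unfolding sum_subtractf[symmetric]
      proof (rule sum.cong[OF refl])
        \<comment> \<open>A colour with \<open>d c = 0\<close> has \<open>q c k = 0\<close> by
          \<open>qd\<close>, so that the division by zero does no harm.\<close>
        fix c assume c: "c \<in> C"
        show "q c k / d c * card {e\<in>?R. col e = c} - q c k * card ?R = q c k / d c * (card {e\<in>?R. col e = c} - d c * card ?R)"
          using q(1)[OF c k] qd[OF c k] by (cases "d c = 0") (auto simp: field_simps)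
      qed
      also have "\<bar>\<dots>\<bar> \<le> (\<Sum>c\<in>C. \<bar>q c k / d c * (card {e\<in>?R. col e = c} - d c * card ?R)\<bar>)"
        by (rule sum_abs)
      also have "\<dots> \<le> (\<Sum>c\<in>C. \<eta> * card E)"
      proof (rule sum_mono)
        fix c assume c: "c \<in> C"
        have "\<bar>q c k / d c\<bar> \<le> 1"
          using q(1)[OF c k] qd[OF c k] d0[of c] by (auto simp: divide_le_eq_1)
        moreover have "\<bar>card {e\<in>?R. col e = c} - d c * card ?R\<bar> \<le> \<eta> * card E"
          using reg[rule_format, OF c A' B'] by (simp add: d_def E_def)
        ultimately have "\<bar>q c k / d c\<bar> * \<bar>card {e\<in>?R. col e = c} - d c * card ?R\<bar> \<le> 1 * (\<eta> * card E)"
          by (intro mult_mono) auto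
        then show "\<bar>q c k / d c * (card {e\<in>?R. col e = c} - d c * card ?R)\<bar> \<le> \<eta> * card E"
          by (simp add: abs_mult)
      qed
      also have "\<dots> = card C * \<eta> * card E" by simp
      finally have "\<bar>(\<Sum>e\<in>?R. p e k) - card ?R / l\<bar> \<le> card C * \<eta> * card E" .
      moreover have "\<bar>real (card {e\<in>?R. f e = k}) - (\<Sum>e\<in>?R. p e k)\<bar> \<le> \<eta> * card E"
        using f(2)[OF R(1)] k by simp
      moreover have "(card C + 1) * \<eta> * card E = card C * \<eta> * card E + \<eta> * card E"
        by (simp add: algebra_simps)
      ultimately show ?thesis unfolding E_def by linarith
    qed
    show "col e = col e'" if e: "e \<in> A \<times> B" "e' \<in> A \<times> B" "f e = f e'" "f e \<notin> L" for e e'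
    proof -
      have eE: "e \<in> E" "e' \<in> E" using e by (auto simp: E_def)
      have pos: "0 < q (col x) (f x)" if "x \<in> E" for x
        using f(1)[OF that] dpos[OF that] by (simp add: p_def zero_less_divide_iff)
      show ?thesis
        using q(4)[OF _ e(4) colC[OF eE(1)] colC[OF eE(2)] pos[OF eE(1)]] pos[OF eE(2)] f(1)[OF eE(1)] e(3)
        by simp
    qed
  qed (use L in auto)
qed

text \<open>With both sides at least \<open>m\<close>, \<open>2 * a * b\<close> is at least
  \<open>m * (a + b)\<close>, and the exponent is at least \<open>2 * (a + b)\<close>. One factor
  \<open>exp (a + b)\<close> absorbs the power of 2, the other one absorbs \<open>2 * l\<close>,
  which is at most \<open>a + b\<close>.\<close>

lemma exp_dominates_subset_pairs:
  fixes a b l m :: nat and \<eta> :: real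
  assumes "0 < \<eta>" "16 / \<eta>\<^sup>2 \<le> m" "l \<le> m" "1 \<le> l" "m \<le> a" "m \<le> b"
  shows "2 * 2 ^ (a + b) * real l < exp (\<eta>\<^sup>2 * (a * b) / 4)"
proof -
  define s where "s = a + b"
  have "m * b \<le> a * b" "m * a \<le> b * a" using assms by (auto intro: mult_right_mono)
  then have "m * s \<le> 2 * (a * b)" unfolding s_def distrib_left by (simp only: mult.commute[of b a])
  then have "real (m * s) \<le> real (2 * (a * b))" by (simp only: of_nat_le_iff)
  then have ms: "real m * real s \<le> 2 * (real a * real b)" by simp
  have "16 \<le> \<eta>\<^sup>2 * m" using assms(1,2) by (simp add: field_simps)
  then have "16 * real s \<le> \<eta>\<^sup>2 * m * s" by (intro mult_right_mono) auto
  also have "\<dots> \<le> \<eta>\<^sup>2 * (2 * (real a * real b))"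
    using ms by (simp only: mult.assoc) (intro mult_left_mono, auto)
  finally have "real s + real s \<le> \<eta>\<^sup>2 * (a * b) / 4" by (simp add: mult_ac)
  then have le: "exp (real s) * exp (real s) \<le> exp (\<eta>\<^sup>2 * (a * b) / 4)"
    by (simp flip: exp_add)
  have "(2::real) ^ s \<le> exp 1 ^ s" using exp_ge_add_one_self[of 1] by (intro power_mono) auto
  also have "\<dots> = exp (real s)" by (simp flip: exp_of_nat_mult)
  finally have "2 ^ s * (2 * real l) \<le> exp (real s) * (2 * real l)" by (intro mult_right_mono) auto
  also have "\<dots> < exp (real s) * exp (real s)"
  proof (rule mult_strict_left_mono)
    have "2 * real l < 1 + real s" using assms by (simp add: s_def)
    also have "\<dots> \<le> exp (real s)" by (rule exp_ge_add_one_self)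
    finally show "2 * real l < exp (real s)" .
  qed simp
  also note le
  finally show ?thesis by (simp add: s_def mult_ac)
qed

subsection \<open>Hypergraphs and graphs as ternary relations\<close>

definition ordered_edges :: "'a edges \<Rightarrow> ('a \<times> 'a \<times> 'a) set" where
  "ordered_edges H = {(x, y, z). {x, y, z} \<in> H}"

text \<open>Of the six orderings of an edge that meets each of three disjoint classes once, exactly
  one lies in \<open>X \<times> Y \<times> Z\<close>. Having three vertices, such an edge has none
  outside the classes.\<close>

lemma card_hyp_restrict:
  assumes H: "H \<subseteq> nsets V 3" and dj: "X \<inter> Y = {}" "X \<inter> Z = {}" "Y \<inter> Z = {}"
  shows "card (hyp_restrict H X Y Z) = card (ordered_edges H \<inter> X \<times> Y \<times> Z)"
proof -
  let ?g = "\<lambda>(x, y, z). {x, y, z}"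
  have "inj_on ?g (X \<times> Y \<times> Z)"
  proof (rule inj_onI)
    fix p q assume pq: "p \<in> X \<times> Y \<times> Z" "q \<in> X \<times> Y \<times> Z" "?g p = ?g q"
    obtain x y z x' y' z' where p: "p = (x, y, z)" and q: "q = (x', y', z')" by (metis prod_cases3)
    have m: "x \<in> X" "y \<in> Y" "z \<in> Z" "x' \<in> X" "y' \<in> Y" "z' \<in> Z" and eq: "{x, y, z} = {x', y', z'}"
      using pq by (simp_all add: p q)
    have "x \<in> {x', y', z'}" "y \<in> {x', y', z'}" "z \<in> {x', y', z'}" using eq by blast+
    then have "x = x' \<and> y = y' \<and> z = z'" using m dj by blast
    then show "p = q" by (simp add: p q)
  qed
  then have inj: "inj_on ?g (ordered_edges H \<inter> X \<times> Y \<times> Z)" by (rule inj_on_subset) simp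
  have "?g ` (ordered_edges H \<inter> X \<times> Y \<times> Z) = hyp_restrict H X Y Z"
  proof (intro equalityI subsetI)
    fix e assume "e \<in> ?g ` (ordered_edges H \<inter> X \<times> Y \<times> Z)"
    then obtain x y z where e: "e = {x, y, z}" "e \<in> H" "x \<in> X" "y \<in> Y" "z \<in> Z"
      by (auto simp: ordered_edges_def)
    have "e \<inter> X = {x}" "e \<inter> Y = {y}" "e \<inter> Z = {z}" using e dj by auto
    then show "e \<in> hyp_restrict H X Y Z" using e(2) by (simp add: hyp_restrict_def)
  next
    fix e assume "e \<in> hyp_restrict H X Y Z"
    then have e: "e \<in> H" "card (e \<inter> X) = 1" "card (e \<inter> Y) = 1" "card (e \<inter> Z) = 1"
      by (auto simp: hyp_restrict_def)
    then obtain x y z where xyz: "e \<inter> X = {x}" "e \<inter> Y = {y}" "e \<inter> Z = {z}"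
      by (auto simp: card_1_singleton_iff)
    have e3: "finite e" "card e = 3" using e(1) H by (auto simp: nsets_def)
    have mem: "x \<in> e" "y \<in> e" "z \<in> e" "x \<in> X" "y \<in> Y" "z \<in> Z" using xyz by blast+
    then have "x \<noteq> y" "x \<noteq> z" "y \<noteq> z" using dj by blast+
    then have "{x, y, z} = e"
      using mem e3 by (intro card_subset_eq) auto
    then show "e \<in> ?g ` (ordered_edges H \<inter> X \<times> Y \<times> Z)"
      using mem e(1) by (auto simp: ordered_edges_def intro!: image_eqI[of _ _ "(x, y, z)"])
  qed
  with card_image[OF inj] show ?thesis by simp
qed

lemma weakly_regular_tripleI:
  assumes H: "H \<subseteq> nsets V 3" and dj: "X \<inter> Y = {}" "X \<inter> Z = {}" "Y \<inter> Z = {}"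
    and reg: "\<not> box_irregular \<delta> (ordered_edges H) X Y Z"
  shows "weakly_regular_triple \<delta> H X Y Z"
  unfolding weakly_regular_triple_def
proof (intro allI impI)
  fix X' Y' Z' assume sub: "X' \<subseteq> X \<and> Y' \<subseteq> Y \<and> Z' \<subseteq> Z"
  then have "\<not> \<delta> * real (card (X \<times> Y \<times> Z)) < \<bar>real (card (ordered_edges H \<inter> X' \<times> Y' \<times> Z'))
          - real (card (ordered_edges H \<inter> X \<times> Y \<times> Z)) / real (card (X \<times> Y \<times> Z)) * real (card (X' \<times> Y' \<times> Z'))\<bar>"
    using reg unfolding box_irregular_def by blast
  moreover have "X' \<inter> Y' = {}" "X' \<inter> Z' = {}" "Y' \<inter> Z' = {}" using sub dj by blast+
  then have "card (hyp_restrict H X' Y' Z') = card (ordered_edges H \<inter> X' \<times> Y' \<times> Z')"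
    by (rule card_hyp_restrict[OF H])
  ultimately show "\<bar>real (card (hyp_restrict H X' Y' Z'))
           - hyp_density H X Y Z * real (card X') * real (card Y') * real (card Z')\<bar>
          \<le> \<delta> * real (card X) * real (card Y) * real (card Z)"
    by (simp add: hyp_density_def card_hyp_restrict[OF H dj] card_cartesian_product mult.assoc)
qed

text \<open>
  Regarding a graph as a ternary relation that ignores the third vertex makes graph regularity an
  instance of the regularity of ternary relations.
\<close>

definition cylinder :: "('a \<times> 'b) set \<Rightarrow> ('a \<times> 'b \<times> 'c) set" where
  "cylinder R = {(x, y, z). (x, y) \<in> R}"

lemma pair_regular_if_cylinder_regular:
  assumes reg: "\<not> box_irregular \<delta> (cylinder R) X Y Z" and Z: "finite Z" "Z \<noteq> {}"
    and sub: "X' \<subseteq> X" "Y' \<subseteq> Y"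
  shows "\<bar>real (card (R \<inter> X' \<times> Y')) - real (card (R \<inter> X \<times> Y)) / real (card (X \<times> Y)) * real (card (X' \<times> Y'))\<bar>
    \<le> \<delta> * real (card (X \<times> Y))"
proof -
  have cyl: "card (cylinder R \<inter> A \<times> B \<times> Z) = card (R \<inter> A \<times> B) * card Z" for A B
  proof -
    have "cylinder R \<inter> A \<times> B \<times> Z = (\<lambda>((x, y), z). (x, y, z)) ` ((R \<inter> A \<times> B) \<times> Z)"
      by (force simp: cylinder_def)
    moreover have "inj_on (\<lambda>((x, y), z). (x, y, z)) ((R \<inter> A \<times> B) \<times> Z)" by (auto simp: inj_on_def)
    ultimately show ?thesis by (simp add: card_image card_cartesian_product)
  qed
  have Z0: "0 < real (card Z)" using Z by (simp add: card_gt_0_iff)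
  have "\<not> \<delta> * real (card (X \<times> Y \<times> Z)) < \<bar>real (card (cylinder R \<inter> X' \<times> Y' \<times> Z))
          - real (card (cylinder R \<inter> X \<times> Y \<times> Z)) / real (card (X \<times> Y \<times> Z)) * real (card (X' \<times> Y' \<times> Z))\<bar>"
    using reg sub unfolding box_irregular_def by blast
  then have "\<bar>real (card (R \<inter> X' \<times> Y')) * card Z
      - real (card (R \<inter> X \<times> Y)) * card Z / (real (card X) * real (card Y) * card Z) * (real (card X') * real (card Y') * card Z)\<bar>
      \<le> \<delta> * (real (card X) * real (card Y)) * card Z"
    unfolding cyl by (simp add: card_cartesian_product mult.assoc)
  also have "real (card (R \<inter> X' \<times> Y')) * card Z
      - real (card (R \<inter> X \<times> Y)) * card Z / (real (card X) * real (card Y) * card Z) * (real (card X') * real (card Y') * card Z)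
    = (real (card (R \<inter> X' \<times> Y')) - real (card (R \<inter> X \<times> Y)) / (real (card X) * real (card Y)) * (real (card X') * real (card Y'))) * card Z"
    using Z0 by (simp add: left_diff_distrib)
  finally show ?thesis
    using Z0 by (simp add: card_cartesian_product abs_mult)
qed

subsection \<open>Equitable partitions from labellings\<close>

definition label_class :: "(nat \<Rightarrow> 'a set) \<Rightarrow> (nat \<Rightarrow> nat \<Rightarrow> 'a \<times> 'a \<Rightarrow> nat) \<Rightarrow> nat \<Rightarrow> nat \<Rightarrow> nat \<Rightarrow> 'a edges" where
  "label_class W f i j k = (\<lambda>(x, y). {x, y}) ` {e \<in> W i \<times> W j. f i j e = k}"

definition label_classes :: "nat \<Rightarrow> nat \<Rightarrow> (nat \<Rightarrow> 'a set) \<Rightarrow> (nat \<Rightarrow> nat \<Rightarrow> 'a \<times> 'a \<Rightarrow> nat) \<Rightarrow> 'a edges set" where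
  "label_classes t l W f = {label_class W f i j k |i j k. 1 \<le> i \<and> i < j \<and> j \<le> t \<and> k < l}"

lemma complete_bipartite_commute: "complete_bipartite A B = complete_bipartite B A"
  unfolding complete_bipartite_def by (auto simp: insert_commute)

lemma complete_bipartite_image: "complete_bipartite A B = (\<lambda>(x, y). {x, y}) ` (A \<times> B)"
  by (auto simp: complete_bipartite_def)

lemma vertex_partition_unique:
  "vertex_partition V t W \<Longrightarrow> x \<in> W i \<Longrightarrow> x \<in> W j \<Longrightarrow> i \<in> {1..t} \<Longrightarrow> j \<in> {1..t} \<Longrightarrow> i = j"
  unfolding vertex_partition_def disjoint_family_on_def by blast

text \<open>Each unordered pair of classes carries one labelling, the one with \<open>i < j\<close>.
  The assumption \<open>onto\<close> makes its \<open>l\<close> slices nonempty and therefore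
  distinct, as \<open>partition_on\<close> and the count in \<open>equitable\<close> demand.\<close>

locale labelled_pairs =
  fixes V :: "'a set" and t l :: nat and W :: "nat \<Rightarrow> 'a set" and f :: "nat \<Rightarrow> nat \<Rightarrow> 'a \<times> 'a \<Rightarrow> nat"
  assumes partition: "vertex_partition V t W"
    and label: "\<And>i j e. 1 \<le> i \<Longrightarrow> i < j \<Longrightarrow> j \<le> t \<Longrightarrow> e \<in> W i \<times> W j \<Longrightarrow> f i j e < l"
    and onto: "\<And>i j k. 1 \<le> i \<Longrightarrow> i < j \<Longrightarrow> j \<le> t \<Longrightarrow> k < l \<Longrightarrow> \<exists>e \<in> W i \<times> W j. f i j e = k"
begin

lemmas class_unique = vertex_partition_unique[OF partition]

lemma cross_pair_unique:
  assumes "1 \<le> i" "i < j" "j \<le> t" "1 \<le> i'" "i' < j'" "j' \<le> t"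
    "x \<in> W i" "y \<in> W j" "x' \<in> W i'" "y' \<in> W j'" "{x, y} = {x', y'}"
  shows "i = i' \<and> j = j' \<and> x = x' \<and> y = y'"
proof -
  have r: "i \<in> {1..t}" "j \<in> {1..t}" "i' \<in> {1..t}" "j' \<in> {1..t}" using assms by auto
  have "x = x' \<and> y = y' \<or> x = y' \<and> y = x'" using assms(11) by (auto simp: doubleton_eq_iff)
  then show ?thesis
  proof
    assume "x = x' \<and> y = y'"
    then show ?thesis using class_unique assms r by metis
  next
    assume "x = y' \<and> y = x'"
    then have "i = j'" "j = i'" using class_unique assms r by metis+
    then show ?thesis using assms by simp
  qed
qed

lemma inj_pair: "1 \<le> i \<Longrightarrow> i < j \<Longrightarrow> j \<le> t \<Longrightarrow> inj_on (\<lambda>(x, y). {x, y}) (W i \<times> W j)"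
  using cross_pair_unique[of i j i j] by (auto simp: inj_on_def)

lemma label_class_nonempty: "1 \<le> i \<Longrightarrow> i < j \<Longrightarrow> j \<le> t \<Longrightarrow> k < l \<Longrightarrow> label_class W f i j k \<noteq> {}"
  using onto[of i j k] by (auto simp: label_class_def)

lemma label_class_subset: "label_class W f i j k \<subseteq> complete_bipartite (W i) (W j)"
  by (auto simp: label_class_def complete_bipartite_image)

lemma label_class_unique:
  assumes "1 \<le> i" "i < j" "j \<le> t" "1 \<le> i'" "i' < j'" "j' \<le> t"
    "e \<in> label_class W f i j k" "e \<in> label_class W f i' j' k'"
  shows "i = i' \<and> j = j' \<and> k = k'"
proof -
  obtain x y where xy: "e = {x, y}" "x \<in> W i" "y \<in> W j" "f i j (x, y) = k"
    using assms(7) by (auto simp: label_class_def)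
  obtain x' y' where xy': "e = {x', y'}" "x' \<in> W i'" "y' \<in> W j'" "f i' j' (x', y') = k'"
    using assms(8) by (auto simp: label_class_def)
  show ?thesis using cross_pair_unique[OF assms(1-6) xy(2,3) xy'(2,3)] xy xy' by auto
qed

text \<open>A slice is nonempty, and by \<open>cross_pair_unique\<close> each of its edges
  determines the pair of classes; hence no slice of another pair is contained in this complete
  bipartite graph.\<close>

lemma pair_members_label_classes:
  assumes ij: "1 \<le> i" "i < j" "j \<le> t"
  shows "pair_members W (label_classes t l W f) i j = label_class W f i j ` {..<l}"
proof (intro equalityI subsetI)
  fix B assume "B \<in> pair_members W (label_classes t l W f) i j"
  then obtain i' j' k where B: "B = label_class W f i' j' k" "1 \<le> i'" "i' < j'" "j' \<le> t" "k < l"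
    "B \<subseteq> complete_bipartite (W i) (W j)"
    by (auto simp: pair_members_def label_classes_def)
  obtain e where e: "e \<in> B" using label_class_nonempty[OF B(2-5)] B(1) by blast
  then obtain x' y' where x': "x' \<in> W i'" "y' \<in> W j'" "e = {x', y'}" using B(1) by (auto simp: label_class_def)
  obtain x y where "x \<in> W i" "y \<in> W j" "e = {x, y}" using B(6) e by (auto simp: complete_bipartite_def)
  then have "i = i' \<and> j = j'" using cross_pair_unique[OF ij B(2-4)] x' by blast
  then show "B \<in> label_class W f i j ` {..<l}" using B by auto
next
  fix B assume "B \<in> label_class W f i j ` {..<l}"
  then show "B \<in> pair_members W (label_classes t l W f) i j"
    using ij label_class_subset by (auto simp: pair_members_def label_classes_def)
qed

lemma Union_label_class:
  assumes ij: "1 \<le> i" "i < j" "j \<le> t"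
  shows "\<Union> (label_class W f i j ` {..<l}) = complete_bipartite (W i) (W j)"
  using label[OF ij] by (auto simp: label_class_def complete_bipartite_image)

lemma equitable_label_classes: "equitable l t W (label_classes t l W f)"
proof -
  let ?B = "label_classes t l W f"
  have bip: "card (pair_members W ?B i j) = l \<and> partition_on (complete_bipartite (W i) (W j)) (pair_members W ?B i j)"
    if ij: "1 \<le> i" "i < j" "j \<le> t" for i j
  proof
    have "inj_on (label_class W f i j) {..<l}"
    proof (rule inj_onI)
      fix k k' assume "k \<in> {..<l}" "k' \<in> {..<l}" "label_class W f i j k = label_class W f i j k'"
      moreover obtain e where "e \<in> label_class W f i j k"
        using label_class_nonempty[OF ij, of k] \<open>k \<in> {..<l}\<close> by blast
      ultimately show "k = k'" using label_class_unique[OF ij ij] by blast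
    qed
    then show "card (pair_members W ?B i j) = l"
      by (simp add: pair_members_label_classes[OF ij] card_image)
    show "partition_on (complete_bipartite (W i) (W j)) (pair_members W ?B i j)"
      unfolding pair_members_label_classes[OF ij]
    proof (rule partition_onI)
      show "\<Union> (label_class W f i j ` {..<l}) = complete_bipartite (W i) (W j)"
        by (rule Union_label_class[OF ij])
      fix p q assume "p \<in> label_class W f i j ` {..<l}" "q \<in> label_class W f i j ` {..<l}" "p \<noteq> q"
      then show "disjnt p q" unfolding disjnt_def using label_class_unique[OF ij ij] by blast
    next
      show "{} \<notin> label_class W f i j ` {..<l}" using label_class_nonempty[OF ij] by force
    qed
  qed
  have sym: "pair_members W ?B i j = pair_members W ?B j i" for i j
    unfolding pair_members_def by (simp add: complete_bipartite_commute)
  have "partition_on (complete_multipartite t W) ?B"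
  proof (rule partition_onI)
    show "\<Union> ?B = complete_multipartite t W"
    proof (intro equalityI subsetI)
      fix e assume "e \<in> \<Union> ?B"
      then obtain i j k where "1 \<le> i" "i < j" "j \<le> t" "e \<in> label_class W f i j k"
        by (auto simp: label_classes_def)
      then have "i \<in> {1..t}" "j \<in> {1..t} - {i}" "e \<in> complete_bipartite (W i) (W j)"
        using label_class_subset by auto
      then show "e \<in> complete_multipartite t W" unfolding complete_multipartite_def by blast
    next
      fix e assume "e \<in> complete_multipartite t W"
      then obtain i j where ij: "i \<in> {1..t}" "j \<in> {1..t} - {i}" "e \<in> complete_bipartite (W i) (W j)"
        unfolding complete_multipartite_def by blast
      obtain i' j' where ij': "1 \<le> i'" "i' < j'" "j' \<le> t" "e \<in> complete_bipartite (W i') (W j')"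
      proof (cases "i < j")
        case True
        then show ?thesis using ij that[of i j] by simp
      next
        case False
        then show ?thesis using ij that[of j i] by (simp add: complete_bipartite_commute)
      qed
      from Union_label_class[OF ij'(1-3)] ij'(4) obtain k where "k < l" "e \<in> label_class W f i' j' k"
        by blast
      then show "e \<in> \<Union> ?B" using ij' by (auto simp: label_classes_def)
    qed
    fix p q assume p: "p \<in> ?B" and q: "q \<in> ?B" and "p \<noteq> q"
    then show "disjnt p q" unfolding disjnt_def label_classes_def using label_class_unique by blast
  next
    show "{} \<notin> ?B" unfolding label_classes_def using label_class_nonempty by force
  qed
  moreover have "\<exists>i\<in>{1..t}. \<exists>j\<in>{1..t}. i \<noteq> j \<and> B \<subseteq> complete_bipartite (W i) (W j)" if B: "B \<in> ?B" for B
  proof -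
    obtain i j k where "1 \<le> i" "i < j" "j \<le> t" "B = label_class W f i j k"
      using B by (auto simp: label_classes_def)
    then show ?thesis using label_class_subset by (intro bexI[of _ i] bexI[of _ j]) auto
  qed
  moreover have "card (pair_members W ?B i j) = l \<and> partition_on (complete_bipartite (W i) (W j)) (pair_members W ?B i j)"
    if "i \<in> {1..t}" "j \<in> {1..t}" "i \<noteq> j" for i j
  proof (cases "i < j")
    case True
    then show ?thesis using bip that by simp
  next
    case False
    then have "j < i" using that by simp
    then show ?thesis using bip[of j i] that sym[of i j] complete_bipartite_commute[of "W i" "W j"] by simp
  qed
  ultimately show ?thesis unfolding equitable_def by blast
qed

lemma card_label_class:
  assumes ij: "1 \<le> i" "i < j" "j \<le> t" and sub: "A' \<subseteq> W i" "B' \<subseteq> W j"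
  shows "card (label_class W f i j k \<inter> complete_bipartite A' B') = card {e \<in> A' \<times> B'. f i j e = k}"
proof -
  have inj: "inj_on (\<lambda>(x, y). {x, y}) (W i \<times> W j)" by (rule inj_pair[OF ij])
  have "label_class W f i j k \<inter> complete_bipartite A' B'
      = (\<lambda>(x, y). {x, y}) ` ({e \<in> W i \<times> W j. f i j e = k} \<inter> A' \<times> B')"
    unfolding label_class_def complete_bipartite_image
    using sub by (intro inj_on_image_Int[OF inj, symmetric]) auto
  also have "{e \<in> W i \<times> W j. f i j e = k} \<inter> A' \<times> B' = {e \<in> A' \<times> B'. f i j e = k}" using sub by auto
  also have "card ((\<lambda>(x, y). {x, y}) ` {e \<in> A' \<times> B'. f i j e = k}) = card {e \<in> A' \<times> B'. f i j e = k}"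
    using sub by (intro card_image inj_on_subset[OF inj]) auto
  finally show ?thesis .
qed

end

subsection \<open>Approximating a family of graphs\<close>

text \<open>All requirements of the theorem on the structure apart from the strong regularity of the
  hypergraphs, with \<open>\<delta>\<close> in the place of \<open>\<delta>2 l\<close>.\<close>

definition regularized :: "real \<Rightarrow> 'a edges set \<Rightarrow> 'a set \<Rightarrow> nat \<Rightarrow> nat \<Rightarrow> (nat \<Rightarrow> 'a set) \<Rightarrow> 'a edges set \<Rightarrow> bool" where
  "regularized \<delta> \<H> V t l W \<B> \<longleftrightarrow> vertex_partition V t W \<and> equitable l t W \<B> \<and>
     ((\<forall>i\<in>{1..<t}. card (W i) \<le> card (W (Suc i))) \<and> card (W t) \<le> card (W 1) + 1) \<and>
     (\<forall>i j. 1 \<le> i \<and> i < j \<and> j \<le> t \<longrightarrow>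
        (\<forall>B\<in>pair_members W \<B> i j. graph_regular \<delta> (1 / real l) (W i) (W j) B)) \<and>
     (\<forall>H\<in>\<H>. weakly_regular \<delta> t W H)"

text \<open>The colour of a pair is the Venn atom of \<open>\<D>\<close> in which it lies; a pair in
  no graph of \<open>\<D>\<close> has colour \<open>{}\<close>. Thus at most
  \<open>2 ^ card \<D>\<close> colours occur.\<close>

definition edge_type :: "'a edges set \<Rightarrow> 'a set \<Rightarrow> 'a edges set" where
  "edge_type \<D> e = {G\<in>\<D>. e \<in> G}"

definition colour_cylinders :: "'a edges set \<Rightarrow> ('a \<times> 'a \<times> 'a) set set" where
  "colour_cylinders \<D> = (\<lambda>C. cylinder {(x, y). edge_type \<D> {x, y} = C}) ` Pow \<D>"

text \<open>All pairs of classes must be cut into regular slices, including those on which the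
  colours behave irregularly. On the latter only the control of the colours is given up.\<close>

lemma slice_pair:
  fixes col :: "'a \<times> 'a \<Rightarrow> 'c" and \<eta> :: real and N l m :: nat
  assumes fin: "finite X" "finite Y" and m: "m \<le> card X" "m \<le> card Y"
    "16 / \<eta>\<^sup>2 \<le> m" "l \<le> m" and l: "1 \<le> l" and \<eta>: "0 < \<eta>" "\<eta> \<le> 1"
    and C: "finite C" "col ` (X \<times> Y) \<subseteq> C" "card C \<le> N" and N: "1 \<le> N"
    and good_def: "good \<longleftrightarrow> (\<forall>c\<in>C. \<forall>A' B'. A' \<subseteq> X \<longrightarrow> B' \<subseteq> Y \<longrightarrow>
      \<bar>real (card {e\<in>A' \<times> B'. col e = c}) - real (card {e\<in>X \<times> Y. col e = c}) / real (card (X \<times> Y)) * real (card (A' \<times> B'))\<bar>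
        \<le> \<eta> * real (card (X \<times> Y)))"
  shows "\<exists>f L. (\<forall>e\<in>X \<times> Y. f e < l) \<and> L \<subseteq> {..<l} \<and> card L \<le> N \<and>
    (\<forall>k A' B'. k < l \<longrightarrow> A' \<subseteq> X \<longrightarrow> B' \<subseteq> Y \<longrightarrow>
      \<bar>real (card {e\<in>A' \<times> B'. f e = k}) - real (card (A' \<times> B')) / real l\<bar> \<le> (N + 1) * \<eta> * real (card (X \<times> Y))) \<and>
    (good \<longrightarrow> (\<forall>e\<in>X \<times> Y. \<forall>e'\<in>X \<times> Y. f e = f e' \<longrightarrow> f e \<notin> L \<longrightarrow> col e = col e'))"
proof -
  have m0: "0 < m" using l m by simp
  then have ne: "X \<noteq> {}" "Y \<noteq> {}" using m by auto
  have large: "2 * 2 ^ (card X + card Y) * real l < exp (\<eta>\<^sup>2 * card (X \<times> Y) / 4)"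
    unfolding card_cartesian_product using exp_dominates_subset_pairs[OF \<eta>(1) m(3,4) l m(1,2)] .
  have \<eta>2: "\<eta> \<le> 2" using \<eta> by simp
  have N\<eta>: "(real M + 1) * \<eta> * real (card (X \<times> Y)) \<le> (real N + 1) * \<eta> * real (card (X \<times> Y))" if "M \<le> N" for M
    using that \<eta> by (intro mult_right_mono) auto
  show ?thesis
  proof (cases good)
    case True
    note reg = True[unfolded good_def]
    obtain f L where f: "\<forall>e\<in>X \<times> Y. f e < l" and L: "L \<subseteq> {..<l}" "card L \<le> card C"
      and disc: "\<forall>k A' B'. k < l \<longrightarrow> A' \<subseteq> X \<longrightarrow> B' \<subseteq> Y \<longrightarrow>
        \<bar>real (card {e\<in>A' \<times> B'. f e = k}) - real (card (A' \<times> B')) / real l\<bar> \<le> (card C + 1) * \<eta> * real (card (X \<times> Y))"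
      and mono: "\<forall>e\<in>X \<times> Y. \<forall>e'\<in>X \<times> Y. f e = f e' \<longrightarrow> f e \<notin> L \<longrightarrow> col e = col e'"
      using slicing[where col = col, OF fin ne C(1,2) l \<eta>(1) \<eta>2 large reg] by (elim exE conjE)
    have "\<bar>real (card {e\<in>A' \<times> B'. f e = k}) - real (card (A' \<times> B')) / real l\<bar> \<le> (N + 1) * \<eta> * real (card (X \<times> Y))"
      if "k < l" "A' \<subseteq> X" "B' \<subseteq> Y" for k A' B'
      using disc[rule_format, OF that] N\<eta>[OF C(3)] by (simp add: add.commute)
    moreover have "card L \<le> N" using L(2) C(3) by simp
    ultimately show ?thesis using f L(1) mono by (intro exI[of _ f] exI[of _ L]) blast
  next
    case False
    \<comment> \<open>An irregular pair is sliced without regard to the colours.\<close>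
    have fU: "finite {()}" and cU: "(\<lambda>e::'a \<times> 'a. ()) ` (X \<times> Y) \<subseteq> {()}" by auto
    have reg: "\<bar>real (card {e\<in>A' \<times> B'. () = c}) - real (card {e\<in>X \<times> Y. () = c}) / real (card (X \<times> Y)) * real (card (A' \<times> B'))\<bar>
        \<le> \<eta> * real (card (X \<times> Y))" for c and A' B' :: "'a set"
    proof -
      have "0 < card (X \<times> Y)" using ne fin by (simp add: card_gt_0_iff)
      then have "real (card (X \<times> Y)) / real (card (X \<times> Y)) = 1" by simp
      then show ?thesis using \<eta> by (simp del: card_cartesian_product)
    qed
    obtain f L where f: "\<forall>e\<in>X \<times> Y. f e < l" and L: "L \<subseteq> {..<l}" "card L \<le> card {()}"
      and disc: "\<forall>k A' B'. k < l \<longrightarrow> A' \<subseteq> X \<longrightarrow> B' \<subseteq> Y \<longrightarrow>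
        \<bar>real (card {e\<in>A' \<times> B'. f e = k}) - real (card (A' \<times> B')) / real l\<bar> \<le> (card {()} + 1) * \<eta> * real (card (X \<times> Y))"
      using slicing[where col = "\<lambda>_. ()", OF fin ne fU cU l \<eta>(1) \<eta>2 large] reg by blast
    have "\<bar>real (card {e\<in>A' \<times> B'. f e = k}) - real (card (A' \<times> B')) / real l\<bar> \<le> (N + 1) * \<eta> * real (card (X \<times> Y))"
      if "k < l" "A' \<subseteq> X" "B' \<subseteq> Y" for k A' B'
      using disc[rule_format, OF that] N\<eta>[OF N] by (simp add: add.commute)
    moreover have "card L \<le> N" using L(2) N by simp
    ultimately show ?thesis using f L(1) False by (intro exI[of _ f] exI[of _ L]) blast
  qed
qed

lemma cube_le_27_choose_3:
  assumes "3 \<le> t"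
  shows "real t ^ 3 \<le> 27 * real (t choose 3)"
proof -
  have "(real t / real 3) ^ 3 \<le> of_nat (t choose 3)" by (rule binomial_ge_n_over_k_pow_k[OF assms])
  then show ?thesis by (simp add: power_divide)
qed

text \<open>\<open>Z\<close> collects the pairs inside a class, the pairs between classes that are
  irregular for some colour, and the pairs whose label lies in the mixed set \<open>L i j\<close>.
  As a class has at most \<open>2 * n / t\<close> vertices, these account for the terms
  \<open>4 / t\<close>, \<open>4 * \<delta>'\<close> and \<open>8 * N / l\<close>; the last one uses
  that a slice has at most twice its expected size. \<open>N\<close> bounds the number of colours,
  and \<open>m\<close> is the class size from which random slicing succeeds.\<close>

lemma slice_equipartition:
  fixes V :: "'a set" and \<D> \<H> :: "'a edges set" and \<delta> \<delta>' \<eta> :: real and t l m N :: nat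
  assumes V: "finite V" and \<D>: "finite \<D>" "2 ^ card \<D> \<le> N" and \<H>: "finite \<H>" "\<forall>H\<in>\<H>. H \<subseteq> nsets V 3"
    and l: "1 \<le> l" and \<eta>: "0 < \<eta>" "\<eta> \<le> 1" "(N + 1) * \<eta> \<le> \<delta>" "(N + 1) * \<eta> \<le> 1 / (2 * real l)"
    and \<delta>': "0 < \<delta>'" "\<delta>' \<le> \<eta>" "27 * \<delta>' \<le> \<delta>"
    and m: "16 / \<eta>\<^sup>2 \<le> m" "l \<le> m" "2 * t * m \<le> card V"
    and t: "3 \<le> t" "equipartition V t w"
    and irr: "card (\<Union>F\<in>ordered_edges ` \<H> \<union> colour_cylinders \<D>. irregular_boxes \<delta>' V t w F) \<le> \<delta>' * real t ^ 3"
  shows "\<exists>\<B> Z. regularized \<delta> \<H> V t l (fibre V w) \<B> \<and> Z \<subseteq> nsets V 2 \<and>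
    card Z \<le> (4 / t + 4 * \<delta>' + 8 * N / l) * card V ^ 2 \<and>
    nsets V 2 - Z \<subseteq> complete_multipartite t (fibre V w) \<and>
    (\<forall>B\<in>\<B>. \<forall>e\<in>B - Z. \<forall>e'\<in>B - Z. edge_type \<D> e = edge_type \<D> e')"
proof -
  define n where "n = card V"
  define W where "W = fibre V w"
  define col where "col = (\<lambda>(x, y). edge_type \<D> {x, y})"
  define I where "I = (\<Union>F\<in>ordered_edges ` \<H> \<union> colour_cylinders \<D>. irregular_boxes \<delta>' V t w F)"
  have m1: "1 \<le> m" using l m(2) by simp
  have tn: "t \<le> n"
  proof -
    have "t \<le> 2 * t * m" using m1 by simp
    also note m(3)
    finally show ?thesis by (simp add: n_def)
  qed
  have fW: "finite (W i)" for i using V by (simp add: W_def)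
  have WV: "W i \<subseteq> V" for i by (auto simp: W_def fibre_def)
  have W_iff: "x \<in> W i \<longleftrightarrow> x \<in> V \<and> w x = i" for x i by (auto simp: W_def fibre_def)
  have Wsize: "card (W i) = equi_size n t i" if "i \<in> {1..t}" for i
    using card_fibre_equipartition[OF t(2) that] by (simp add: W_def n_def)
  have mW: "m \<le> card (W i)" if "i \<in> {1..t}" for i
  proof -
    have "real (2 * t * m) \<le> n" using m(3) unfolding n_def by (simp only: of_nat_le_iff)
    then have "m \<le> n / (2 * t)" using t(1) by (simp add: field_simps)
    also have "\<dots> \<le> card (W i)" using card_fibre_ge[OF t(2) that] tn by (simp add: W_def n_def)
    finally show ?thesis by simp
  qed
  have Wne: "W i \<noteq> {}" if "i \<in> {1..t}" for i using mW[OF that] m1 by auto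
  define q where "q = 2 * n / t"
  have Wq: "card (W i) \<le> q" if "i \<in> {1..t}" for i
  proof -
    have "card (W i) \<le> n div t + 1" using Wsize[OF that] by (simp add: equi_size_def)
    then have "real (card (W i)) \<le> real (n div t + 1)" by (simp only: of_nat_le_iff)
    also have "\<dots> \<le> n / t + 1" using of_nat_div_le_of_nat[of n t] by simp
    also have "\<dots> \<le> n / t + n / t" using tn t(1) by (simp add: field_simps)
    finally show ?thesis by (simp add: q_def)
  qed
  have q0: "0 \<le> q" by (simp add: q_def)
  have WWq: "card (W i \<times> W j) \<le> q ^ 2" if "i \<in> {1..t}" "j \<in> {1..t}" for i j
    using mult_mono[OF Wq[OF that(1)] Wq[OF that(2)] q0] by (simp add: card_cartesian_product power2_eq_square)
  have partition: "vertex_partition V t W"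
    unfolding vertex_partition_def disjoint_family_on_def
    using t(2) Wne by (auto simp: W_iff equipartition_def)
  define good where "good i j \<longleftrightarrow> (\<forall>c\<in>Pow \<D>. \<forall>A' B'. A' \<subseteq> W i \<longrightarrow> B' \<subseteq> W j \<longrightarrow>
      \<bar>real (card {e\<in>A' \<times> B'. col e = c}) - real (card {e\<in>W i \<times> W j. col e = c}) / real (card (W i \<times> W j)) * real (card (A' \<times> B'))\<bar>
        \<le> \<eta> * real (card (W i \<times> W j)))" for i j
  define bad where "bad = {(i, j) \<in> {1..t} \<times> {1..t}. \<not> good i j}"
  have fI: "finite I"
    by (rule finite_subset[of _ "{1..t} \<times> {1..t} \<times> {1..t}"]) (auto simp: I_def irregular_boxes_def)
  \<comment> \<open>The cylinder over an irregular colour class is irregular whatever the third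
    class is. So each bad pair of classes produces \<open>t\<close> irregular boxes, and there are
    at most \<open>card I / t\<close> bad pairs.\<close>
  have badI: "(i, j, k) \<in> I" if ij: "(i, j) \<in> bad" and k: "k \<in> {1..t}" for i j k
  proof -
    from ij obtain c A' B' where c: "c \<in> Pow \<D>" and sub: "A' \<subseteq> W i" "B' \<subseteq> W j"
      and viol: "\<not> \<bar>real (card {e\<in>A' \<times> B'. col e = c}) - real (card {e\<in>W i \<times> W j. col e = c}) / real (card (W i \<times> W j)) * real (card (A' \<times> B'))\<bar>
        \<le> \<eta> * real (card (W i \<times> W j))"
      unfolding bad_def good_def by blast
    define R where "R = {(x, y). edge_type \<D> {x, y} = c}"
    have R: "{e\<in>S. col e = c} = R \<inter> S" for S by (auto simp: R_def col_def)
    have "\<delta>' * real (card (W i \<times> W j)) \<le> \<eta> * real (card (W i \<times> W j))" using \<delta>' by (intro mult_right_mono) auto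
    then have "box_irregular \<delta>' (cylinder R) (W i) (W j) (W k)"
      using pair_regular_if_cylinder_regular[OF _ fW Wne[OF k] sub] viol unfolding R
      by (meson order_trans)
    moreover have "cylinder R \<in> colour_cylinders \<D>" using c by (auto simp: colour_cylinders_def R_def)
    ultimately show ?thesis
      using ij k unfolding I_def irregular_boxes_def W_def bad_def by blast
  qed
  have cbad: "card bad \<le> \<delta>' * t ^ 2"
  proof -
    have "card ((\<lambda>((i, j), k). (i, j, k)) ` (bad \<times> {1..t})) = card (bad \<times> {1..t})"
      by (intro card_image) (auto simp: inj_on_def)
    moreover have "card ((\<lambda>((i, j), k). (i, j, k)) ` (bad \<times> {1..t})) \<le> card I"
      using badI by (intro card_mono fI) auto
    ultimately have "real (card bad * t) \<le> card I"
      by (simp only: card_cartesian_product card_atLeastAtMost of_nat_le_iff diff_Suc_1)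
    also have "\<dots> \<le> \<delta>' * t ^ 2 * t" using irr by (simp add: I_def power2_eq_square power3_eq_cube mult.assoc)
    finally show ?thesis using t(1) by simp
  qed
  define ok where "ok i j f L \<longleftrightarrow> (\<forall>e\<in>W i \<times> W j. f e < l) \<and> L \<subseteq> {..<l} \<and> card L \<le> N \<and>
    (\<forall>k A' B'. k < l \<longrightarrow> A' \<subseteq> W i \<longrightarrow> B' \<subseteq> W j \<longrightarrow>
      \<bar>real (card {e\<in>A' \<times> B'. f e = k}) - real (card (A' \<times> B')) / real l\<bar> \<le> (N + 1) * \<eta> * real (card (W i \<times> W j))) \<and>
    (good i j \<longrightarrow> (\<forall>e\<in>W i \<times> W j. \<forall>e'\<in>W i \<times> W j. f e = f e' \<longrightarrow> f e \<notin> L \<longrightarrow> col e = col e'))"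
    for i j and f :: "'a \<times> 'a \<Rightarrow> nat" and L
  have N1: "1 \<le> N" using \<D>(2) by (metis le_trans one_le_numeral one_le_power)
  have ex: "\<exists>p. ok i j (fst p) (snd p)" if "i \<in> {1..t}" "j \<in> {1..t}" for i j
  proof -
    have "\<exists>f L. ok i j f L"
      unfolding ok_def
    proof (rule slice_pair[OF fW fW mW[OF that(1)] mW[OF that(2)] m(1,2) l \<eta>(1,2) _ _ _ N1])
      show "finite (Pow \<D>)" "card (Pow \<D>) \<le> N" using \<D> by (simp_all add: card_Pow)
      show "col ` (W i \<times> W j) \<subseteq> Pow \<D>" by (auto simp: col_def edge_type_def)
      show "good i j \<longleftrightarrow> (\<forall>c\<in>Pow \<D>. \<forall>A' B'. A' \<subseteq> W i \<longrightarrow> B' \<subseteq> W j \<longrightarrow>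
      \<bar>real (card {e\<in>A' \<times> B'. col e = c}) - real (card {e\<in>W i \<times> W j. col e = c}) / real (card (W i \<times> W j)) * real (card (A' \<times> B'))\<bar>
        \<le> \<eta> * real (card (W i \<times> W j)))"
        by (rule good_def)
    qed
    then show ?thesis by auto
  qed
  define f where "f i j = fst (SOME p. ok i j (fst p) (snd p))" for i j
  define L where "L i j = snd (SOME p. ok i j (fst p) (snd p))" for i j
  have ok: "ok i j (f i j) (L i j)" if "i \<in> {1..t}" "j \<in> {1..t}" for i j
    unfolding f_def L_def by (rule someI_ex[OF ex[OF that]])
  have fl: "f i j e < l" if "i \<in> {1..t}" "j \<in> {1..t}" "e \<in> W i \<times> W j" for i j e
    using ok[OF that(1,2)] that(3) unfolding ok_def by blast
  have Ll: "L i j \<subseteq> {..<l}" "card (L i j) \<le> N" if "i \<in> {1..t}" "j \<in> {1..t}" for i j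
    using ok[OF that(1,2)] unfolding ok_def by blast+
  have disc: "\<bar>real (card {e\<in>A' \<times> B'. f i j e = k}) - real (card (A' \<times> B')) / real l\<bar> \<le> (N + 1) * \<eta> * real (card (W i \<times> W j))"
    if "i \<in> {1..t}" "j \<in> {1..t}" "k < l" "A' \<subseteq> W i" "B' \<subseteq> W j" for i j k A' B'
    using ok[OF that(1,2)] that(3-5) unfolding ok_def by blast
  have mono: "col e = col e'"
    if "i \<in> {1..t}" "j \<in> {1..t}" "good i j" "e \<in> W i \<times> W j" "e' \<in> W i \<times> W j" "f i j e = f i j e'" "f i j e \<notin> L i j" for i j e e'
    using ok[OF that(1,2)] that(3-7) unfolding ok_def by blast
  \<comment> \<open>An error of half the expected size makes every slice nonempty and at most twice
    as large as expected.\<close>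
  have class_size: "\<bar>real (card {e\<in>W i \<times> W j. f i j e = k}) - real (card (W i \<times> W j)) / l\<bar> \<le> real (card (W i \<times> W j)) / (2 * real l)"
    if "i \<in> {1..t}" "j \<in> {1..t}" "k < l" for i j k
  proof -
    have "(N + 1) * \<eta> * real (card (W i \<times> W j)) \<le> 1 / (2 * real l) * real (card (W i \<times> W j))"
      by (intro mult_right_mono \<eta>(4)) auto
    then show ?thesis using disc[OF that order_refl order_refl] by simp
  qed
  interpret labelled_pairs V t l W f
  proof
    show "vertex_partition V t W" by (rule partition)
    show "f i j e < l" if "1 \<le> i" "i < j" "j \<le> t" "e \<in> W i \<times> W j" for i j e
      using fl[of i j e] that by simp
    show "\<exists>e\<in>W i \<times> W j. f i j e = k" if "1 \<le> i" "i < j" "j \<le> t" "k < l" for i j k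
    proof -
      have ij: "i \<in> {1..t}" "j \<in> {1..t}" using that by auto
      have "0 < real (card (W i \<times> W j))" using Wne[OF ij(1)] Wne[OF ij(2)] fW by (simp add: card_gt_0_iff)
      then have "0 < real (card (W i \<times> W j)) / (2 * real l)" using l by simp
      moreover have "real (card (W i \<times> W j)) / l = 2 * (real (card (W i \<times> W j)) / (2 * real l))" by simp
      ultimately have "0 < real (card {e\<in>W i \<times> W j. f i j e = k})"
        using class_size[OF ij that(4)] by linarith
      then have "{e\<in>W i \<times> W j. f i j e = k} \<noteq> {}" by (metis card.empty less_irrefl of_nat_0)
      then show ?thesis by blast
    qed
  qed
  define \<B> where "\<B> = label_classes t l W f"
  have "graph_regular \<delta> (1 / real l) (W i) (W j) B"
    if ij: "1 \<le> i" "i < j" "j \<le> t" and B: "B \<in> pair_members W \<B> i j" for i j B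
  proof -
    have ij': "i \<in> {1..t}" "j \<in> {1..t}" using ij by auto
    obtain k where k: "k < l" "B = label_class W f i j k"
      using B unfolding \<B>_def pair_members_label_classes[OF ij] by auto
    show ?thesis unfolding graph_regular_def
    proof (intro allI impI)
      fix A' B' assume sub: "A' \<subseteq> W i \<and> B' \<subseteq> W j"
      have "(N + 1) * \<eta> * real (card (W i \<times> W j)) \<le> \<delta> * real (card (W i \<times> W j))"
        by (intro mult_right_mono \<eta>(3)) auto
      then have "\<bar>real (card {e\<in>A' \<times> B'. f i j e = k}) - real (card (A' \<times> B')) / l\<bar> \<le> \<delta> * real (card (W i \<times> W j))"
        using disc[OF ij' k(1), of A' B'] sub by linarith
      then show "\<bar>real (card (B \<inter> complete_bipartite A' B')) - 1 / real l * real (card A') * real (card B')\<bar>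
          \<le> \<delta> * real (card (W i)) * real (card (W j))"
        using sub by (simp add: k(2) card_label_class[OF ij] card_cartesian_product mult.assoc)
    qed
  qed
  moreover have "weakly_regular \<delta> t W H" if H: "H \<in> \<H>" for H
  proof -
    let ?S = "{(i, j, k). 1 \<le> i \<and> i < j \<and> j < k \<and> k \<le> t \<and> \<not> weakly_regular_triple \<delta> H (W i) (W j) (W k)}"
    have "?S \<subseteq> I"
    proof (rule subsetI)
      fix p assume "p \<in> ?S"
      then obtain i j k where p: "p = (i, j, k)" "1 \<le> i" "i < j" "j < k" "k \<le> t"
        "\<not> weakly_regular_triple \<delta> H (W i) (W j) (W k)" by auto
      have "box_irregular \<delta>' (ordered_edges H) (W i) (W j) (W k)"
      proof (rule ccontr)
        assume reg: "\<not> ?thesis"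
        have "weakly_regular_triple \<delta>' H (W i) (W j) (W k)"
          by (rule weakly_regular_tripleI[OF bspec[OF \<H>(2) H] _ _ _ reg]) (use p in \<open>auto simp: W_iff\<close>)
        moreover have "\<delta>' * real (card (W i)) * real (card (W j)) * real (card (W k)) \<le> \<delta> * real (card (W i)) * real (card (W j)) * real (card (W k))"
          using \<delta>' by (intro mult_right_mono) auto
        ultimately have "weakly_regular_triple \<delta> H (W i) (W j) (W k)"
          unfolding weakly_regular_triple_def by (meson order_trans)
        with p show False by simp
      qed
      then have "p \<in> irregular_boxes \<delta>' V t w (ordered_edges H)"
        using p by (simp add: irregular_boxes_def W_def)
      then show "p \<in> I" using H unfolding I_def by blast
    qed
    \<comment> \<open>The bound on irregular boxes is relative to \<open>t ^ 3\<close>, weak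
      regularity is relative to \<open>t choose 3\<close>; the factor 27 between them is the reason
      for \<open>27 * \<delta>' \<le> \<delta>\<close>.\<close>
    then have "real (card ?S) \<le> card I" using card_mono[OF fI] by simp
    also have "\<dots> \<le> \<delta>' * t ^ 3" using irr by (simp add: I_def)
    also have "\<dots> \<le> \<delta>' * (27 * real (t choose 3))"
      using cube_le_27_choose_3[OF t(1)] \<delta>' by (intro mult_left_mono) auto
    also have "\<dots> \<le> \<delta> * real (t choose 3)" using \<delta>'(3) by (simp only: mult.assoc[symmetric]) (intro mult_right_mono, auto)
    finally show ?thesis unfolding weakly_regular_def .
  qed
  moreover have "card (W i) \<le> card (W (Suc i))" if "i \<in> {1..<t}" for i
    using that Wsize[of i] Wsize[of "Suc i"] by (simp add: equi_size_def)
  moreover have "card (W t) \<le> card (W 1) + 1"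
    using t(1) Wsize[of t] Wsize[of 1] by (simp add: equi_size_def)
  ultimately have reg: "regularized \<delta> \<H> V t l W \<B>"
    unfolding regularized_def using partition equitable_label_classes unfolding \<B>_def by blast
  define P1 where "P1 = {(x, y) \<in> V \<times> V. w x = w y \<and> x \<noteq> y}"
  \<comment> \<open>Bad index pairs with \<open>i = j\<close> are left out: they would contribute
    degenerate pairs \<open>{x, x}\<close>, and the proper pairs inside a class are in
    \<open>P1\<close>.\<close>
  define P2 where "P2 = (\<Union>(i, j)\<in>{p\<in>bad. fst p < snd p}. W i \<times> W j)"
  define T2 where "T2 = {(i, j) \<in> {1..t} \<times> {1..t}. i < j}"
  define P3 where "P3 = (\<Union>(i, j)\<in>T2. {e \<in> W i \<times> W j. f i j e \<in> L i j})"
  define Z where "Z = (\<lambda>(x, y). {x, y}) ` (P1 \<union> P2 \<union> P3)"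
  have PV: "P1 \<union> P2 \<union> P3 \<subseteq> {(x, y) \<in> V \<times> V. x \<noteq> y}"
    by (auto simp: P1_def P2_def P3_def T2_def W_iff)
  have fP: "finite (P1 \<union> P2 \<union> P3)"
    by (rule finite_subset[OF PV]) (use V in \<open>auto intro: finite_subset[of _ "V \<times> V"]\<close>)
  have ZV: "Z \<subseteq> nsets V 2"
    using PV by (auto simp: Z_def nsets_def card_insert_if)
  have fbad: "finite bad" by (rule finite_subset[of _ "{1..t} \<times> {1..t}"]) (auto simp: bad_def)
  have P1: "card P1 \<le> t * q ^ 2"
  proof -
    have "P1 \<subseteq> (\<Union>i\<in>{1..t}. W i \<times> W i)" using t(2) by (auto simp: P1_def W_iff equipartition_def)
    then have "card P1 \<le> card (\<Union>i\<in>{1..t}. W i \<times> W i)" using fW by (intro card_mono) auto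
    also have "\<dots> \<le> (\<Sum>i\<in>{1..t}. card (W i \<times> W i))" by (rule card_UN_le) simp
    finally have "real (card P1) \<le> (\<Sum>i\<in>{1..t}. real (card (W i \<times> W i)))" by (simp flip: of_nat_sum)
    also have "\<dots> \<le> (\<Sum>i\<in>{1..t}. q ^ 2)" using WWq by (intro sum_mono) auto
    finally show ?thesis by simp
  qed
  have P2: "card P2 \<le> \<delta>' * t ^ 2 * q ^ 2"
  proof -
    let ?b = "{p\<in>bad. fst p < snd p}"
    have "card P2 \<le> (\<Sum>p\<in>?b. card (case p of (i, j) \<Rightarrow> W i \<times> W j))"
      unfolding P2_def by (rule card_UN_le) (use fbad in simp)
    then have "real (card P2) \<le> (\<Sum>p\<in>?b. real (card (case p of (i, j) \<Rightarrow> W i \<times> W j)))" by (simp flip: of_nat_sum)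
    also have "\<dots> \<le> (\<Sum>p\<in>?b. q ^ 2)" using WWq by (intro sum_mono) (auto simp: bad_def)
    also have "\<dots> = card ?b * q ^ 2" by simp
    also have "\<dots> \<le> card bad * q ^ 2"
      using card_mono[OF fbad, of ?b] by (intro mult_right_mono) auto
    also have "\<dots> \<le> \<delta>' * t ^ 2 * q ^ 2" using cbad by (intro mult_right_mono) auto
    finally show ?thesis .
  qed
  have P3: "card P3 \<le> t ^ 2 * (2 * N / l * q ^ 2)"
  proof -
    have fT2: "finite T2" by (rule finite_subset[of _ "{1..t} \<times> {1..t}"]) (auto simp: T2_def)
    have cT2: "card T2 \<le> t ^ 2"
    proof -
      have "T2 \<subseteq> {1..t} \<times> {1..t}" by (auto simp: T2_def)
      from card_mono[OF _ this] show ?thesis by (simp add: card_cartesian_product power2_eq_square)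
    qed
    have one: "real (card {e \<in> W i \<times> W j. f i j e \<in> L i j}) \<le> 2 * N / l * q ^ 2"
      if ij: "i \<in> {1..t}" "j \<in> {1..t}" for i j
    proof -
      have fL: "finite (L i j)" using Ll(1)[OF ij] finite_subset by blast
      have "{e \<in> W i \<times> W j. f i j e \<in> L i j} = (\<Union>k\<in>L i j. {e \<in> W i \<times> W j. f i j e = k})" by auto
      then have "card {e \<in> W i \<times> W j. f i j e \<in> L i j} \<le> (\<Sum>k\<in>L i j. card {e \<in> W i \<times> W j. f i j e = k})"
        using card_UN_le[OF fL] by simp
      then have "real (card {e \<in> W i \<times> W j. f i j e \<in> L i j}) \<le> (\<Sum>k\<in>L i j. real (card {e \<in> W i \<times> W j. f i j e = k}))"
        by (simp flip: of_nat_sum)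
      also have "\<dots> \<le> (\<Sum>k\<in>L i j. 2 / l * q ^ 2)"
      proof (rule sum_mono)
        fix k assume "k \<in> L i j"
        then have k: "k < l" using Ll(1)[OF ij] by auto
        have h: "real (card (W i \<times> W j)) / (2 * real l) = real (card (W i \<times> W j)) / l / 2" by simp
        have "0 \<le> real (card (W i \<times> W j)) / l" by simp
        moreover have "a \<le> 2 * b" if "0 \<le> b" "\<bar>a - b\<bar> \<le> b / 2" for a b :: real using that by linarith
        ultimately have "real (card {e \<in> W i \<times> W j. f i j e = k}) \<le> 2 * (real (card (W i \<times> W j)) / l)"
          using class_size[OF ij k] unfolding h by blast
        also have "\<dots> = 2 / l * real (card (W i \<times> W j))" by simp
        also have "\<dots> \<le> 2 / l * q ^ 2" using WWq[OF ij] by (intro mult_left_mono) auto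
        finally show "real (card {e \<in> W i \<times> W j. f i j e = k}) \<le> 2 / l * q ^ 2" .
      qed
      also have "\<dots> = card (L i j) * (2 / l * q ^ 2)" by simp
      also have "\<dots> \<le> N * (2 / l * q ^ 2)" using Ll(2)[OF ij] by (intro mult_right_mono) auto
      finally show ?thesis by (simp add: mult_ac)
    qed
    have "card P3 \<le> (\<Sum>p\<in>T2. card (case p of (i, j) \<Rightarrow> {e \<in> W i \<times> W j. f i j e \<in> L i j}))"
      unfolding P3_def by (rule card_UN_le[OF fT2])
    then have "real (card P3) \<le> (\<Sum>p\<in>T2. real (card (case p of (i, j) \<Rightarrow> {e \<in> W i \<times> W j. f i j e \<in> L i j})))"
      by (simp flip: of_nat_sum)
    also have "\<dots> \<le> (\<Sum>p\<in>T2. 2 * N / l * q ^ 2)" using one by (intro sum_mono) (auto simp: T2_def)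
    also have "\<dots> = card T2 * (2 * N / l * q ^ 2)" by simp
    also have "\<dots> \<le> t ^ 2 * (2 * N / l * q ^ 2)" using cT2 by (intro mult_right_mono) (simp_all flip: of_nat_power)
    finally show ?thesis by simp
  qed
  have "card Z \<le> card (P1 \<union> P2 \<union> P3)" unfolding Z_def by (rule card_image_le[OF fP])
  also have "\<dots> \<le> card P1 + card P2 + card P3"
    by (meson add_le_mono1 card_Un_le le_trans)
  finally have "real (card Z) \<le> card P1 + card P2 + card P3" by (simp flip: of_nat_add)
  also have "\<dots> \<le> t * q ^ 2 + \<delta>' * t ^ 2 * q ^ 2 + t ^ 2 * (2 * N / l * q ^ 2)"
    using P1 P2 P3 by linarith
  also have "\<dots> = (4 / t + 4 * \<delta>' + 8 * N / l) * n ^ 2"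
    using t(1) l by (simp add: q_def power2_eq_square field_simps)
  finally have cZ: "card Z \<le> (4 / t + 4 * \<delta>' + 8 * N / l) * card V ^ 2" by (simp add: n_def)
  have cross: "nsets V 2 - Z \<subseteq> complete_multipartite t W"
  proof (rule subsetI)
    fix e assume e: "e \<in> nsets V 2 - Z"
    then obtain x y where xy: "e = {x, y}" "x \<noteq> y" "x \<in> V" "y \<in> V"
      by (auto simp: nsets_def card_2_iff)
    have "(x, y) \<notin> P1" using e xy(1) by (auto simp: Z_def)
    then have "w x \<noteq> w y" using xy by (simp add: P1_def)
    moreover have "w x \<in> {1..t}" "w y \<in> {1..t}" using t(2) xy by (auto simp: equipartition_def)
    moreover have "e \<in> complete_bipartite (W (w x)) (W (w y))"
      using xy by (auto simp: complete_bipartite_def W_iff)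
    ultimately show "e \<in> complete_multipartite t W"
      unfolding complete_multipartite_def by (intro UN_I[of "w x"] UN_I[of "w y"]) simp_all
  qed
  have "edge_type \<D> e = edge_type \<D> e'" if B: "B \<in> \<B>" "e \<in> B - Z" "e' \<in> B - Z" for B e e'
  proof -
    obtain i j k where ij: "1 \<le> i" "i < j" "j \<le> t" and k: "B = label_class W f i j k"
      using B(1) unfolding \<B>_def label_classes_def by blast
    have ij': "i \<in> {1..t}" "j \<in> {1..t}" using ij by auto
    obtain x y where x: "e = {x, y}" "(x, y) \<in> W i \<times> W j" "f i j (x, y) = k"
      using B(2) k by (auto simp: label_class_def)
    obtain x' y' where x': "e' = {x', y'}" "(x', y') \<in> W i \<times> W j" "f i j (x', y') = k"
      using B(3) k by (auto simp: label_class_def)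
    have notin: "(x, y) \<notin> P2" "(x, y) \<notin> P3" using B(2) x(1) by (auto simp: Z_def)
    have g: "good i j"
    proof (rule ccontr)
      assume "\<not> good i j"
      then have "(i, j) \<in> {p\<in>bad. fst p < snd p}" using ij by (simp add: bad_def)
      then show False using notin(1) x(2) unfolding P2_def by blast
    qed
    have nl: "f i j (x, y) \<notin> L i j"
    proof
      assume "f i j (x, y) \<in> L i j"
      moreover have "(i, j) \<in> T2" using ij by (simp add: T2_def)
      ultimately show False using notin(2) x(2) unfolding P3_def by blast
    qed
    have "f i j (x, y) = f i j (x', y')" using x(3) x'(3) by simp
    then have "col (x, y) = col (x', y')" by (rule mono[OF ij' g x(2) x'(2) _ nl])
    then show ?thesis by (simp add: col_def x x')
  qed
  then show ?thesis using reg ZV cZ cross unfolding W_def by blast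
qed

lemma graph_approximation:
  fixes \<delta>2 :: "nat \<Rightarrow> real" and \<epsilon> :: real and l0 t0 s D :: nat
  assumes \<epsilon>: "0 < \<epsilon>" and \<delta>2: "\<And>l. 0 < \<delta>2 l \<and> \<delta>2 l \<le> 1"
  shows "\<exists>T n0. \<forall>(V :: 'a set) \<H> \<D>. finite V \<and> n0 \<le> card V \<and> finite \<H> \<and> card \<H> \<le> s \<and>
      (\<forall>H\<in>\<H>. H \<subseteq> nsets V 3) \<and> finite \<D> \<and> card \<D> \<le> D \<longrightarrow>
    (\<exists>t l W \<B> Z. 1 \<le> t \<and> t0 \<le> t \<and> t \<le> T \<and> 1 \<le> l \<and> l0 \<le> l \<and> l \<le> T \<and>
      regularized (\<delta>2 l) \<H> V t l W \<B> \<and> Z \<subseteq> nsets V 2 \<and> card Z \<le> \<epsilon> * card V ^ 2 \<and>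
      nsets V 2 - Z \<subseteq> complete_multipartite t W \<and>
      (\<forall>B\<in>\<B>. \<forall>e\<in>B - Z. \<forall>e'\<in>B - Z. edge_type \<D> e = edge_type \<D> e'))"
proof -
  define N where "N = (2::nat) ^ D"
  \<comment> \<open>The bound on \<open>Z\<close> in \<open>slice_equipartition\<close> has three
    terms, and each gets \<open>\<epsilon> / 3\<close>: \<open>8 * N / l\<close> through the 24
    here, \<open>4 * \<delta>'\<close> through \<open>\<epsilon> / 12\<close> in
    \<open>\<delta>'\<close>, and \<open>4 / t\<close> through \<open>12 / \<epsilon>\<close> in
    \<open>t1\<close>. Slicing multiplies \<open>\<eta>\<close> by \<open>N + 1\<close>, which the
    definition of \<open>\<eta>\<close> anticipates.\<close>
  define l where "l = l0 + 1 + nat \<lceil>24 * N / \<epsilon>\<rceil>"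
  define \<delta> where "\<delta> = \<delta>2 l"
  define \<eta> where "\<eta> = min \<delta> (1 / (2 * l)) / (N + 1)"
  define \<delta>' where "\<delta>' = min \<eta> (min (\<delta> / 27) (\<epsilon> / 12))"
  define m where "m = l + nat \<lceil>16 / \<eta>\<^sup>2\<rceil>"
  define t1 where "t1 = t0 + 3 + nat \<lceil>12 / \<epsilon>\<rceil>"
  have \<delta>: "0 < \<delta>" "\<delta> \<le> 1" using \<delta>2 by (auto simp: \<delta>_def)
  have l: "1 \<le> l" "l0 \<le> l" "24 * N / \<epsilon> \<le> l" by (auto simp: l_def) linarith
  have \<eta>: "0 < \<eta>" using \<delta> l by (simp add: \<eta>_def)
  have \<eta>': "(N + 1) * \<eta> = min \<delta> (1 / (2 * l))" by (simp add: \<eta>_def)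
  then have \<eta>'': "(N + 1) * \<eta> \<le> \<delta>" "(N + 1) * \<eta> \<le> 1 / (2 * real l)" by simp_all
  have "1 * \<eta> \<le> (N + 1) * \<eta>" using \<eta> by (intro mult_right_mono) auto
  then have \<eta>1: "\<eta> \<le> 1" using \<eta>'' \<delta> by simp
  have \<delta>': "0 < \<delta>'" "\<delta>' \<le> \<eta>" "27 * \<delta>' \<le> \<delta>" "\<delta>' \<le> 1" "4 * \<delta>' \<le> \<epsilon> / 3"
    using \<eta> \<eta>1 \<delta> \<epsilon> by (auto simp: \<delta>'_def)
  have m: "16 / \<eta>\<^sup>2 \<le> m" "l \<le> m" by (auto simp: m_def) linarith
  obtain T n0 where T: "\<forall>(V :: 'a set) \<F>. finite V \<and> n0 \<le> card V \<and> finite \<F> \<and> card \<F> \<le> s + N \<longrightarrow>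
    (\<exists>t w. 1 \<le> t \<and> t1 \<le> t \<and> t \<le> T \<and> equipartition V t w \<and>
       card (\<Union>F\<in>\<F>. irregular_boxes \<delta>' V t w F) \<le> \<delta>' * t ^ 3)"
    using ternary_regularity[OF \<delta>'(1,4), where ?t0.0 = t1 and M = "s + N"] by (elim exE)
  define T' where "T' = max T l"
  have claim: "\<exists>t l W \<B> Z. 1 \<le> t \<and> t0 \<le> t \<and> t \<le> T' \<and> 1 \<le> l \<and> l0 \<le> l \<and> l \<le> T' \<and>
      regularized (\<delta>2 l) \<H> V t l W \<B> \<and> Z \<subseteq> nsets V 2 \<and> card Z \<le> \<epsilon> * card V ^ 2 \<and>
      nsets V 2 - Z \<subseteq> complete_multipartite t W \<and>
      (\<forall>B\<in>\<B>. \<forall>e\<in>B - Z. \<forall>e'\<in>B - Z. edge_type \<D> e = edge_type \<D> e')"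
    if V: "finite V" "max n0 (2 * T * m) \<le> card V" and \<H>: "finite \<H>" "card \<H> \<le> s"
      "\<forall>H\<in>\<H>. H \<subseteq> nsets V 3" and \<D>: "finite \<D>" "card \<D> \<le> D"
    for V :: "'a set" and \<H> \<D>
  proof -
    let ?F = "ordered_edges ` \<H> \<union> colour_cylinders \<D>"
    have N': "2 ^ card \<D> \<le> N" using \<D> by (simp add: N_def)
    have fF: "finite ?F" using \<H> \<D> by (simp add: colour_cylinders_def)
    have "card ?F \<le> card (ordered_edges ` \<H>) + card (colour_cylinders \<D>)" by (rule card_Un_le)
    also have "\<dots> \<le> s + N"
    proof (rule add_mono)
      show "card (ordered_edges ` \<H>) \<le> s" using card_image_le[OF \<H>(1), of ordered_edges] \<H>(2) by linarith
      have "card (colour_cylinders \<D>) \<le> card (Pow \<D>)"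
        unfolding colour_cylinders_def using \<D> by (intro card_image_le) simp
      then show "card (colour_cylinders \<D>) \<le> N" using N' \<D>(1) by (simp add: card_Pow)
    qed
    finally have cF: "card ?F \<le> s + N" .
    obtain t w where t: "t1 \<le> t" "t \<le> T" "equipartition V t w"
      "card (\<Union>F\<in>?F. irregular_boxes \<delta>' V t w F) \<le> \<delta>' * real t ^ 3"
      using T[rule_format, of V ?F] V fF cF by auto
    have "2 * t * m \<le> 2 * T * m" using t(2) by simp
    also have "\<dots> \<le> card V" using V(2) by simp
    finally have mV: "2 * t * m \<le> card V" .
    have t3: "3 \<le> t" "t0 \<le> t" using t(1) by (auto simp: t1_def)
    obtain \<B> Z where BZ: "regularized \<delta> \<H> V t l (fibre V w) \<B>" "Z \<subseteq> nsets V 2"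
      "card Z \<le> (4 / t + 4 * \<delta>' + 8 * N / l) * card V ^ 2"
      "nsets V 2 - Z \<subseteq> complete_multipartite t (fibre V w)"
      "\<forall>B\<in>\<B>. \<forall>e\<in>B - Z. \<forall>e'\<in>B - Z. edge_type \<D> e = edge_type \<D> e'"
      using slice_equipartition[OF V(1) \<D>(1) N' \<H>(1,3) l(1) \<eta> \<eta>1 \<eta>'' \<delta>'(1-3) m mV t3(1) t(3,4)]
      by (elim exE conjE)
    have "4 / t \<le> \<epsilon> / 3"
    proof -
      have "12 / \<epsilon> \<le> t1" unfolding t1_def by linarith
      then have "12 / \<epsilon> \<le> t" using t(1) by linarith
      then show ?thesis using \<epsilon> t3 by (simp add: field_simps)
    qed
    moreover have "8 * N / l \<le> \<epsilon> / 3" using l \<epsilon> by (simp add: field_simps)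
    ultimately have "4 / t + 4 * \<delta>' + 8 * N / l \<le> \<epsilon>" using \<delta>'(5) by linarith
    then have "(4 / t + 4 * \<delta>' + 8 * N / l) * card V ^ 2 \<le> \<epsilon> * card V ^ 2"
      by (intro mult_right_mono) auto
    with BZ(3) have cZ: "card Z \<le> \<epsilon> * card V ^ 2" by linarith
    have bounds: "1 \<le> t" "t \<le> T'" "l \<le> T'" using t3 t(2) by (auto simp: T'_def)
    show ?thesis
      by (intro exI[of _ t] exI[of _ l] exI[of _ "fibre V w"] exI[of _ \<B>] exI[of _ Z] conjI
          bounds t3 l(1,2) BZ(1)[unfolded \<delta>_def] BZ(2,4,5) cZ)
  qed
  show ?thesis
    by (rule exI[of _ T'], rule exI[of _ "max n0 (2 * T * m)"], intro allI impI, elim conjE, rule claim)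
qed

subsection \<open>Triads as fibres\<close>

text \<open>
  The condition on \<open>nsets T 2\<close> excludes triples with two vertices in one class, so that the fibre
  over a triad consists of its triangles only.
\<close>

definition triad_label :: "'a edges set \<Rightarrow> 'a set \<Rightarrow> 'a edges" where
  "triad_label \<B> T = (if nsets T 2 \<subseteq> \<Union>\<B> then \<Union>{B\<in>\<B>. B \<inter> nsets T 2 \<noteq> {}} else {})"

lemma nsets_2_pair: "x \<in> T \<Longrightarrow> y \<in> T \<Longrightarrow> x \<noteq> y \<Longrightarrow> {x, y} \<in> nsets T 2"
  by (simp add: nsets_def)

text \<open>A pair \<open>e\<close> of \<open>T\<close> lies in the label of \<open>T\<close>, hence
  in that of \<open>T'\<close>, hence in a member that also contains a pair \<open>e'\<close> of
  \<open>T'\<close>. Neither pair is in \<open>Z\<close>, so this member gives them the same type.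
  Off \<open>Z\<close> the new triad thus determines the set of types of a triple; the converse
  inclusion follows by symmetry.\<close>

lemma edge_types_if_triad_label_eq:
  assumes part: "partition_on C \<B>" and cover: "nsets V 2 - Z \<subseteq> C"
    and mono: "\<forall>B\<in>\<B>. \<forall>e\<in>B - Z. \<forall>e'\<in>B - Z. edge_type \<D> e = edge_type \<D> e'"
    and T: "T \<subseteq> V" "nsets T 2 \<inter> Z = {}" and T': "T' \<subseteq> V" "nsets T' 2 \<inter> Z = {}"
    and eq: "triad_label \<B> T = triad_label \<B> T'"
  shows "edge_type \<D> ` nsets T 2 \<subseteq> edge_type \<D> ` nsets T' 2"
proof
  fix \<tau> assume "\<tau> \<in> edge_type \<D> ` nsets T 2"
  then obtain e where e: "e \<in> nsets T 2" "\<tau> = edge_type \<D> e" by blast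
  have cov: "nsets S 2 \<subseteq> \<Union>\<B>" if "S \<subseteq> V" "nsets S 2 \<inter> Z = {}" for S
    using that cover part nsets_mono[OF that(1), of 2] unfolding partition_on_def by blast
  have lab: "triad_label \<B> S = \<Union>{B\<in>\<B>. B \<inter> nsets S 2 \<noteq> {}}" if "S \<subseteq> V" "nsets S 2 \<inter> Z = {}" for S
    using cov[OF that] by (simp add: triad_label_def)
  obtain B where B: "B \<in> \<B>" "e \<in> B" using cov[OF T] e(1) by blast
  then have "e \<in> triad_label \<B> T" using e(1) unfolding lab[OF T] by blast
  then obtain B' where B': "B' \<in> \<B>" "B' \<inter> nsets T' 2 \<noteq> {}" "e \<in> B'" unfolding eq lab[OF T'] by blast
  then obtain e' where e': "e' \<in> B'" "e' \<in> nsets T' 2" by blast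
  have "e \<in> B' - Z" "e' \<in> B' - Z" using e e' B' T(2) T'(2) by blast+
  then have "edge_type \<D> e = edge_type \<D> e'" using mono B'(1) by blast
  then show "\<tau> \<in> edge_type \<D> ` nsets T' 2" using e(2) e'(2) by blast
qed

text \<open>When the old members belong to \<open>\<D>\<close>, the type of a pair names the old
  member containing it, so the old label can be read off from the set of types alone.\<close>

lemma triad_label_if_edge_types_eq:
  assumes eq: "edge_type \<D> ` nsets T 2 = edge_type \<D> ` nsets T' 2" and sub: "\<B> \<subseteq> \<D>"
  shows "triad_label \<B> T = triad_label \<B> T'"
proof -
  have mem: "B \<in> edge_type \<D> e \<longleftrightarrow> e \<in> B" if "B \<in> \<B>" for B e
    using that sub by (auto simp: edge_type_def)
  have cov: "nsets S 2 \<subseteq> \<Union>\<B> \<longleftrightarrow> (\<forall>\<tau>\<in>edge_type \<D> ` nsets S 2. \<exists>B\<in>\<B>. B \<in> \<tau>)" for S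
    by (simp add: subset_eq mem cong: bex_cong)
  have meet: "{B\<in>\<B>. B \<inter> nsets S 2 \<noteq> {}} = {B\<in>\<B>. \<exists>\<tau>\<in>edge_type \<D> ` nsets S 2. B \<in> \<tau>}" for S
    by (rule Collect_cong, rule conj_cong) (auto simp: mem)
  show ?thesis unfolding triad_label_def cov meet eq ..
qed

lemma triangles_if_edge_types_eq:
  assumes eq: "edge_type \<D> ` nsets T 2 = edge_type \<D> ` nsets T' 2" and Q: "Q \<in> \<D>"
    and c: "card T = 3" "card T' = 3"
  shows "T \<in> triangles Q \<longleftrightarrow> T' \<in> triangles Q"
proof -
  have sub: "nsets S 2 \<subseteq> Q \<longleftrightarrow> (\<forall>\<tau>\<in>edge_type \<D> ` nsets S 2. Q \<in> \<tau>)" for S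
    using Q by (auto simp: edge_type_def)
  show ?thesis unfolding triangles_def mem_Collect_eq c sub eq ..
qed

lemma card_triples_over:
  assumes V: "finite V" and Z: "Z \<subseteq> nsets V 2"
  shows "card {T\<in>nsets V 3. nsets T 2 \<inter> Z \<noteq> {}} \<le> card Z * card V"
proof -
  have fZ: "finite Z" using Z V by (meson finite_imp_finite_nsets finite_subset)
  have "{T\<in>nsets V 3. nsets T 2 \<inter> Z \<noteq> {}} \<subseteq> (\<lambda>(e, v). insert v e) ` (Z \<times> V)"
  proof
    fix T assume "T \<in> {T\<in>nsets V 3. nsets T 2 \<inter> Z \<noteq> {}}"
    then obtain e where e: "e \<in> Z" "e \<subseteq> T" "finite e" "card e = 2" and T: "T \<subseteq> V" "finite T" "card T = 3"
      by (auto simp: nsets_def)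
    have "card (T - e) = 1" using e T by (simp add: card_Diff_subset)
    then obtain v where "T - e = {v}" by (auto simp: card_1_singleton_iff)
    then have "T = insert v e" "v \<in> V" using e(2) T(1) by auto
    then show "T \<in> (\<lambda>(e, v). insert v e) ` (Z \<times> V)" using e(1) by force
  qed
  then have "card {T\<in>nsets V 3. nsets T 2 \<inter> Z \<noteq> {}} \<le> card ((\<lambda>(e, v). insert v e) ` (Z \<times> V))"
    using fZ V by (intro card_mono) auto
  also have "\<dots> \<le> card (Z \<times> V)" using fZ V by (intro card_image_le) auto
  finally show ?thesis by (simp add: card_cartesian_product)
qed

section \<open>Triads of an equitable partition and the graphs that witness their
  irregularity\<close>

locale equitable_structure =
  fixes V :: "'a set" and t l :: nat and W :: "nat \<Rightarrow> 'a set" and \<B> :: "'a edges set"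
  assumes finite_V: "finite V" and partition: "vertex_partition V t W"
    and equitable: "equitable l t W \<B>" and l_pos: "1 \<le> l"
begin

lemmas class_unique = vertex_partition_unique[OF partition]

lemma partition_members: "partition_on (complete_multipartite t W) \<B>"
  using equitable by (simp add: equitable_def)

lemma member_unique: "B \<in> \<B> \<Longrightarrow> B' \<in> \<B> \<Longrightarrow> e \<in> B \<Longrightarrow> e \<in> B' \<Longrightarrow> B = B'"
  using partition_members unfolding partition_on_def disjoint_def by blast

lemma class_subset: "i \<in> {1..t} \<Longrightarrow> W i \<subseteq> V"
  using partition unfolding vertex_partition_def by blast

lemma finite_card_members: "finite \<B>" "card \<B> \<le> t * t * l"
proof -
  let ?M = "\<lambda>(i, j). pair_members W \<B> i j"
  let ?I = "{(i, j) \<in> {1..t} \<times> {1..t}. i \<noteq> j}"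
  have cM: "card (?M p) = l" if "p \<in> ?I" for p
    using equitable that unfolding equitable_def by auto
  have fM: "finite (?M p)" if "p \<in> ?I" for p
    using cM[OF that] l_pos by (intro card_ge_0_finite) simp
  have fI: "finite ?I" by (rule finite_subset[of _ "{1..t} \<times> {1..t}"]) auto
  have "card ?I \<le> card ({1..t} \<times> {1..t})" by (rule card_mono) auto
  then have cI: "card ?I \<le> t * t" by (simp add: card_cartesian_product)
  have sub: "\<B> \<subseteq> (\<Union>p\<in>?I. ?M p)"
  proof
    fix B assume "B \<in> \<B>"
    moreover from this obtain i j where "i \<in> {1..t}" "j \<in> {1..t}" "i \<noteq> j" "B \<subseteq> complete_bipartite (W i) (W j)"
      using equitable unfolding equitable_def by blast
    ultimately have "(i, j) \<in> ?I" "B \<in> ?M (i, j)" by (auto simp: pair_members_def)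
    then show "B \<in> (\<Union>p\<in>?I. ?M p)" by (rule UN_I)
  qed
  have fU: "finite (\<Union>p\<in>?I. ?M p)" using fI fM by (rule finite_UN_I)
  show "finite \<B>" by (rule finite_subset[OF sub fU])
  have "card \<B> \<le> card (\<Union>p\<in>?I. ?M p)" by (rule card_mono[OF fU sub])
  also have "\<dots> \<le> (\<Sum>p\<in>?I. card (?M p))" by (rule card_UN_le[OF fI])
  also have "\<dots> = card ?I * l" using cM by simp
  also have "\<dots> \<le> t * t * l" using cI by simp
  finally show "card \<B> \<le> t * t * l" .
qed

context
  fixes i j k B1 B2 B3
  assumes ijk: "1 \<le> i" "i < j" "j < k" "k \<le> t"
    and B: "B1 \<in> pair_members W \<B> i j" "B2 \<in> pair_members W \<B> i k" "B3 \<in> pair_members W \<B> j k"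
begin

lemma indices: "i \<in> {1..t}" "j \<in> {1..t}" "k \<in> {1..t}" "i \<noteq> j" "i \<noteq> k" "j \<noteq> k"
  using ijk by auto

text \<open>Every edge of the triad joins two different classes among the three. The vertices of a
  triangle are therefore in three different classes, one in each, and the edge between two given
  classes can only come from the member for these classes.\<close>

lemma triangle_in_triad:
  assumes T: "T \<in> triangles (B1 \<union> B2 \<union> B3)"
  obtains x y z where "T = {x, y, z}" "x \<in> W i" "y \<in> W j" "z \<in> W k" "x \<noteq> y" "x \<noteq> z" "y \<noteq> z"
    "{x, y} \<in> B1" "{x, z} \<in> B2" "{y, z} \<in> B3"
proof -
  let ?P = "B1 \<union> B2 \<union> B3"
  have Bsub: "B1 \<subseteq> complete_bipartite (W i) (W j)" "B2 \<subseteq> complete_bipartite (W i) (W k)" "B3 \<subseteq> complete_bipartite (W j) (W k)"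
    using B by (auto simp: pair_members_def)
  have bip: "(u \<in> W p \<and> v \<in> W q) \<or> (u \<in> W q \<and> v \<in> W p)"
    if "{u, v} \<in> B" "B \<subseteq> complete_bipartite (W p) (W q)" for u v p q and B :: "'a edges"
    using subsetD[OF that(2,1)] by (auto simp: complete_bipartite_def doubleton_eq_iff)
  have cross: "\<exists>p q. p \<in> {i, j, k} \<and> q \<in> {i, j, k} \<and> p \<noteq> q \<and> u \<in> W p \<and> v \<in> W q" if "{u, v} \<in> ?P" for u v
    using that
  proof (elim UnE)
    assume "{u, v} \<in> B1"
    from bip[OF this Bsub(1)] show ?thesis using indices by blast
  next
    assume "{u, v} \<in> B2"
    from bip[OF this Bsub(2)] show ?thesis using indices by blast
  next
    assume "{u, v} \<in> B3"
    from bip[OF this Bsub(3)] show ?thesis using indices by blast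
  qed
  have in_range: "p \<in> {1..t}" if "p \<in> {i, j, k}" for p using that indices by blast
  obtain a b c where abc: "T = {a, b, c}" "a \<noteq> b" "a \<noteq> c" "b \<noteq> c"
    using T unfolding triangles_def card_3_iff by blast
  have T2: "nsets T 2 \<subseteq> ?P" using T by (simp add: triangles_def)
  have pairs: "{a, b} \<in> ?P" "{a, c} \<in> ?P" "{b, c} \<in> ?P"
    by (rule subsetD[OF T2], rule nsets_2_pair; use abc in blast)+
  obtain p q where pq: "p \<in> {i, j, k}" "q \<in> {i, j, k}" "p \<noteq> q" "a \<in> W p" "b \<in> W q"
    using cross[OF pairs(1)] by blast
  obtain p' s where ps: "p' \<in> {i, j, k}" "s \<in> {i, j, k}" "p' \<noteq> s" "a \<in> W p'" "c \<in> W s"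
    using cross[OF pairs(2)] by blast
  obtain q' s' where qs: "q' \<in> {i, j, k}" "s' \<in> {i, j, k}" "q' \<noteq> s'" "b \<in> W q'" "c \<in> W s'"
    using cross[OF pairs(3)] by blast
  have "p = p'" "q = q'" "s = s'"
    using class_unique[OF pq(4) ps(4)] class_unique[OF pq(5) qs(4)] class_unique[OF ps(5) qs(5)]
      in_range pq ps qs by auto
  then have dist: "p \<noteq> q" "p \<noteq> s" "q \<noteq> s" using pq ps qs by auto
  have "\<exists>x y z. T = {x, y, z} \<and> x \<in> W i \<and> y \<in> W j \<and> z \<in> W k"
  proof -
    have "(p = i \<and> q = j \<and> s = k) \<or> (p = i \<and> q = k \<and> s = j) \<or> (p = j \<and> q = i \<and> s = k) \<or>
      (p = j \<and> q = k \<and> s = i) \<or> (p = k \<and> q = i \<and> s = j) \<or> (p = k \<and> q = j \<and> s = i)"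
      using pq(1,2) ps(2) dist by auto
    moreover have "T = {a, c, b}" "T = {b, a, c}" "T = {b, c, a}" "T = {c, a, b}" "T = {c, b, a}"
      using abc(1) by auto
    ultimately show ?thesis using abc(1) pq(4,5) ps(5) by metis
  qed
  then obtain x y z where xyz: "T = {x, y, z}" "x \<in> W i" "y \<in> W j" "z \<in> W k" by blast
  have neq: "x \<noteq> y" "x \<noteq> z" "y \<noteq> z"
    using class_unique xyz(2-4) indices by metis+
  have only: "False" if "{u, v} \<in> B" "B \<subseteq> complete_bipartite (W p) (W q)" "u \<in> W p'" "v \<in> W q'"
    "p \<in> {1..t}" "q \<in> {1..t}" "p' \<in> {1..t}" "q' \<in> {1..t}" "\<not> (p = p' \<and> q = q')" "\<not> (p = q' \<and> q = p')"
    for u v p q p' q' and B :: "'a edges"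
    using bip[OF that(1,2)] class_unique[OF that(3)] class_unique[OF that(4)] that(5-) by metis
  have mem: "{x, y} \<in> ?P" "{x, z} \<in> ?P" "{y, z} \<in> ?P"
    by (rule subsetD[OF T2], rule nsets_2_pair; use xyz(1) neq in blast)+
  have "{x, y} \<in> B1"
    using mem(1) only[OF _ Bsub(2) xyz(2,3)] only[OF _ Bsub(3) xyz(2,3)] indices by auto
  moreover have "{x, z} \<in> B2"
    using mem(2) only[OF _ Bsub(1) xyz(2,4)] only[OF _ Bsub(3) xyz(2,4)] indices by auto
  moreover have "{y, z} \<in> B3"
    using mem(3) only[OF _ Bsub(1) xyz(3,4)] only[OF _ Bsub(2) xyz(3,4)] indices by auto
  ultimately show ?thesis using that xyz neq by blast
qed

text \<open>This identifies \<open>relative_density H P\<close> with the fibre density over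
  \<open>P\<close>, so that irregular triads become the bad fibres of
  \<open>residual_increment\<close>. It also makes the triangle sets of different triads
  disjoint.\<close>

lemma fibre_triad: "fibre (nsets V 3) (triad_label \<B>) (B1 \<union> B2 \<union> B3) = triangles (B1 \<union> B2 \<union> B3)"
proof (intro equalityI subsetI)
  have mem: "B1 \<in> \<B>" "B2 \<in> \<B>" "B3 \<in> \<B>" using B by (auto simp: pair_members_def)
  {
    fix T assume "T \<in> fibre (nsets V 3) (triad_label \<B>) (B1 \<union> B2 \<union> B3)"
    then have T: "card T = 3" and lab: "triad_label \<B> T = B1 \<union> B2 \<union> B3"
      by (auto simp: fibre_def nsets_def)
    \<comment> \<open>Parts are nonempty, so the label of \<open>T\<close> is not the default
      \<open>{}\<close> and all pairs of \<open>T\<close> are covered by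
      \<open>\<B>\<close>.\<close>
    have "B1 \<noteq> {}" using partition_members mem(1) unfolding partition_on_def by blast
    then have cov: "nsets T 2 \<subseteq> \<Union>\<B>" using lab by (auto simp: triad_label_def split: if_splits)
    then have "nsets T 2 \<subseteq> triad_label \<B> T" unfolding triad_label_def by auto
    then show "T \<in> triangles (B1 \<union> B2 \<union> B3)" using T lab by (simp add: triangles_def)
  next
    fix T assume T: "T \<in> triangles (B1 \<union> B2 \<union> B3)"
    then obtain x y z where xyz: "T = {x, y, z}" "x \<in> W i" "y \<in> W j" "z \<in> W k" "x \<noteq> y" "x \<noteq> z" "y \<noteq> z"
      "{x, y} \<in> B1" "{x, z} \<in> B2" "{y, z} \<in> B3"
      by (rule triangle_in_triad)
    have TV: "T \<in> nsets V 3" using xyz class_subset indices by (auto simp: nsets_def)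
    have T2: "nsets T 2 \<subseteq> B1 \<union> B2 \<union> B3" using T by (simp add: triangles_def)
    have pairs: "{x, y} \<in> nsets T 2" "{x, z} \<in> nsets T 2" "{y, z} \<in> nsets T 2"
      by (rule nsets_2_pair; use xyz in blast)+
    have "{B\<in>\<B>. B \<inter> nsets T 2 \<noteq> {}} = {B1, B2, B3}"
    proof (intro equalityI subsetI)
      fix B assume "B \<in> {B\<in>\<B>. B \<inter> nsets T 2 \<noteq> {}}"
      then show "B \<in> {B1, B2, B3}" using T2 member_unique mem by blast
    next
      fix B assume "B \<in> {B1, B2, B3}"
      then show "B \<in> {B\<in>\<B>. B \<inter> nsets T 2 \<noteq> {}}" using mem pairs xyz(8-10) by blast
    qed
    moreover have "nsets T 2 \<subseteq> \<Union>\<B>" using T2 mem by blast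
    ultimately have "triad_label \<B> T = B1 \<union> B2 \<union> B3" by (auto simp: triad_label_def)
    then show "T \<in> fibre (nsets V 3) (triad_label \<B>) (B1 \<union> B2 \<union> B3)" using TV by (simp add: fibre_def)
  }
qed

text \<open>Triangles of a triad are transversal, so restricting the hypergraph to the three classes
  loses none of them. This matches the restricted hypergraph in the regularity condition with the
  full one in the density.\<close>

lemma hyp_restrict_triangles:
  assumes Q: "Q \<subseteq> B1 \<union> B2 \<union> B3"
  shows "hyp_restrict H (W i) (W j) (W k) \<inter> triangles Q = H \<inter> triangles Q"
proof -
  have "card (T \<inter> W i) = 1 \<and> card (T \<inter> W j) = 1 \<and> card (T \<inter> W k) = 1" if "T \<in> triangles Q" for T
  proof -
    have "T \<in> triangles (B1 \<union> B2 \<union> B3)" using that Q by (auto simp: triangles_def)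
    then obtain x y z where xyz: "T = {x, y, z}" "x \<in> W i" "y \<in> W j" "z \<in> W k"
      by (rule triangle_in_triad)
    have "x \<notin> W j" "x \<notin> W k" "y \<notin> W i" "y \<notin> W k" "z \<notin> W i" "z \<notin> W j"
      using xyz(2-4) class_unique indices by metis+
    then have "T \<inter> W i = {x}" "T \<inter> W j = {y}" "T \<inter> W k = {z}"
      using xyz by auto
    then show ?thesis by simp
  qed
  then show ?thesis by (auto simp: hyp_restrict_def)
qed

end

lemma triad_of_irregular:
  assumes "P \<in> irregular_triads \<delta> r t W \<B> H"
  shows "fibre (nsets V 3) (triad_label \<B>) P = triangles P"
    and "\<exists>B1\<in>\<B>. \<exists>B2\<in>\<B>. \<exists>B3\<in>\<B>. P = B1 \<union> B2 \<union> B3"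
    and "\<exists>Q. (\<forall>i\<in>{1..r}. Q i \<subseteq> P) \<and> \<delta> * real (card (triangles P)) <
        \<bar>real (card (\<Union>i\<in>{1..r}. H \<inter> triangles (Q i)))
           - relative_density H P * real (card (\<Union>i\<in>{1..r}. triangles (Q i)))\<bar>"
proof -
  obtain i j k B1 B2 B3 where ijk: "1 \<le> i" "i < j" "j < k" "k \<le> t"
    and B: "B1 \<in> pair_members W \<B> i j" "B2 \<in> pair_members W \<B> i k" "B3 \<in> pair_members W \<B> j k"
    and P: "P = B1 \<union> B2 \<union> B3"
    and irr: "\<not> regular_wrt_graph \<delta> (relative_density H P) r P (hyp_restrict H (W i) (W j) (W k))"
    using assms unfolding irregular_triads_def by blast
  show "fibre (nsets V 3) (triad_label \<B>) P = triangles P"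
    unfolding P by (rule fibre_triad[OF ijk B])
  show "\<exists>B1\<in>\<B>. \<exists>B2\<in>\<B>. \<exists>B3\<in>\<B>. P = B1 \<union> B2 \<union> B3"
    using B P unfolding pair_members_def by blast
  obtain Q where Q: "\<forall>i\<in>{1..r}. Q i \<subseteq> P" and viol: "\<delta> * real (card (triangles P)) <
        \<bar>real (card (\<Union>a\<in>{1..r}. hyp_restrict H (W i) (W j) (W k) \<inter> triangles (Q a)))
           - relative_density H P * real (card (\<Union>a\<in>{1..r}. triangles (Q a)))\<bar>"
    using irr unfolding regular_wrt_graph_def not_all not_imp not_le by blast
  have "(\<Union>a\<in>{1..r}. hyp_restrict H (W i) (W j) (W k) \<inter> triangles (Q a)) = (\<Union>a\<in>{1..r}. H \<inter> triangles (Q a))"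
    using Q hyp_restrict_triangles[OF ijk B] unfolding P by (intro SUP_cong) auto
  with Q viol show "\<exists>Q. (\<forall>i\<in>{1..r}. Q i \<subseteq> P) \<and> \<delta> * real (card (triangles P)) <
        \<bar>real (card (\<Union>i\<in>{1..r}. H \<inter> triangles (Q i)))
           - relative_density H P * real (card (\<Union>i\<in>{1..r}. triangles (Q i)))\<bar>"
    by (intro exI[of _ Q]) simp
qed

lemma card_irregular_triads:
  "finite (irregular_triads \<delta> r t W \<B> H)" "card (irregular_triads \<delta> r t W \<B> H) \<le> (t * t * l) ^ 3"
proof -
  let ?g = "\<lambda>(B1, B2, B3). B1 \<union> B2 \<union> B3"
  have sub: "irregular_triads \<delta> r t W \<B> H \<subseteq> ?g ` (\<B> \<times> \<B> \<times> \<B>)"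
  proof
    fix P assume "P \<in> irregular_triads \<delta> r t W \<B> H"
    from triad_of_irregular(2)[OF this] show "P \<in> ?g ` (\<B> \<times> \<B> \<times> \<B>)" by force
  qed
  have fin: "finite (\<B> \<times> \<B> \<times> \<B>)" using finite_card_members(1) by simp
  show "finite (irregular_triads \<delta> r t W \<B> H)" using finite_subset[OF sub] fin by simp
  have "card (irregular_triads \<delta> r t W \<B> H) \<le> card (?g ` (\<B> \<times> \<B> \<times> \<B>))" using fin by (intro card_mono[OF _ sub]) simp
  also have "\<dots> \<le> card (\<B> \<times> \<B> \<times> \<B>)" by (rule card_image_le[OF fin])
  also have "\<dots> = card \<B> ^ 3" by (simp add: card_cartesian_product power3_eq_cube mult.assoc)
  also have "\<dots> \<le> (t * t * l) ^ 3" using finite_card_members(2) by (rule power_mono) simp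
  finally show "card (irregular_triads \<delta> r t W \<B> H) \<le> (t * t * l) ^ 3" .
qed

text \<open>\<open>\<D>\<close> consists of the members of \<open>\<B>\<close> and all witnesses
  \<open>Q H P i\<close>. A labelling that determines the edge types off \<open>X\<close> also
  determines there the old triad and which witnesses have the triple as a triangle, which is the
  hypothesis \<open>factor\<close> of \<open>residual_increment\<close>. \<open>\<D>\<close> is
  fixed before \<open>\<pi>'\<close> and \<open>X\<close>, since the new structure is built from
  \<open>\<D>\<close>.\<close>

lemma refining_graphs:
  assumes \<H>: "finite \<H>" "card \<H> \<le> s" and \<delta>: "0 < \<delta>" and \<delta>1: "\<delta>1 = min \<delta> 1"
  shows "\<exists>\<D>. finite \<D> \<and> card \<D> \<le> t * t * l + s * ((t * t * l) ^ 3 * r) \<and>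
    (\<forall>(\<pi>' :: 'a set \<Rightarrow> 'l) X. X \<subseteq> nsets V 3 \<longrightarrow>
      (\<forall>T\<in>nsets V 3 - X. \<forall>T'\<in>nsets V 3 - X. \<pi>' T = \<pi>' T' \<longrightarrow> edge_type \<D> ` nsets T 2 = edge_type \<D> ` nsets T' 2) \<longrightarrow>
      (\<forall>H\<in>\<H>. residual (nsets V 3) \<pi>' H \<le> residual (nsets V 3) (triad_label \<B>) H
         - \<delta>1\<^sup>2 * card (\<Union>P\<in>irregular_triads \<delta> r t W \<B> H. triangles P) + 4 * card X))"
proof -
  define \<Omega> where "\<Omega> = nsets V 3"
  define irr where "irr H = irregular_triads \<delta> r t W \<B> H" for H
  have fO: "finite \<Omega>" unfolding \<Omega>_def using finite_V by (rule finite_imp_finite_nsets)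
  define wit where "wit H P Q \<longleftrightarrow> (\<forall>i\<in>{1..r}. Q i \<subseteq> P) \<and> \<delta> * real (card (triangles P)) <
        \<bar>real (card (\<Union>i\<in>{1..r}. H \<inter> triangles (Q i)))
           - relative_density H P * real (card (\<Union>i\<in>{1..r}. triangles (Q i)))\<bar>" for H P and Q :: "nat \<Rightarrow> 'a edges"
  define Q where "Q H P = (SOME Q. wit H P Q)" for H P
  have wit: "wit H P (Q H P)" if "P \<in> irr H" for H P
  proof -
    have "\<exists>Q. wit H P Q"
      using triad_of_irregular(3)[OF that[unfolded irr_def]] unfolding wit_def .
    then show ?thesis unfolding Q_def by (rule someI_ex)
  qed
  define \<D> where "\<D> = \<B> \<union> (\<Union>H\<in>\<H>. \<Union>P\<in>irr H. Q H P ` {1..r})"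
  have firr: "finite (irr H)" and cirr: "card (irr H) \<le> (t * t * l) ^ 3" for H
    unfolding irr_def by (rule card_irregular_triads)+
  have f\<D>: "finite \<D>" using finite_card_members(1) \<H>(1) firr by (simp add: \<D>_def)
  have "card (\<Union>P\<in>irr H. Q H P ` {1..r}) \<le> (t * t * l) ^ 3 * r" for H
  proof -
    have "card (\<Union>P\<in>irr H. Q H P ` {1..r}) \<le> (\<Sum>P\<in>irr H. card (Q H P ` {1..r}))" by (rule card_UN_le[OF firr])
    also have "\<dots> \<le> (\<Sum>P\<in>irr H. r)"
      by (rule sum_mono) (use card_image_le[of "{1..r}"] in auto)
    also have "\<dots> = card (irr H) * r" by simp
    also have "\<dots> \<le> (t * t * l) ^ 3 * r" using cirr by simp
    finally show ?thesis .
  qed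
  then have "(\<Sum>H\<in>\<H>. card (\<Union>P\<in>irr H. Q H P ` {1..r})) \<le> (\<Sum>H\<in>\<H>. (t * t * l) ^ 3 * r)" by (intro sum_mono)
  then have "card (\<Union>H\<in>\<H>. \<Union>P\<in>irr H. Q H P ` {1..r}) \<le> card \<H> * ((t * t * l) ^ 3 * r)"
    using card_UN_le[OF \<H>(1), of "\<lambda>H. \<Union>P\<in>irr H. Q H P ` {1..r}"] by simp
  also have "\<dots> \<le> s * ((t * t * l) ^ 3 * r)" using \<H>(2) by (rule mult_right_mono) simp
  finally have c\<D>: "card \<D> \<le> t * t * l + s * ((t * t * l) ^ 3 * r)"
    using finite_card_members(2) card_Un_le[of \<B> "\<Union>H\<in>\<H>. \<Union>P\<in>irr H. Q H P ` {1..r}"] unfolding \<D>_def by linarith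
  have increment: "residual \<Omega> \<pi>' H \<le> residual \<Omega> (triad_label \<B>) H - \<delta>1\<^sup>2 * card (\<Union>P\<in>irr H. triangles P) + 4 * card X"
    if X: "X \<subseteq> \<Omega>" and H: "H \<in> \<H>"
      and factor: "\<forall>T\<in>\<Omega> - X. \<forall>T'\<in>\<Omega> - X. \<pi>' T = \<pi>' T' \<longrightarrow> edge_type \<D> ` nsets T 2 = edge_type \<D> ` nsets T' 2"
    for \<pi>' :: "'a set \<Rightarrow> 'l" and X H
  proof -
    define U where "U = (\<Union>P\<in>irr H. \<Union>i\<in>{1..r}. triangles (Q H P i))"
    have fib: "fibre \<Omega> (triad_label \<B>) P = triangles P" if "P \<in> irr H" for P
      using triad_of_irregular(1)[OF that[unfolded irr_def]] by (simp add: \<Omega>_def)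
    have sub: "triangles (Q H P i) \<subseteq> triangles P" if "P \<in> irr H" "i \<in> {1..r}" for P i
    proof -
      have "Q H P i \<subseteq> P" using wit[OF that(1)] that(2) unfolding wit_def by blast
      then show ?thesis by (auto simp: triangles_def)
    qed
    \<comment> \<open>Different triads are different fibres and share no triangle. Hence the
      witnesses of other triads leave no trace on \<open>P\<close>, and one set \<open>U\<close>
      serves all irregular triads of \<open>H\<close>.\<close>
    have Ufib: "U \<inter> triangles P = (\<Union>i\<in>{1..r}. triangles (Q H P i))" if P: "P \<in> irr H" for P
    proof (intro equalityI subsetI)
      fix T assume T: "T \<in> U \<inter> triangles P"
      then obtain P' i where P': "P' \<in> irr H" "i \<in> {1..r}" "T \<in> triangles (Q H P' i)" unfolding U_def by blast
      then have "T \<in> triangles P'" using sub by blast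
      then have "P' = P" using T fib[OF P] fib[OF P'(1)] by (auto simp: fibre_def)
      then show "T \<in> (\<Union>i\<in>{1..r}. triangles (Q H P i))" using P' by blast
    next
      fix T assume "T \<in> (\<Union>i\<in>{1..r}. triangles (Q H P i))"
      then show "T \<in> U \<inter> triangles P" using sub P unfolding U_def by blast
    qed
    have "residual \<Omega> \<pi>' H \<le> residual \<Omega> (triad_label \<B>) H - \<delta>1\<^sup>2 * card {T\<in>\<Omega>. triad_label \<B> T \<in> irr H} + 4 * card X"
    proof (rule residual_increment[OF fO _ _ X, where U = U])
      show "0 \<le> \<delta>1" "\<delta>1 \<le> 1" using \<delta> \<delta>1 by auto
      fix P assume P: "P \<in> irr H"
      have "\<delta>1 * card (triangles P) \<le> \<delta> * card (triangles P)" using \<delta>1 by (intro mult_right_mono) auto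
      also have "\<dots> \<le> \<bar>real (card (\<Union>i\<in>{1..r}. H \<inter> triangles (Q H P i)))
           - relative_density H P * real (card (\<Union>i\<in>{1..r}. triangles (Q H P i)))\<bar>"
        using wit[OF P] unfolding wit_def by simp
      also have "(\<Union>i\<in>{1..r}. H \<inter> triangles (Q H P i)) = H \<inter> U \<inter> triangles P"
        using Ufib[OF P] by blast
      finally show "\<delta>1 * card (fibre \<Omega> (triad_label \<B>) P)
          \<le> \<bar>real (card (H \<inter> U \<inter> fibre \<Omega> (triad_label \<B>) P))
             - fibre_density \<Omega> (triad_label \<B>) H P * card (U \<inter> fibre \<Omega> (triad_label \<B>) P)\<bar>"
        unfolding fibre_density_def fib[OF P] relative_density_def Ufib[OF P] .
    next
      fix T T' assume T: "T \<in> \<Omega> - X" "T' \<in> \<Omega> - X" "\<pi>' T = \<pi>' T'"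
      have eq: "edge_type \<D> ` nsets T 2 = edge_type \<D> ` nsets T' 2" using factor T by blast
      have "card T = 3" "card T' = 3" using T by (auto simp: \<Omega>_def nsets_def)
      then have tri: "T \<in> triangles G \<longleftrightarrow> T' \<in> triangles G" if "G \<in> \<D>" for G
        using triangles_if_edge_types_eq[OF eq that] by blast
      have "T \<in> triangles (Q H P i) \<longleftrightarrow> T' \<in> triangles (Q H P i)" if "P \<in> irr H" "i \<in> {1..r}" for P i
      proof (rule tri)
        show "Q H P i \<in> \<D>" unfolding \<D>_def using that H by blast
      qed
      then have "T \<in> U \<longleftrightarrow> T' \<in> U" unfolding U_def by blast
      moreover have "triad_label \<B> T = triad_label \<B> T'"
        by (rule triad_label_if_edge_types_eq[OF eq]) (simp add: \<D>_def)
      ultimately show "triad_label \<B> T = triad_label \<B> T' \<and> (T \<in> U \<longleftrightarrow> T' \<in> U)" by blast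
    qed
    moreover have "{T\<in>\<Omega>. triad_label \<B> T \<in> irr H} = (\<Union>P\<in>irr H. triangles P)"
    proof -
      have "{T\<in>\<Omega>. triad_label \<B> T \<in> irr H} = (\<Union>P\<in>irr H. fibre \<Omega> (triad_label \<B>) P)" by (auto simp: fibre_def)
      then show ?thesis using fib by simp
    qed
    ultimately show ?thesis by simp
  qed
  show ?thesis
    by (rule exI[of _ \<D>], intro conjI allI impI ballI)
      (rule f\<D> c\<D> increment[unfolded \<Omega>_def irr_def]; assumption)+
qed

end

subsection \<open>The increment step\<close>

text \<open>The irregular triads of \<open>H0\<close> contain more than
  \<open>\<delta>3 * n ^ 3\<close> triples, which gains at least
  \<open>\<delta> ^ 3 * n ^ 3\<close>. Any residual may rise by \<open>4 * card X\<close>, where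
  \<open>X\<close> is the set of triples containing a pair of \<open>Z\<close>; over
  \<open>s\<close> hypergraphs this is at most \<open>4 * s * \<epsilon> * n ^ 3\<close>, half of
  the gain by the choice of \<open>\<epsilon>\<close>.\<close>

lemma residual_step:
  fixes \<delta>3 \<epsilon> :: real and s D t l r :: nat
  assumes V: "finite V" and \<H>: "finite \<H>" "card \<H> \<le> s" "\<forall>H\<in>\<H>. H \<subseteq> nsets V 3"
    and \<delta>: "\<delta> = min \<delta>3 1" "0 < \<delta>3" and S: "regularized d \<H> V t l W \<B>" "1 \<le> l"
    and irr: "H0 \<in> \<H>" "\<not> regular_wrt_partition \<delta>3 r V t W \<B> H0"
    and \<epsilon>: "8 * s * \<epsilon> \<le> \<delta> ^ 3"
  shows "\<exists>\<D>. finite \<D> \<and> card \<D> \<le> t * t * l + s * ((t * t * l) ^ 3 * r) \<and>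
    (\<forall>t' W' \<B>' l' d' Z. regularized d' \<H> V t' l' W' \<B>' \<longrightarrow> Z \<subseteq> nsets V 2 \<longrightarrow>
       card Z \<le> \<epsilon> * card V ^ 2 \<longrightarrow> nsets V 2 - Z \<subseteq> complete_multipartite t' W' \<longrightarrow>
       (\<forall>B\<in>\<B>'. \<forall>e\<in>B - Z. \<forall>e'\<in>B - Z. edge_type \<D> e = edge_type \<D> e') \<longrightarrow>
       (\<Sum>H\<in>\<H>. residual (nsets V 3) (triad_label \<B>') H)
         \<le> (\<Sum>H\<in>\<H>. residual (nsets V 3) (triad_label \<B>) H) - \<delta> ^ 3 / 2 * card V ^ 3)"
proof -
  interpret equitable_structure V t l W \<B>
    using V S by unfold_locales (auto simp: regularized_def)
  define n where "n = card V"
  define \<Omega> where "\<Omega> = nsets V 3"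
  define irrT where "irrT H = (\<Union>P\<in>irregular_triads \<delta>3 r t W \<B> H. triangles P)" for H
  obtain \<D> where \<D>: "finite \<D>" "card \<D> \<le> t * t * l + s * ((t * t * l) ^ 3 * r)"
    and ref: "\<forall>(\<pi>' :: 'a set \<Rightarrow> 'a edges) X. X \<subseteq> \<Omega> \<longrightarrow>
      (\<forall>T\<in>\<Omega> - X. \<forall>T'\<in>\<Omega> - X. \<pi>' T = \<pi>' T' \<longrightarrow> edge_type \<D> ` nsets T 2 = edge_type \<D> ` nsets T' 2) \<longrightarrow>
      (\<forall>H\<in>\<H>. residual \<Omega> \<pi>' H \<le> residual \<Omega> (triad_label \<B>) H - \<delta>\<^sup>2 * card (irrT H) + 4 * card X)"
    using refining_graphs[OF \<H>(1,2) \<delta>(2,1), where r = r] unfolding \<Omega>_def irrT_def by (elim exE conjE)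
  have "(\<Sum>H\<in>\<H>. residual \<Omega> (triad_label \<B>') H) \<le> (\<Sum>H\<in>\<H>. residual \<Omega> (triad_label \<B>) H) - \<delta> ^ 3 / 2 * n ^ 3"
    if S': "regularized d' \<H> V t' l' W' \<B>'" and Z: "Z \<subseteq> nsets V 2" "card Z \<le> \<epsilon> * card V ^ 2"
      and cover: "nsets V 2 - Z \<subseteq> complete_multipartite t' W'"
      and mono: "\<forall>B\<in>\<B>'. \<forall>e\<in>B - Z. \<forall>e'\<in>B - Z. edge_type \<D> e = edge_type \<D> e'"
    for t' W' \<B>' l' d' Z
  proof -
    define X where "X = {T\<in>\<Omega>. nsets T 2 \<inter> Z \<noteq> {}}"
    have part: "partition_on (complete_multipartite t' W') \<B>'"
      using S' by (simp add: regularized_def equitable_def)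
    have sub: "edge_type \<D> ` nsets T 2 \<subseteq> edge_type \<D> ` nsets T' 2"
      if T: "T \<in> \<Omega> - X" "T' \<in> \<Omega> - X" "triad_label \<B>' T = triad_label \<B>' T'" for T T'
      by (rule edge_types_if_triad_label_eq[OF part cover mono _ _ _ _ T(3)])
        (use T in \<open>auto simp: X_def \<Omega>_def nsets_def[of V]\<close>)
    have factor: "\<forall>T\<in>\<Omega> - X. \<forall>T'\<in>\<Omega> - X. triad_label \<B>' T = triad_label \<B>' T' \<longrightarrow>
        edge_type \<D> ` nsets T 2 = edge_type \<D> ` nsets T' 2"
      by (intro ballI impI equalityI sub) auto
    have "X \<subseteq> \<Omega>" by (auto simp: X_def)
    from ref[rule_format, OF this factor[rule_format]]
    have each: "residual \<Omega> (triad_label \<B>') H \<le> residual \<Omega> (triad_label \<B>) H - \<delta>\<^sup>2 * card (irrT H) + 4 * card X"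
      if "H \<in> \<H>" for H using that by blast
    have "card X \<le> card Z * n"
      unfolding X_def \<Omega>_def n_def by (rule card_triples_over[OF V Z(1)])
    then have "real (card X) \<le> card Z * real n" by (simp flip: of_nat_mult)
    also have "\<dots> \<le> \<epsilon> * n ^ 2 * n" using Z(2) by (intro mult_right_mono) (simp_all add: n_def)
    finally have cX: "real (card X) \<le> \<epsilon> * n ^ 3" by (simp add: power2_eq_square power3_eq_cube mult.assoc)
    have "card \<H> * (4 * real (card X)) \<le> s * (4 * real (card X))" using \<H>(2) by (intro mult_right_mono) auto
    also have "\<dots> \<le> s * (4 * (\<epsilon> * n ^ 3))" using cX by (intro mult_left_mono) auto
    also have "\<dots> = 8 * s * \<epsilon> * n ^ 3 / 2" by simp
    also have "\<dots> \<le> \<delta> ^ 3 * n ^ 3 / 2" using \<epsilon> by (intro divide_right_mono mult_right_mono) auto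
    finally have loss: "card \<H> * (4 * real (card X)) \<le> \<delta> ^ 3 * n ^ 3 / 2" .
    have "\<delta> * n ^ 3 \<le> \<delta>3 * n ^ 3" using \<delta> by (intro mult_right_mono) auto
    also have "\<dots> \<le> card (irrT H0)" using irr(2) by (simp add: regular_wrt_partition_def irrT_def n_def)
    finally have "\<delta>\<^sup>2 * (\<delta> * n ^ 3) \<le> \<delta>\<^sup>2 * card (irrT H0)" by (intro mult_left_mono) auto
    also have "\<dots> \<le> (\<Sum>H\<in>\<H>. \<delta>\<^sup>2 * card (irrT H))"
      using irr(1) \<H>(1) by (intro member_le_sum) auto
    finally have gain: "\<delta> ^ 3 * n ^ 3 \<le> (\<Sum>H\<in>\<H>. \<delta>\<^sup>2 * card (irrT H))"
      by (simp add: power2_eq_square power3_eq_cube mult.assoc)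
    have "(\<Sum>H\<in>\<H>. residual \<Omega> (triad_label \<B>') H)
        \<le> (\<Sum>H\<in>\<H>. residual \<Omega> (triad_label \<B>) H - \<delta>\<^sup>2 * card (irrT H) + 4 * card X)"
      by (rule sum_mono[OF each])
    also have "\<dots> = (\<Sum>H\<in>\<H>. residual \<Omega> (triad_label \<B>) H) - (\<Sum>H\<in>\<H>. \<delta>\<^sup>2 * card (irrT H))
        + card \<H> * (4 * real (card X))"
      by (simp add: sum.distrib sum_subtractf)
    finally show ?thesis using gain loss by simp
  qed
  then show ?thesis using \<D> unfolding \<Omega>_def n_def by (intro exI[of _ \<D>]) blast
qed

section \<open>Iteration of the increment step\<close>

theorem proposition1p3:
  fixes \<delta>3 :: real and \<delta>2 :: "nat \<Rightarrow> real" and r :: "nat \<Rightarrow> nat \<Rightarrow> nat"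
    and l0 t0 s :: nat
  assumes "\<delta>3 > 0"
    and "\<And>l. 0 < \<delta>2 l \<and> \<delta>2 l \<le> 1"
  shows "\<exists>n0 T :: nat. \<forall>n \<ge> n0. \<forall>(V :: 'a set) (H :: nat \<Rightarrow> 'a set set).
    finite V \<and> card V = n \<and> (\<forall>m\<in>{1..s}. H m \<subseteq> nsets V 3) \<longrightarrow>
    (\<exists>(t :: nat) (l :: nat) (W :: nat \<Rightarrow> 'a set) (\<B> :: 'a set set set).
       1 \<le> t \<and> t0 \<le> t \<and> t \<le> T \<and> 1 \<le> l \<and> l0 \<le> l \<and> l \<le> T \<and>
       vertex_partition V t W \<and>
       equitable l t W \<B> \<and>
       ((\<forall>i\<in>{1..<t}. card (W i) \<le> card (W (Suc i))) \<and> card (W t) \<le> card (W 1) + 1) \<and>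
       (\<forall>i j. 1 \<le> i \<and> i < j \<and> j \<le> t \<longrightarrow>
          (\<forall>B\<in>pair_members W \<B> i j. graph_regular (\<delta>2 l) (1 / real l) (W i) (W j) B)) \<and>
       (\<forall>m\<in>{1..s}. weakly_regular (\<delta>2 l) t W (H m)) \<and>
       (\<forall>m\<in>{1..s}. regular_wrt_partition \<delta>3 (r t l) V t W \<B> (H m)))"
proof -
  define \<delta> where "\<delta> = min \<delta>3 1"
  have \<delta>: "0 < \<delta>" using assms(1) by (simp add: \<delta>_def)
  \<comment> \<open>The summand 1 keeps the denominator positive for \<open>s = 0\<close>.\<close>
  define \<epsilon> where "\<epsilon> = \<delta> ^ 3 / (8 * (real s + 1))"
  have \<epsilon>: "0 < \<epsilon>" using \<delta> by (simp add: \<epsilon>_def)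
  have s\<epsilon>: "8 * s * \<epsilon> \<le> \<delta> ^ 3"
    using \<delta> by (simp add: \<epsilon>_def field_simps)
  define inst where "inst n0 V \<H> \<longleftrightarrow> finite V \<and> n0 \<le> card V \<and> finite \<H> \<and> card \<H> \<le> s \<and> (\<forall>H\<in>\<H>. H \<subseteq> nsets V 3)"
    for n0 and V :: "'a set" and \<H>
  define struct where "struct T V \<H> t l W \<B> \<longleftrightarrow> 1 \<le> t \<and> t0 \<le> t \<and> t \<le> T \<and> 1 \<le> l \<and> l0 \<le> l \<and> l \<le> T \<and>
      regularized (\<delta>2 l) \<H> V t l W \<B>" for T and V :: "'a set" and \<H> t l W \<B>
  define good where "good V \<H> t l W \<B> \<longleftrightarrow> (\<forall>H\<in>\<H>. regular_wrt_partition \<delta>3 (r t l) V t W \<B> H)"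
    for V :: "'a set" and \<H> t l W \<B>
  define pot where "pot V \<H> \<B> = (\<Sum>H\<in>\<H>. residual (nsets V 3) (triad_label \<B>) H)"
    for V :: "'a set" and \<H> \<B>
  have approx: "\<exists>T n0. \<forall>(V :: 'a set) \<H> \<D>. inst n0 V \<H> \<and> finite \<D> \<and> card \<D> \<le> D \<longrightarrow>
      (\<exists>t l W \<B> Z. struct T V \<H> t l W \<B> \<and> Z \<subseteq> nsets V 2 \<and> card Z \<le> \<epsilon> * card V ^ 2 \<and>
      nsets V 2 - Z \<subseteq> complete_multipartite t W \<and>
      (\<forall>B\<in>\<B>. \<forall>e\<in>B - Z. \<forall>e'\<in>B - Z. edge_type \<D> e = edge_type \<D> e'))" for D
    using graph_approximation[where \<epsilon> = \<epsilon> and ?\<delta>2.0 = \<delta>2 and ?l0.0 = l0 and ?t0.0 = t0 and s = s and D = D, OF \<epsilon> assms(2)]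
    unfolding inst_def struct_def by (simp only: conj_assoc)
  \<comment> \<open>After \<open>q\<close> rounds either a structure with all required properties
    has been found or the potential has dropped \<open>q\<close> times. The bounds \<open>T\<close>
    and \<open>n0\<close> are uniform over all instances, as the theorem requires.\<close>
  have step: "\<exists>T n0. \<forall>(V :: 'a set) \<H>. inst n0 V \<H> \<longrightarrow>
    (\<exists>t l W \<B>. struct T V \<H> t l W \<B> \<and>
      (good V \<H> t l W \<B> \<or> pot V \<H> \<B> \<le> (s - q * (\<delta> ^ 3 / 2)) * card V ^ 3))" for q :: nat
  proof (induction q)
    case 0
    obtain T n0 where T: "\<forall>(V :: 'a set) \<H> \<D>. inst n0 V \<H> \<and> finite \<D> \<and> card \<D> \<le> 0 \<longrightarrow>
      (\<exists>t l W \<B> Z. struct T V \<H> t l W \<B> \<and> Z \<subseteq> nsets V 2 \<and> card Z \<le> \<epsilon> * card V ^ 2 \<and>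
      nsets V 2 - Z \<subseteq> complete_multipartite t W \<and>
      (\<forall>B\<in>\<B>. \<forall>e\<in>B - Z. \<forall>e'\<in>B - Z. edge_type \<D> e = edge_type \<D> e'))"
      using approx[of 0] by (elim exE)
    have "\<exists>t l W \<B>. struct T V \<H> t l W \<B> \<and>
      (good V \<H> t l W \<B> \<or> pot V \<H> \<B> \<le> (s - real 0 * (\<delta> ^ 3 / 2)) * card V ^ 3)"
      if i: "inst n0 V \<H>" for V :: "'a set" and \<H>
    proof -
      obtain t l W \<B> where S: "struct T V \<H> t l W \<B>"
        using T[rule_format, of V \<H> "{}"] i by auto
      have V: "finite V" and \<H>: "card \<H> \<le> s" using i by (auto simp: inst_def)
      have "card (nsets V 3) \<le> card V ^ 3"
        using binomial_le_pow[of 3 "card V"] by (cases "3 \<le> card V") (simp_all add: card_nsets binomial_eq_0)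
      then have "real (card (nsets V 3)) \<le> card V ^ 3" by (simp only: of_nat_le_iff)
      moreover have "finite (nsets V 3)" using V by (rule finite_imp_finite_nsets)
      ultimately have "residual (nsets V 3) (triad_label \<B>) H \<le> real (card V ^ 3)" for H
        using residual_le_card order_trans by blast
      then have "pot V \<H> \<B> \<le> card \<H> * real (card V ^ 3)"
        unfolding pot_def by (intro sum_bounded_above)
      also have "\<dots> \<le> s * real (card V ^ 3)" using \<H> by (intro mult_right_mono) auto
      finally show ?thesis using S by (intro exI[of _ t] exI[of _ l] exI[of _ W] exI[of _ \<B>]) simp
    qed
    then show ?case by blast
  next
    case (Suc q)
    then obtain T n0 where T: "\<forall>(V :: 'a set) \<H>. inst n0 V \<H> \<longrightarrow>
      (\<exists>t l W \<B>. struct T V \<H> t l W \<B> \<and>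
      (good V \<H> t l W \<B> \<or> pot V \<H> \<B> \<le> (s - q * (\<delta> ^ 3 / 2)) * card V ^ 3))"
      by (elim exE)
    \<comment> \<open>The values \<open>t\<close> and \<open>l\<close> of the current structure
      depend on the instance and are only known to be at most \<open>T\<close>. Summing
      \<open>r\<close> over this range bounds the number of graphs by a constant \<open>D\<close>,
      so that \<open>approx\<close> can be invoked before the instance is given.\<close>
    define R where "R = (\<Sum>t\<le>T. \<Sum>l\<le>T. r t l)"
    have R: "r t l \<le> R" if "t \<le> T" "l \<le> T" for t l
    proof -
      have "r t l \<le> (\<Sum>l\<le>T. r t l)" using that by (intro member_le_sum) auto
      also have "\<dots> \<le> R" unfolding R_def using that(1) by (intro member_le_sum[of t "{..T}" "\<lambda>t. \<Sum>l\<le>T. r t l"]) auto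
      finally show ?thesis .
    qed
    define D where "D = T * T * T + s * ((T * T * T) ^ 3 * R)"
    obtain T' n0' where T': "\<forall>(V :: 'a set) \<H> \<D>. inst n0' V \<H> \<and> finite \<D> \<and> card \<D> \<le> D \<longrightarrow>
      (\<exists>t l W \<B> Z. struct T' V \<H> t l W \<B> \<and> Z \<subseteq> nsets V 2 \<and> card Z \<le> \<epsilon> * card V ^ 2 \<and>
      nsets V 2 - Z \<subseteq> complete_multipartite t W \<and>
      (\<forall>B\<in>\<B>. \<forall>e\<in>B - Z. \<forall>e'\<in>B - Z. edge_type \<D> e = edge_type \<D> e'))"
      using approx[of D] by (elim exE)
    have "\<exists>t l W \<B>. struct (max T T') V \<H> t l W \<B> \<and>
      (good V \<H> t l W \<B> \<or> pot V \<H> \<B> \<le> (s - Suc q * (\<delta> ^ 3 / 2)) * card V ^ 3)"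
      if i: "inst (max n0 n0') V \<H>" for V :: "'a set" and \<H>
    proof -
      have i': "inst n0 V \<H>" "inst n0' V \<H>" using i by (auto simp: inst_def)
      have weaken: "struct (max T T') V \<H> t l W \<B>" if "struct T'' V \<H> t l W \<B>" "T'' \<le> max T T'" for t l W \<B> T''
        using that unfolding struct_def by auto
      obtain t l W \<B> where S: "struct T V \<H> t l W \<B>"
        and alt: "good V \<H> t l W \<B> \<or> pot V \<H> \<B> \<le> (s - q * (\<delta> ^ 3 / 2)) * card V ^ 3"
        using T i'(1) by blast
      show ?thesis
      proof (cases "good V \<H> t l W \<B>")
        case True
        then show ?thesis using weaken[OF S] by auto
      next
        case False
        then obtain H0 where H0: "H0 \<in> \<H>" "\<not> regular_wrt_partition \<delta>3 (r t l) V t W \<B> H0"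
          unfolding good_def by blast
        have reg: "regularized (\<delta>2 l) \<H> V t l W \<B>" "1 \<le> l" "t \<le> T" "l \<le> T"
          using S by (auto simp: struct_def)
        have V: "finite V" "finite \<H>" "card \<H> \<le> s" "\<forall>H\<in>\<H>. H \<subseteq> nsets V 3"
          using i by (auto simp: inst_def)
        obtain \<D> where \<D>: "finite \<D>" "card \<D> \<le> t * t * l + s * ((t * t * l) ^ 3 * r t l)"
          and drop: "\<forall>t' W' \<B>' l' d' Z. regularized d' \<H> V t' l' W' \<B>' \<longrightarrow> Z \<subseteq> nsets V 2 \<longrightarrow>
            card Z \<le> \<epsilon> * card V ^ 2 \<longrightarrow> nsets V 2 - Z \<subseteq> complete_multipartite t' W' \<longrightarrow>
            (\<forall>B\<in>\<B>'. \<forall>e\<in>B - Z. \<forall>e'\<in>B - Z. edge_type \<D> e = edge_type \<D> e') \<longrightarrow>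
            pot V \<H> \<B>' \<le> pot V \<H> \<B> - \<delta> ^ 3 / 2 * card V ^ 3"
          using residual_step[OF V \<delta>_def assms(1) reg(1,2) H0 s\<epsilon>] unfolding pot_def by (elim exE conjE)
        have "t * t * l \<le> T * T * T" using reg(3,4) by (intro mult_le_mono)
        then have "t * t * l + s * ((t * t * l) ^ 3 * r t l) \<le> D"
          unfolding D_def using R[OF reg(3,4)] by (intro add_le_mono mult_le_mono[of _ _ "r t l"] mult_le_mono2 power_mono) simp_all
        with \<D>(2) have c\<D>: "card \<D> \<le> D" by linarith
        obtain t' l' W' \<B>' Z where S': "struct T' V \<H> t' l' W' \<B>'" and Z: "Z \<subseteq> nsets V 2"
          "card Z \<le> \<epsilon> * card V ^ 2" "nsets V 2 - Z \<subseteq> complete_multipartite t' W'"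
          "\<forall>B\<in>\<B>'. \<forall>e\<in>B - Z. \<forall>e'\<in>B - Z. edge_type \<D> e = edge_type \<D> e'"
          using T'[rule_format, OF conjI[OF i'(2) conjI[OF \<D>(1) c\<D>]]] by (elim exE conjE)
        have "regularized (\<delta>2 l') \<H> V t' l' W' \<B>'" using S' by (simp add: struct_def)
        note drop[THEN spec, THEN spec, THEN spec, THEN spec, THEN spec, THEN spec, THEN mp, OF this,
            THEN mp, OF Z(1), THEN mp, OF Z(2), THEN mp, OF Z(3), THEN mp, OF Z(4)]
        with alt False have "pot V \<H> \<B>' \<le> (s - Suc q * (\<delta> ^ 3 / 2)) * card V ^ 3"
          by (simp add: algebra_simps add_divide_distrib)
        then show ?thesis using weaken[OF S'] by auto
      qed
    qed
    then show ?case by blast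
  qed
  \<comment> \<open>After this many unsuccessful rounds the potential, a sum of squares, would be
    negative.\<close>
  obtain q :: nat where q: "s < q * (\<delta> ^ 3 / 2)" using reals_Archimedean3[of "\<delta> ^ 3 / 2"] \<delta> by auto
  obtain T n0 where T: "\<forall>(V :: 'a set) \<H>. inst n0 V \<H> \<longrightarrow>
    (\<exists>t l W \<B>. struct T V \<H> t l W \<B> \<and>
      (good V \<H> t l W \<B> \<or> pot V \<H> \<B> \<le> (s - q * (\<delta> ^ 3 / 2)) * card V ^ 3))"
    using step[of q] by (elim exE)
  have neg: "\<not> pot V \<H> \<B> \<le> (s - q * (\<delta> ^ 3 / 2)) * card V ^ 3" if "1 \<le> card V" for V :: "'a set" and \<H> \<B>
  proof -
    have "(s - q * (\<delta> ^ 3 / 2)) * card V ^ 3 < 0" using that q by (intro mult_neg_pos) auto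
    moreover have "0 \<le> pot V \<H> \<B>" unfolding pot_def by (intro sum_nonneg residual_nonneg)
    ultimately show ?thesis by linarith
  qed
  \<comment> \<open>The family enters as a set; repeated hypergraphs coincide in it, so that its
    cardinality may be less than \<open>s\<close>.\<close>
  have main: "\<exists>t l W \<B>. struct T V (H ` {1..s}) t l W \<B> \<and> good V (H ` {1..s}) t l W \<B>"
    if "max n0 1 \<le> card V" "finite V" "\<forall>m\<in>{1..s}. H m \<subseteq> nsets V 3" for V :: "'a set" and H
  proof -
    have "inst n0 V (H ` {1..s})"
      using that card_image_le[of "{1..s}" H] by (auto simp: inst_def)
    then show ?thesis using T neg[of V "H ` {1..s}"] that(1) by fastforce
  qed
  show ?thesis
  proof (rule exI[of _ "max n0 1"], rule exI[of _ T], intro allI impI)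
    fix n and V :: "'a set" and H :: "nat \<Rightarrow> 'a set set"
    assume "max n0 1 \<le> n" "finite V \<and> card V = n \<and> (\<forall>m\<in>{1..s}. H m \<subseteq> nsets V 3)"
    then obtain t l W \<B> where "struct T V (H ` {1..s}) t l W \<B>" "good V (H ` {1..s}) t l W \<B>"
      using main[of V H] by auto
    then show "\<exists>(t :: nat) (l :: nat) (W :: nat \<Rightarrow> 'a set) (\<B> :: 'a set set set).
       1 \<le> t \<and> t0 \<le> t \<and> t \<le> T \<and> 1 \<le> l \<and> l0 \<le> l \<and> l \<le> T \<and>
       vertex_partition V t W \<and>
       equitable l t W \<B> \<and>
       ((\<forall>i\<in>{1..<t}. card (W i) \<le> card (W (Suc i))) \<and> card (W t) \<le> card (W 1) + 1) \<and>
       (\<forall>i j. 1 \<le> i \<and> i < j \<and> j \<le> t \<longrightarrow>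
          (\<forall>B\<in>pair_members W \<B> i j. graph_regular (\<delta>2 l) (1 / real l) (W i) (W j) B)) \<and>
       (\<forall>m\<in>{1..s}. weakly_regular (\<delta>2 l) t W (H m)) \<and>
       (\<forall>m\<in>{1..s}. regular_wrt_partition \<delta>3 (r t l) V t W \<B> (H m))"
      unfolding struct_def good_def regularized_def ball_simps
      by (intro exI[of _ t] exI[of _ l] exI[of _ W] exI[of _ \<B>]) blast
  qed
qed

end
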